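(* Let $(G_i \mid i \in I)$ be a family of groups, let $F$ be a free group, and let $G = F \ast \mathop{\ast}_{i\in I} G_i$ be the free product of $F$ and all the $G_i$. Let $\mathcal{F}$ be the set of all finitely generated subgroups $H$ of $G$ such that $H \cap G_i^{g} = \{1\}$ for each $g \in G$ and each $i \in I$, and assume that some element of $\mathcal{F}$ has rank at least two. Then $\sigma(\mathcal{F}) \ge \beta_2(G)\cdot\theta\alpha_3(G)$.
   Context: For $a,b \in G$ and $S \subseteq G$: $b^a := a^{-1}ba$ and $S^a := \{c^a \mid c \in S\}$. For a set $S$, $|S| \in \mathbb{N}\cup\{\infty\}$ is its cardinal if $S$ is finite, and $\infty$ otherwise. The rank of a group is the minimum of $|S|$ over its generating sets $S$. For a free group $H$, the reduced rank is $\bar r(H) := \max\{\operatorname{rank}(H)-1, 0\} \in \mathbb{N}\cup\{\infty\}$. By the Kurosh Subgroup Theorem, every element of $\mathcal{F}$ is a free group. Define $$\sigma(\mathcal{F}) := \sup\left\{ \frac{\bar r(H\cap K)}{\bar r(H)\cdot \bar r(K)} \;\middle|\; H,K\in\mathcal{F},\ \bar r(H)\cdot\bar r(K)\neq 0\right\} \in [1,\infty].$$ Define $\alpha_3(G) := \inf\{|L| : L \text{ is a subgroup of } G \text{ and } |L|\ge 3\}$, where the infimum of the empty set is $\infty$ (so $\alpha_3(G)$ is $\infty$, $4$, or an odd prime). Define $\theta:[3,\infty]\to[1,3]$ by $\theta(x) = \frac{x}{x-2}$ with $\theta(\infty)=1$, and write $\theta\alpha_3(G) := \theta(\alpha_3(G))$.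 Define $\beta_2(G) := 2$ if $G$ has a subgroup of order two, and $\beta_2(G) := 1$ otherwise. *)

theory Defs
  imports "HOL-Algebra.Generated_Groups" "HOL-Library.Extended_Real" "HOL-Library.Extended_Nat"
begin

section \<open>Free groups\<close>

text \<open>A word in the letters \<open>x\<close> and \<open>x\<inverse>\<close>, for \<open>x \<in> B\<close>, is a list of pairs \<open>(x, e)\<close>, where
  \<open>(x, True)\<close> stands for \<open>x\<close> and \<open>(x, False)\<close> for \<open>x\<inverse>\<close>.\<close>

definition group_word_value :: "('a, 'b) monoid_scheme \<Rightarrow> ('a \<times> bool) list \<Rightarrow> 'a" where
  "group_word_value F w =
     foldr (\<lambda>(x, e) a. (if e then x else inv\<^bsub>F\<^esub> x) \<otimes>\<^bsub>F\<^esub> a) w \<one>\<^bsub>F\<^esub>"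

definition reduced_group_words :: "'a set \<Rightarrow> ('a \<times> bool) list set" where
  "reduced_group_words B =
     {w \<in> lists (B \<times> UNIV). successively (\<lambda>(x, e) (y, d). \<not> (x = y \<and> e \<noteq> d)) w}"

definition free_basis :: "('a, 'b) monoid_scheme \<Rightarrow> 'a set \<Rightarrow> bool" where
  "free_basis F B \<longleftrightarrow> B \<subseteq> carrier F \<and>
     (\<forall>g\<in>carrier F. \<exists>!w. w \<in> reduced_group_words B \<and> group_word_value F w = g)"

definition free_group :: "('a, 'b) monoid_scheme \<Rightarrow> bool" where
  "free_group F \<longleftrightarrow> group F \<and> (\<exists>B. free_basis F B)"


section \<open>Free products\<close>

text \<open>The free product of a family of groups is the monoid of words in the disjoint union of
  the carriers, modulo the congruence generated by deleting identity letters and by multiplying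
  adjacent letters that come from the same group.\<close>

definition fp_words :: "'i set \<Rightarrow> ('i \<Rightarrow> ('a, 'b) monoid_scheme) \<Rightarrow> ('i \<times> 'a) list set" where
  "fp_words I \<G> = lists (SIGMA i:I. carrier (\<G> i))"

inductive fp_eq :: "'i set \<Rightarrow> ('i \<Rightarrow> ('a, 'b) monoid_scheme) \<Rightarrow>
    ('i \<times> 'a) list \<Rightarrow> ('i \<times> 'a) list \<Rightarrow> bool"
  for I :: "'i set" and \<G> :: "'i \<Rightarrow> ('a, 'b) monoid_scheme" where
  fp_refl: "w \<in> fp_words I \<G> \<Longrightarrow> fp_eq I \<G> w w"
| fp_sym: "fp_eq I \<G> v w \<Longrightarrow> fp_eq I \<G> w v"
| fp_trans: "fp_eq I \<G> u v \<Longrightarrow> fp_eq I \<G> v w \<Longrightarrow> fp_eq I \<G> u w"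
| fp_one: "u \<in> fp_words I \<G> \<Longrightarrow> v \<in> fp_words I \<G> \<Longrightarrow> i \<in> I \<Longrightarrow>
    fp_eq I \<G> (u @ [(i, \<one>\<^bsub>\<G> i\<^esub>)] @ v) (u @ v)"
| fp_mult: "u \<in> fp_words I \<G> \<Longrightarrow> v \<in> fp_words I \<G> \<Longrightarrow> i \<in> I \<Longrightarrow>
    x \<in> carrier (\<G> i) \<Longrightarrow> y \<in> carrier (\<G> i) \<Longrightarrow>
    fp_eq I \<G> (u @ [(i, x), (i, y)] @ v) (u @ [(i, x \<otimes>\<^bsub>\<G> i\<^esub> y)] @ v)"

definition fp_class :: "'i set \<Rightarrow> ('i \<Rightarrow> ('a, 'b) monoid_scheme) \<Rightarrow>
    ('i \<times> 'a) list \<Rightarrow> ('i \<times> 'a) list set" where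
  "fp_class I \<G> w = {v. fp_eq I \<G> w v}"

definition free_product :: "'i set \<Rightarrow> ('i \<Rightarrow> ('a, 'b) monoid_scheme) \<Rightarrow>
    ('i \<times> 'a) list set monoid" where
  "free_product I \<G> =
     \<lparr>carrier = fp_class I \<G> ` fp_words I \<G>,
      mult = (\<lambda>A B. \<Union>a\<in>A. \<Union>b\<in>B. fp_class I \<G> (a @ b)),
      one = fp_class I \<G> []\<rparr>"

definition fp_factor :: "'i set \<Rightarrow> ('i \<Rightarrow> ('a, 'b) monoid_scheme) \<Rightarrow> 'i \<Rightarrow>
    ('i \<times> 'a) list set set" where
  "fp_factor I \<G> i = (\<lambda>x. fp_class I \<G> [(i, x)]) ` carrier (\<G> i)"

lemma fp_words_append [simp]:
  "u @ v \<in> fp_words I \<G> \<longleftrightarrow> u \<in> fp_words I \<G> \<and> v \<in> fp_words I \<G>"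
  by (auto simp: fp_words_def)

lemma fp_words_Nil [simp]: "[] \<in> fp_words I \<G>"
  by (simp add: fp_words_def)

lemma fp_words_Cons [simp]:
  "(i, x) # v \<in> fp_words I \<G> \<longleftrightarrow> i \<in> I \<and> x \<in> carrier (\<G> i) \<and> v \<in> fp_words I \<G>"
  by (auto simp: fp_words_def)

context
  fixes I :: "'i set" and \<G> :: "'i \<Rightarrow> ('a, 'b) monoid_scheme"
  assumes groups: "\<And>i. i \<in> I \<Longrightarrow> group (\<G> i)"
begin

lemma fp_eq_words:
  assumes "fp_eq I \<G> u v"
  shows "u \<in> fp_words I \<G> \<and> v \<in> fp_words I \<G>"
  using assms
  by induction
    (simp_all add: monoid.one_closed monoid.m_closed group.is_monoid groups)

lemma fp_eq_append_left:
  assumes "fp_eq I \<G> u v" "w \<in> fp_words I \<G>"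
  shows "fp_eq I \<G> (w @ u) (w @ v)"
  using assms
proof induction
  case (fp_one u v i)
  then show ?case using fp_eq.fp_one[of "w @ u" I \<G> v i] by simp
next
  case (fp_mult u v i x y)
  then show ?case using fp_eq.fp_mult[of "w @ u" I \<G> v i x y] by simp
qed (simp add: fp_refl, blast intro: fp_sym, blast intro: fp_trans)

lemma fp_eq_append_right:
  assumes "fp_eq I \<G> u v" "w \<in> fp_words I \<G>"
  shows "fp_eq I \<G> (u @ w) (v @ w)"
  using assms
proof induction
  case (fp_one u v i)
  then show ?case using fp_eq.fp_one[of u I \<G> "v @ w" i] by simp
next
  case (fp_mult u v i x y)
  then show ?case using fp_eq.fp_mult[of u I \<G> "v @ w" i x y] by simp
qed (simp add: fp_refl, blast intro: fp_sym, blast intro: fp_trans)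

lemma fp_eq_append:
  assumes "fp_eq I \<G> u u'" "fp_eq I \<G> v v'"
  shows "fp_eq I \<G> (u @ v) (u' @ v')"
  using fp_trans[OF fp_eq_append_right[OF assms(1)] fp_eq_append_left[OF assms(2)]]
    fp_eq_words[OF assms(1)] fp_eq_words[OF assms(2)] by simp

lemma fp_class_eqI: "fp_eq I \<G> u v \<Longrightarrow> fp_class I \<G> u = fp_class I \<G> v"
  unfolding fp_class_def by (blast intro: fp_sym fp_trans)

lemma fp_class_eq_iff:
  assumes "u \<in> fp_words I \<G>" "v \<in> fp_words I \<G>"
  shows "fp_class I \<G> u = fp_class I \<G> v \<longleftrightarrow> fp_eq I \<G> u v"
  using assms fp_class_eqI fp_refl[of v I \<G>] unfolding fp_class_def by blast

lemma free_product_mult: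
  assumes "u \<in> fp_words I \<G>" "v \<in> fp_words I \<G>"
  shows "fp_class I \<G> u \<otimes>\<^bsub>free_product I \<G>\<^esub> fp_class I \<G> v = fp_class I \<G> (u @ v)"
proof -
  have "fp_class I \<G> (a @ b) = fp_class I \<G> (u @ v)"
    if "a \<in> fp_class I \<G> u" "b \<in> fp_class I \<G> v" for a b
    using that fp_class_eqI[OF fp_eq_append[of u a v b]] by (simp add: fp_class_def)
  moreover have "u \<in> fp_class I \<G> u" "v \<in> fp_class I \<G> v"
    using assms by (auto simp: fp_class_def intro: fp_refl)
  ultimately have "(\<Union>a\<in>fp_class I \<G> u. \<Union>b\<in>fp_class I \<G> v. fp_class I \<G> (a @ b))
      = fp_class I \<G> (u @ v)"
    by blast
  then show ?thesis
    by (simp add: free_product_def)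
qed

lemma fp_left_inverse:
  "w \<in> fp_words I \<G> \<Longrightarrow> \<exists>v\<in>fp_words I \<G>. fp_eq I \<G> (v @ w) []"
proof (induction w)
  case Nil
  then show ?case by (auto intro!: bexI[of _ "[]"] fp_refl)
next
  case (Cons p w)
  obtain i x where p: "p = (i, x)" by force
  with Cons.prems have i: "i \<in> I" "x \<in> carrier (\<G> i)" "w \<in> fp_words I \<G>"
    by auto
  interpret group "\<G> i" using groups i(1) .
  obtain v where v: "v \<in> fp_words I \<G>" "fp_eq I \<G> (v @ w) []"
    using Cons.IH i by auto
  have "fp_eq I \<G> (v @ [(i, inv\<^bsub>\<G> i\<^esub> x), (i, x)] @ w) (v @ [(i, inv\<^bsub>\<G> i\<^esub> x \<otimes>\<^bsub>\<G> i\<^esub> x)] @ w)"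
    using v i by (intro fp_mult) auto
  moreover have "fp_eq I \<G> (v @ [(i, \<one>\<^bsub>\<G> i\<^esub>)] @ w) (v @ w)"
    using v i by (intro fp_one) auto
  ultimately have "fp_eq I \<G> ((v @ [(i, inv\<^bsub>\<G> i\<^esub> x)]) @ p # w) []"
    using v(2) i p by (simp add: fp_trans[OF _ fp_trans])
  then show ?case
    using v(1) i by (intro bexI[of _ "v @ [(i, inv\<^bsub>\<G> i\<^esub> x)]"]) auto
qed

lemma free_product_group: "group (free_product I \<G>)"
proof (rule groupI)
  have carrier: "carrier (free_product I \<G>) = fp_class I \<G> ` fp_words I \<G>"
    and one: "\<one>\<^bsub>free_product I \<G>\<^esub> = fp_class I \<G> []"
    by (simp_all add: free_product_def)
  show "\<one>\<^bsub>free_product I \<G>\<^esub> \<in> carrier (free_product I \<G>)"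
    by (simp add: carrier one)
  fix x assume "x \<in> carrier (free_product I \<G>)"
  then obtain u where u: "u \<in> fp_words I \<G>" "x = fp_class I \<G> u"
    by (auto simp: carrier)
  show "\<one>\<^bsub>free_product I \<G>\<^esub> \<otimes>\<^bsub>free_product I \<G>\<^esub> x = x"
    using u by (simp add: one free_product_mult)
  show "\<exists>y\<in>carrier (free_product I \<G>). y \<otimes>\<^bsub>free_product I \<G>\<^esub> x = \<one>\<^bsub>free_product I \<G>\<^esub>"
  proof -
    obtain v where v: "v \<in> fp_words I \<G>" "fp_eq I \<G> (v @ u) []"
      using fp_left_inverse u by blast
    then have "fp_class I \<G> v \<otimes>\<^bsub>free_product I \<G>\<^esub> x = \<one>\<^bsub>free_product I \<G>\<^esub>"
      using u fp_class_eqI by (simp add: one free_product_mult)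
    with v show ?thesis by (auto simp: carrier)
  qed
  fix y assume "y \<in> carrier (free_product I \<G>)"
  then obtain v where v: "v \<in> fp_words I \<G>" "y = fp_class I \<G> v"
    by (auto simp: carrier)
  show "x \<otimes>\<^bsub>free_product I \<G>\<^esub> y \<in> carrier (free_product I \<G>)"
    using u v by (auto simp: carrier free_product_mult)
  fix z assume "z \<in> carrier (free_product I \<G>)"
  then obtain w where "w \<in> fp_words I \<G>" "z = fp_class I \<G> w"
    by (auto simp: carrier)
  then show "x \<otimes>\<^bsub>free_product I \<G>\<^esub> y \<otimes>\<^bsub>free_product I \<G>\<^esub> z =
      x \<otimes>\<^bsub>free_product I \<G>\<^esub> (y \<otimes>\<^bsub>free_product I \<G>\<^esub> z)"
    using u v by (simp add: free_product_mult)
qed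

end

text \<open>The free product of a group \<open>F\<close> and a family \<open>(\<G> i)\<^sub>i\<^sub>\<in>\<^sub>I\<close> is the free product of the family
  enlarged by \<open>F\<close>; the new index \<open>None\<close> belongs to \<open>F\<close>, and \<open>Some i\<close> to \<open>\<G> i\<close>.\<close>

definition with_index :: "'i set \<Rightarrow> 'i option set" where
  "with_index I = insert None (Some ` I)"

definition with_factor :: "('a, 'b) monoid_scheme \<Rightarrow> ('i \<Rightarrow> ('a, 'b) monoid_scheme) \<Rightarrow>
    'i option \<Rightarrow> ('a, 'b) monoid_scheme" where
  "with_factor F \<G> j = (case j of None \<Rightarrow> F | Some i \<Rightarrow> \<G> i)"

definition free_product_with :: "('a, 'b) monoid_scheme \<Rightarrow> 'i set \<Rightarrow>
    ('i \<Rightarrow> ('a, 'b) monoid_scheme) \<Rightarrow> ('i option \<times> 'a) list set monoid" where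
  "free_product_with F I \<G> = free_product (with_index I) (with_factor F \<G>)"

text \<open>The copy of \<open>\<G> i\<close> inside \<open>free_product_with F I \<G>\<close>:\<close>

definition factor_subgroup :: "('a, 'b) monoid_scheme \<Rightarrow> 'i set \<Rightarrow>
    ('i \<Rightarrow> ('a, 'b) monoid_scheme) \<Rightarrow> 'i \<Rightarrow> ('i option \<times> 'a) list set set" where
  "factor_subgroup F I \<G> i = fp_factor (with_index I) (with_factor F \<G>) (Some i)"


section \<open>Ranks and the invariants of a group\<close>

definition conjugate :: "('a, 'b) monoid_scheme \<Rightarrow> 'a set \<Rightarrow> 'a \<Rightarrow> 'a set" where
  "conjugate G S a = (\<lambda>c. inv\<^bsub>G\<^esub> a \<otimes>\<^bsub>G\<^esub> c \<otimes>\<^bsub>G\<^esub> a) ` S"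

definition ecard :: "'a set \<Rightarrow> enat" where
  "ecard S = (if finite S then enat (card S) else \<infinity>)"

definition group_rank :: "('a, 'b) monoid_scheme \<Rightarrow> enat" where
  "group_rank H = (INF S\<in>{S. S \<subseteq> carrier H \<and> generate H S = carrier H}. ecard S)"

text \<open>Subtraction on \<^typ>\<open>enat\<close> is truncated, so this is \<open>max {rank H - 1, 0}\<close>.\<close>

definition reduced_rank :: "('a, 'b) monoid_scheme \<Rightarrow> enat" where
  "reduced_rank H = group_rank H - 1"

definition fin_gen_subgroup :: "'a set \<Rightarrow> ('a, 'b) monoid_scheme \<Rightarrow> bool" where
  "fin_gen_subgroup H G \<longleftrightarrow> subgroup H G \<and>
     (\<exists>S. finite S \<and> S \<subseteq> carrier G \<and> H = generate G S)"

definition factor_free_subgroups :: "('a, 'b) monoid_scheme \<Rightarrow> 'i set \<Rightarrow>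
    ('i \<Rightarrow> ('a, 'b) monoid_scheme) \<Rightarrow> ('i option \<times> 'a) list set set set" where
  "factor_free_subgroups F I \<G> =
     {H. fin_gen_subgroup H (free_product_with F I \<G>) \<and>
         (\<forall>g\<in>carrier (free_product_with F I \<G>). \<forall>i\<in>I.
            H \<inter> conjugate (free_product_with F I \<G>) (factor_subgroup F I \<G> i) g
              = {\<one>\<^bsub>free_product_with F I \<G>\<^esub>})}"

definition sigma_ratio :: "('a, 'b) monoid_scheme \<Rightarrow> 'a set set \<Rightarrow> ereal" where
  "sigma_ratio G \<F> =
     Sup {ereal_of_enat (reduced_rank (G\<lparr>carrier := H \<inter> K\<rparr>)) /
          ereal_of_enat (reduced_rank (G\<lparr>carrier := H\<rparr>) * reduced_rank (G\<lparr>carrier := K\<rparr>))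
          | H K. H \<in> \<F> \<and> K \<in> \<F> \<and>
            reduced_rank (G\<lparr>carrier := H\<rparr>) * reduced_rank (G\<lparr>carrier := K\<rparr>) \<noteq> 0}"

definition alpha3 :: "('a, 'b) monoid_scheme \<Rightarrow> enat" where
  "alpha3 G = (INF L\<in>{L. subgroup L G \<and> 3 \<le> ecard L}. ecard L)"

definition theta :: "ereal \<Rightarrow> ereal" where
  "theta x = (if x = \<infinity> then 1 else x / (x - 2))"

definition beta2 :: "('a, 'b) monoid_scheme \<Rightarrow> ereal" where
  "beta2 G = (if \<exists>L. subgroup L G \<and> ecard L = 2 then 2 else 1)"

end

theory Submission
  imports Defs "HOL-Library.Sublist" "HOL-Algebra.Multiplicative_Group"
begin

text \<open>
A free product \<open>P\<close> of finitely many finite groups \<open>A\<^sub>1, \<dots>, A\<^sub>k\<close> has the rational Euler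
  characteristic \<open>\<chi>(P) = 1/|A\<^sub>1| + \<dots> + 1/|A\<^sub>k| - (k - 1)\<close>, and a torsion-free subgroup \<open>H\<close> of index \<open>q\<close>
  is free with \<open>r(H) = - q \<chi>(P)\<close>, where \<open>r\<close> is the reduced rank. Let \<open>H\<close> be the kernel of a homomorphism
  from \<open>P\<close> to a group \<open>Q\<close> of order \<open>q\<close> that is injective on each \<open>A\<^sub>l\<close>, and let \<open>K\<close> be a free
  subgroup of finite rank at least two that is mapped onto \<open>Q\<close> and meets the conjugates of the factors trivially.
  Then \<open>H \<inter> K\<close> has index \<open>q\<close> in \<open>K\<close>, so \<open>r(H \<inter> K) = q r(K)\<close> by the Schreier index formula,
  and the ratio of \<open>H\<close> and \<open>K\<close> is \<open>q / r(H) = 1 / (- \<chi>(P))\<close>. It remains to find a suitable \<open>P\<close> in \<open>G\<close>: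

  \<^item> if \<open>\<alpha>\<^sub>3(G) = n\<close> is finite, then \<open>A * A\<close> with \<open>|A| = n\<close> has ratio \<open>n/(n - 2) = \<theta>(n)\<close>;
  \<^item> if there is also an involution, then \<open>A * C\<^sub>2\<close> has ratio \<open>2n/(n - 2) = 2 \<theta>(n)\<close>;
  \<^item> if \<open>\<alpha>\<^sub>3(G) = \<infinity>\<close> and there is an involution, then \<open>C\<^sub>2 * C\<^sub>2 * C\<^sub>2\<close> has ratio \<open>2\<close>;
  \<^item> if neither is available, then \<open>H = K = \<langle>x, y\<rangle>\<close>, for two elements of a member of rank at least two
    that generate a noncyclic group, has ratio \<open>1\<close>.

  A nontrivial finite subgroup of \<open>G\<close> is conjugate into a factor, which then has a subgroup of the same
  order (\<open>finite_subgroup_in_factor\<close>); this factor is not \<open>F\<close>, which is torsion-free. The groups \<open>A\<^sub>l\<close> are conjugates of finite subgroups of the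
  factors by elements that keep them in free position; \<open>emb_inj\<close> shows that they generate their free
  product, and \<open>emb_conj_letter\<close> that an element of it lies in a conjugate of a factor of \<open>G\<close> only if it
  lies in a conjugate of some \<open>A\<^sub>l\<close>.

  The ranks of \<open>H\<close> and \<open>K\<close> are bounded above by explicit generators. The lower bound for \<open>H \<inter> K\<close> comes from counting
  homomorphisms to the group of order two (\<open>kernel_rank_lower_bound\<close>). They are obtained from actions
  of \<open>P\<close> in which the generators of \<open>K\<close> act on the fibre over a base point by prescribed
  permutations (\<open>prescribed_action\<close>); such actions exist because an action of a free
  product is an arbitrary family of actions of its factors.
\<close>

section \<open>Free products as universal objects\<close>

locale free_product_of_groups =
  fixes I :: "'i set" and \<G> :: "'i \<Rightarrow> ('a, 'b) monoid_scheme"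
  assumes factor_group: "i \<in> I \<Longrightarrow> group (\<G> i)"
begin

definition \<P> :: "('i \<times> 'a) list set monoid" where
  "\<P> = free_product I \<G>"

definition cl :: "('i \<times> 'a) list \<Rightarrow> ('i \<times> 'a) list set" where
  "cl w = fp_class I \<G> w"

abbreviation letter :: "'i \<Rightarrow> 'a \<Rightarrow> ('i \<times> 'a) list set" where
  "letter i x \<equiv> cl [(i, x)]"

abbreviation words :: "('i \<times> 'a) list set" where
  "words \<equiv> fp_words I \<G>"

sublocale P: group \<P>
  unfolding \<P>_def by (rule free_product_group[OF factor_group])

lemma cl_eqI: "fp_eq I \<G> v w \<Longrightarrow> cl v = cl w"
  unfolding cl_def by (rule fp_class_eqI[OF factor_group])

lemma cl_eq_iff: "v \<in> words \<Longrightarrow> w \<in> words \<Longrightarrow> cl v = cl w \<longleftrightarrow> fp_eq I \<G> v w"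
  unfolding cl_def by (rule fp_class_eq_iff[OF factor_group])

lemma carrier_P: "carrier \<P> = cl ` words"
  unfolding \<P>_def cl_def by (simp add: free_product_def)

lemma words_index: "w \<in> words \<Longrightarrow> p \<in> set w \<Longrightarrow> fst p \<in> I"
  by (induction w) auto

lemma cl_closed [simp, intro]: "w \<in> words \<Longrightarrow> cl w \<in> carrier \<P>"
  by (simp add: carrier_P)

lemma one_P: "\<one>\<^bsub>\<P>\<^esub> = cl []"
  unfolding \<P>_def cl_def by (simp add: free_product_def)

lemma cl_append: "v \<in> words \<Longrightarrow> w \<in> words \<Longrightarrow> cl (v @ w) = cl v \<otimes>\<^bsub>\<P>\<^esub> cl w"
  unfolding \<P>_def cl_def by (rule free_product_mult[OF factor_group, symmetric])

lemma cl_Cons: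
  "i \<in> I \<Longrightarrow> x \<in> carrier (\<G> i) \<Longrightarrow> w \<in> words \<Longrightarrow> cl ((i, x) # w) = letter i x \<otimes>\<^bsub>\<P>\<^esub> cl w"
  using cl_append[of "[(i, x)]" w] by simp

lemma letter_mult:
  "i \<in> I \<Longrightarrow> x \<in> carrier (\<G> i) \<Longrightarrow> y \<in> carrier (\<G> i) \<Longrightarrow>
    letter i (x \<otimes>\<^bsub>\<G> i\<^esub> y) = letter i x \<otimes>\<^bsub>\<P>\<^esub> letter i y"
  using cl_append[of "[(i, x)]" "[(i, y)]"] cl_eqI[OF fp_mult[of "[]" I \<G> "[]" i x y]] by simp

lemma letter_one: "i \<in> I \<Longrightarrow> letter i \<one>\<^bsub>\<G> i\<^esub> = \<one>\<^bsub>\<P>\<^esub>"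
  using cl_eqI[OF fp_one[of "[]" I \<G> "[]" i]] by (simp add: one_P)

lemma letter_hom: "i \<in> I \<Longrightarrow> letter i \<in> hom (\<G> i) \<P>"
  by (auto simp: hom_def letter_mult)

lemma letter_inv:
  assumes "i \<in> I" "x \<in> carrier (\<G> i)"
  shows "letter i (inv\<^bsub>\<G> i\<^esub> x) = inv\<^bsub>\<P>\<^esub> (letter i x)"
proof -
  interpret Gi: group "\<G> i" using factor_group assms(1) .
  show ?thesis
    using assms letter_mult[of i "inv\<^bsub>\<G> i\<^esub> x" x] letter_one
    by (intro P.inv_equality[symmetric]) auto
qed

lemma carrier_induct [consumes 1, case_names one letter]:
  assumes "g \<in> carrier \<P>"
    and "Q \<one>\<^bsub>\<P>\<^esub>"
    and "\<And>i x h. i \<in> I \<Longrightarrow> x \<in> carrier (\<G> i) \<Longrightarrow> h \<in> carrier \<P> \<Longrightarrow> Q h \<Longrightarrow> Q (letter i x \<otimes>\<^bsub>\<P>\<^esub> h)"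
  shows "Q g"
proof -
  have "w \<in> words \<Longrightarrow> Q (cl w)" for w
  proof (induction w)
    case (Cons p w)
    then show ?case
      using assms(3)[of "fst p" "snd p" "cl w"] cl_Cons[of "fst p" "snd p" w]
      by (cases p) auto
  qed (use assms(2) one_P in simp)
  with assms(1) show ?thesis by (auto simp: carrier_P)
qed

end

definition acts_on :: "('g, 'm) monoid_scheme \<Rightarrow> 'y set \<Rightarrow> ('g \<Rightarrow> 'y \<Rightarrow> 'y) \<Rightarrow> bool" where
  "acts_on G Y act \<longleftrightarrow> (\<forall>y\<in>Y. act \<one>\<^bsub>G\<^esub> y = y) \<and>
     (\<forall>g\<in>carrier G. \<forall>y\<in>Y. act g y \<in> Y \<and>
        (\<forall>h\<in>carrier G. act (h \<otimes>\<^bsub>G\<^esub> g) y = act h (act g y)))"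

lemma acts_onD:
  assumes "acts_on G Y act" "y \<in> Y"
  shows "act \<one>\<^bsub>G\<^esub> y = y"
    and "g \<in> carrier G \<Longrightarrow> act g y \<in> Y"
    and "g \<in> carrier G \<Longrightarrow> h \<in> carrier G \<Longrightarrow> act (h \<otimes>\<^bsub>G\<^esub> g) y = act h (act g y)"
  using assms unfolding acts_on_def by blast+

lemma (in group) acts_on_inv:
  assumes "acts_on G Y act" "y \<in> Y" "g \<in> carrier G"
  shows "act (inv g) (act g y) = y" "act g (act (inv g) y) = y"
  using acts_onD[OF assms(1,2)] assms(3)
  by (metis inv_closed l_inv r_inv)+

context free_product_of_groups
begin

text \<open>The universal property of the free product, for actions: the letters of a word act one after the
  other, and this respects both generating relations of the congruence.\<close>

theorem action_extends:
  assumes act: "\<And>i. i \<in> I \<Longrightarrow> acts_on (\<G> i) Y (\<rho> i)"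
  obtains act where "acts_on \<P> Y act"
    "\<And>i x y. i \<in> I \<Longrightarrow> x \<in> carrier (\<G> i) \<Longrightarrow> y \<in> Y \<Longrightarrow> act (letter i x) y = \<rho> i x y"
proof -
  define run where "run w y = foldr (\<lambda>(i, x). \<rho> i x) w y" for w y
  have run_append: "run (v @ w) y = run v (run w y)" for v w y
    by (simp add: run_def)
  have run_closed: "w \<in> words \<Longrightarrow> y \<in> Y \<Longrightarrow> run w y \<in> Y" for w y
    by (induction w) (auto simp: run_def intro: acts_onD(2)[OF act])
  have run_eq: "fp_eq I \<G> v w \<Longrightarrow> \<forall>y\<in>Y. run v y = run w y" for v w
  proof (induction rule: fp_eq.induct)
    case (fp_one u v i)
    have "run [(i, \<one>\<^bsub>\<G> i\<^esub>)] y = y" if "y \<in> Y" for y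
      using acts_onD(1)[OF act[OF fp_one(3)] that] by (simp add: run_def)
    with fp_one show ?case by (metis run_append run_closed)
  next
    case (fp_mult u v i x y)
    have "run [(i, x), (i, y)] z = run [(i, x \<otimes>\<^bsub>\<G> i\<^esub> y)] z" if "z \<in> Y" for z
      using acts_onD(3)[OF act[OF fp_mult(3)] that fp_mult(5,4)] by (simp add: run_def)
    with fp_mult show ?case by (metis run_append run_closed)
  qed auto
  define act' where "act' g y = run (SOME w. w \<in> words \<and> cl w = g) y" for g y
  have act': "act' (cl w) y = run w y" if "w \<in> words" "y \<in> Y" for w y
  proof -
    let ?v = "SOME v. v \<in> words \<and> cl v = cl w"
    have "?v \<in> words \<and> cl ?v = cl w"
      by (rule someI[of _ w]) (use that in auto)
    then have "fp_eq I \<G> ?v w"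
      using cl_eq_iff that by blast
    then show ?thesis
      using run_eq that unfolding act'_def by blast
  qed
  show ?thesis
  proof (rule that[of act'])
    show "acts_on \<P> Y act'"
      unfolding acts_on_def
    proof (intro conjI ballI)
      fix y assume y: "y \<in> Y"
      show "act' \<one>\<^bsub>\<P>\<^esub> y = y"
        using act'[of "[]" y] y by (simp add: one_P run_def)
      fix g assume "g \<in> carrier \<P>"
      then obtain w where w: "w \<in> words" "g = cl w" by (auto simp: carrier_P)
      show "act' g y \<in> Y" using act' w y run_closed by simp
      fix h assume "h \<in> carrier \<P>"
      then obtain v where v: "v \<in> words" "h = cl v" by (auto simp: carrier_P)
      have "act' (h \<otimes>\<^bsub>\<P>\<^esub> g) y = run (v @ w) y"
        using act'[of "v @ w"] v w y cl_append by simp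
      then show "act' (h \<otimes>\<^bsub>\<P>\<^esub> g) y = act' h (act' g y)"
        using act' v w y run_closed run_append by simp
    qed
    show "act' (letter i x) y = \<rho> i x y" if "i \<in> I" "x \<in> carrier (\<G> i)" "y \<in> Y" for i x y
      using act'[of "[(i, x)]" y] that by (simp add: run_def)
  qed
qed

text \<open>The universal property for homomorphisms follows from the one for actions: let each factor act on \<open>Q\<close>
  by left multiplication through its homomorphism, and look at the orbit of the unit.\<close>

theorem hom_extends:
  assumes Q: "group Q" and f: "\<And>i. i \<in> I \<Longrightarrow> f i \<in> hom (\<G> i) Q"
  obtains h where "h \<in> hom \<P> Q"
    "\<And>i x. i \<in> I \<Longrightarrow> x \<in> carrier (\<G> i) \<Longrightarrow> h (letter i x) = f i x"
proof -
  interpret Q: group Q by fact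
  have fc: "f i x \<in> carrier Q" if "i \<in> I" "x \<in> carrier (\<G> i)" for i x
    using f[OF that(1)] that(2) by (auto simp: hom_def)
  have "acts_on (\<G> i) (carrier Q) (\<lambda>x y. f i x \<otimes>\<^bsub>Q\<^esub> y)" if i: "i \<in> I" for i
  proof -
    interpret Gi: group "\<G> i" using factor_group i .
    interpret fi: group_hom "\<G> i" Q "f i" by unfold_locales (use f i in auto)
    show ?thesis by (auto simp: acts_on_def Q.m_assoc)
  qed
  then obtain act where act: "acts_on \<P> (carrier Q) act"
    and l: "\<And>i x y. i \<in> I \<Longrightarrow> x \<in> carrier (\<G> i) \<Longrightarrow> y \<in> carrier Q \<Longrightarrow>
      act (letter i x) y = f i x \<otimes>\<^bsub>Q\<^esub> y"
    using action_extends[of "carrier Q" "\<lambda>i x y. f i x \<otimes>\<^bsub>Q\<^esub> y"] by blast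
  note actD = acts_onD[OF act]
  have tr: "\<forall>y\<in>carrier Q. act g y = act g \<one>\<^bsub>Q\<^esub> \<otimes>\<^bsub>Q\<^esub> y" if "g \<in> carrier \<P>" for g
    using that
  proof (induction rule: carrier_induct)
    case (letter i x h)
    have "act (letter i x \<otimes>\<^bsub>\<P>\<^esub> h) y = f i x \<otimes>\<^bsub>Q\<^esub> (act h \<one>\<^bsub>Q\<^esub> \<otimes>\<^bsub>Q\<^esub> y)" if "y \<in> carrier Q" for y
    proof -
      have lc: "letter i x \<in> carrier \<P>" using letter by simp
      have "act (letter i x \<otimes>\<^bsub>\<P>\<^esub> h) y = act (letter i x) (act h y)"
        by (rule actD(3)[OF that letter(3) lc])
      also have "\<dots> = f i x \<otimes>\<^bsub>Q\<^esub> act h y"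
        by (rule l[OF letter(1,2) actD(2)[OF that letter(3)]])
      also have "act h y = act h \<one>\<^bsub>Q\<^esub> \<otimes>\<^bsub>Q\<^esub> y"
        using letter(4) that by blast
      finally show ?thesis .
    qed
    moreover have "act h \<one>\<^bsub>Q\<^esub> \<in> carrier Q" "f i x \<in> carrier Q"
      using letter(1-3) fc actD(2) by auto
    ultimately show ?case
      by (simp add: Q.m_assoc)
  qed (use actD in auto)
  show ?thesis
  proof (rule that[of "\<lambda>g. act g \<one>\<^bsub>Q\<^esub>"])
    show "(\<lambda>g. act g \<one>\<^bsub>Q\<^esub>) \<in> hom \<P> Q"
    proof (rule homI)
      fix g h assume gh: "g \<in> carrier \<P>" "h \<in> carrier \<P>"
      show "act g \<one>\<^bsub>Q\<^esub> \<in> carrier Q" using actD(2) gh by simp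
      have "act (g \<otimes>\<^bsub>\<P>\<^esub> h) \<one>\<^bsub>Q\<^esub> = act g (act h \<one>\<^bsub>Q\<^esub>)"
        by (rule actD(3)) (use gh in auto)
      also have "\<dots> = act g \<one>\<^bsub>Q\<^esub> \<otimes>\<^bsub>Q\<^esub> act h \<one>\<^bsub>Q\<^esub>"
        using tr[OF gh(1)] actD(2)[OF Q.one_closed gh(2)] by blast
      finally show "act (g \<otimes>\<^bsub>\<P>\<^esub> h) \<one>\<^bsub>Q\<^esub> = act g \<one>\<^bsub>Q\<^esub> \<otimes>\<^bsub>Q\<^esub> act h \<one>\<^bsub>Q\<^esub>" .
    qed
    show "act (letter i x) \<one>\<^bsub>Q\<^esub> = f i x" if "i \<in> I" "x \<in> carrier (\<G> i)" for i x
      using l[OF that, of "\<one>\<^bsub>Q\<^esub>"] fc[OF that] by simp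
  qed
qed

end

section \<open>Normal forms\<close>

context free_product_of_groups
begin

definition reduced :: "('i \<times> 'a) list \<Rightarrow> bool" where
  "reduced w \<longleftrightarrow> w \<in> words \<and> (\<forall>(i, x)\<in>set w. x \<noteq> \<one>\<^bsub>\<G> i\<^esub>) \<and> distinct_adj (map fst w)"

lemma reduced_Nil [simp]: "reduced []"
  by (simp add: reduced_def)

lemma reduced_Cons:
  "reduced ((i, x) # w) \<longleftrightarrow> i \<in> I \<and> x \<in> carrier (\<G> i) \<and> x \<noteq> \<one>\<^bsub>\<G> i\<^esub> \<and> reduced w \<and>
     (w = [] \<or> fst (hd w) \<noteq> i)"
  by (cases w) (auto simp: reduced_def)

lemma reduced_append:
  "reduced (v @ w) \<longleftrightarrow> reduced v \<and> reduced w \<and> (v = [] \<or> w = [] \<or> fst (last v) \<noteq> fst (hd w))"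
  by (auto simp: reduced_def distinct_adj_append_iff last_map hd_map)

lemma reduced_words [dest]: "reduced w \<Longrightarrow> w \<in> words"
  by (simp add: reduced_def)

text \<open>Normal forms are established by van der Waerden's method: \<open>\<G> i\<close> acts on the reduced words. A reduced
  word is split into its first letter from \<open>\<G> i\<close>, which is the unit if there is none, and a rest
  that does not start in \<open>\<G> i\<close>; an element of \<open>\<G> i\<close> multiplies the first part.\<close>

definition push :: "'i \<Rightarrow> 'a \<Rightarrow> ('i \<times> 'a) list \<Rightarrow> ('i \<times> 'a) list" where
  "push i x w = (if x = \<one>\<^bsub>\<G> i\<^esub> then w else (i, x) # w)"

definition head_part :: "'i \<Rightarrow> ('i \<times> 'a) list \<Rightarrow> 'a" where
  "head_part i w = (if w \<noteq> [] \<and> fst (hd w) = i then snd (hd w) else \<one>\<^bsub>\<G> i\<^esub>)"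

definition tail_part :: "'i \<Rightarrow> ('i \<times> 'a) list \<Rightarrow> ('i \<times> 'a) list" where
  "tail_part i w = (if w \<noteq> [] \<and> fst (hd w) = i then tl w else w)"

definition mult_letter :: "'i \<Rightarrow> 'a \<Rightarrow> ('i \<times> 'a) list \<Rightarrow> ('i \<times> 'a) list" where
  "mult_letter i x w = push i (x \<otimes>\<^bsub>\<G> i\<^esub> head_part i w) (tail_part i w)"

lemma split_head:
  assumes "i \<in> I" "reduced w"
  shows "head_part i w \<in> carrier (\<G> i)" "reduced (tail_part i w)"
    "tail_part i w = [] \<or> fst (hd (tail_part i w)) \<noteq> i"
    "push i (head_part i w) (tail_part i w) = w"
  using assms factor_group[OF assms(1), THEN group.is_monoid, THEN monoid.one_closed]
  by (cases w; auto simp: head_part_def tail_part_def push_def reduced_Cons)+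

lemma push_parts:
  assumes "i \<in> I" "x \<in> carrier (\<G> i)" "reduced w" "w = [] \<or> fst (hd w) \<noteq> i"
  shows "reduced (push i x w)" "head_part i (push i x w) = x" "tail_part i (push i x w) = w"
  using assms by (auto simp: head_part_def tail_part_def push_def reduced_Cons)

lemma cl_push:
  assumes "i \<in> I" "x \<in> carrier (\<G> i)" "w \<in> words"
  shows "cl (push i x w) = letter i x \<otimes>\<^bsub>\<P>\<^esub> cl w"
  using assms cl_Cons[OF assms] by (simp add: push_def letter_one)

lemma cl_mult_letter:
  assumes "i \<in> I" "x \<in> carrier (\<G> i)" "reduced w"
  shows "cl (mult_letter i x w) = letter i x \<otimes>\<^bsub>\<P>\<^esub> cl w"
proof -
  interpret Gi: group "\<G> i" using factor_group assms(1) .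
  note s = split_head[OF assms(1,3)]
  have "cl w = letter i (head_part i w) \<otimes>\<^bsub>\<P>\<^esub> cl (tail_part i w)"
    using cl_push[of i "head_part i w" "tail_part i w"] s assms by auto
  then show ?thesis
    unfolding mult_letter_def
    using s assms reduced_words[OF s(2)]
    by (subst cl_push) (auto simp: letter_mult P.m_assoc)
qed

lemma mult_letter_acts:
  assumes i: "i \<in> I"
  shows "acts_on (\<G> i) {w. reduced w} (mult_letter i)"
proof -
  interpret Gi: group "\<G> i" using factor_group i .
  show ?thesis
    unfolding acts_on_def mult_letter_def
    by (auto simp: split_head[OF i] push_parts[OF i] Gi.m_assoc)
qed

text \<open>Freeness of this action lets fixed points detect conjugates of letters: a subgroup
  with a fixed point in an action where all factors act freely meets their conjugates trivially.\<close>

lemma mult_letter_free: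
  assumes "i \<in> I" "x \<in> carrier (\<G> i)" "reduced w" "mult_letter i x w = w"
  shows "x = \<one>\<^bsub>\<G> i\<^esub>"
proof -
  interpret Gi: group "\<G> i" using factor_group assms(1) .
  note s = split_head[OF assms(1,3)]
  have "x \<otimes>\<^bsub>\<G> i\<^esub> head_part i w = head_part i w"
    using assms(4) push_parts(2)[OF assms(1) _ s(2,3), of "x \<otimes>\<^bsub>\<G> i\<^esub> head_part i w"] s(1) assms(2)
    unfolding mult_letter_def by simp
  then show ?thesis using s(1) assms(2) by (simp add: Gi.r_cancel_one)
qed

lemma mult_letter_Cons:
  assumes "reduced ((i, x) # w)"
  shows "mult_letter i x w = (i, x) # w"
proof -
  have i: "i \<in> I" using assms by (simp add: reduced_Cons)
  interpret Gi: group "\<G> i" using factor_group i .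
  show ?thesis
    using assms by (auto simp: mult_letter_def head_part_def tail_part_def push_def reduced_Cons)
qed

text \<open>A reduced word can be recovered from its class: it is the image of the empty word under the action.\<close>

theorem reduced_unique:
  assumes "reduced v" "reduced w" "cl v = cl w"
  shows "v = w"
proof -
  obtain act where act: "acts_on \<P> {w. reduced w} act"
    and l: "\<And>i x y. i \<in> I \<Longrightarrow> x \<in> carrier (\<G> i) \<Longrightarrow> y \<in> {w. reduced w} \<Longrightarrow>
      act (letter i x) y = mult_letter i x y"
    using action_extends[OF mult_letter_acts] by blast
  note actD = acts_onD[OF act]
  have "reduced u \<Longrightarrow> act (cl u) [] = u" for u
  proof (induction u)
    case (Cons p u)
    obtain i x where p: "p = (i, x)" by force
    have "act (cl (p # u)) [] = act (letter i x) (act (cl u) [])"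
      using Cons.prems p cl_Cons[of i x u] actD(3)[of "[]" "cl u" "letter i x"]
      by (auto simp: reduced_Cons dest!: reduced_words)
    also have "\<dots> = p # u"
      using Cons p l[of i x u] mult_letter_Cons[of i x u] by (auto simp: reduced_Cons)
    finally show ?case .
  qed (use actD(1) one_P in auto)
  from this[OF assms(1)] this[OF assms(2)] show ?thesis unfolding assms(3) by (rule trans[OF sym])
qed

lemma reduced_length_exists:
  assumes "w \<in> words"
  obtains v where "reduced v" "cl v = cl w" "length v \<le> length w"
proof -
  have "w \<in> words \<Longrightarrow> \<exists>v. reduced v \<and> cl v = cl w \<and> length v \<le> length w" for w
  proof (induction w)
    case (Cons p w)
    obtain i x where p: "p = (i, x)" by force
    obtain v where v: "reduced v" "cl v = cl w" "length v \<le> length w"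
      using Cons p by auto
    have "length (mult_letter i x v) \<le> Suc (length v)"
      by (auto simp: mult_letter_def push_def tail_part_def)
    moreover have "cl (mult_letter i x v) = cl (p # w)"
      using Cons.prems p v cl_mult_letter[of i x v] cl_Cons[of i x w] by auto
    moreover have "reduced (mult_letter i x v)"
      using acts_onD(2)[OF mult_letter_acts, of i v x] Cons.prems p v by auto
    ultimately show ?case using v(3) by auto
  qed auto
  with assms that show ?thesis by blast
qed

lemma reduced_exists:
  assumes "g \<in> carrier \<P>"
  obtains v where "reduced v" "cl v = g"
proof -
  obtain w where "w \<in> words" "cl w = g" using assms by (auto simp: carrier_P)
  then show ?thesis using reduced_length_exists that by metis
qed

lemma letter_eq_one_iff:
  assumes "i \<in> I" "x \<in> carrier (\<G> i)"
  shows "letter i x = \<one>\<^bsub>\<P>\<^esub> \<longleftrightarrow> x = \<one>\<^bsub>\<G> i\<^esub>"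
proof
  assume "letter i x = \<one>\<^bsub>\<P>\<^esub>"
  then show "x = \<one>\<^bsub>\<G> i\<^esub>"
    using reduced_unique[of "[(i, x)]" "[]"] assms by (auto simp: reduced_Cons one_P)
qed (use letter_one assms in simp)

lemma letter_inj:
  assumes "i \<in> I" shows "inj_on (letter i) (carrier (\<G> i))"
proof -
  interpret Gi: group "\<G> i" using factor_group assms .
  interpret l: group_hom "\<G> i" \<P> "letter i"
    by unfold_locales (use letter_hom assms in auto)
  show ?thesis using l.inj_on_one_iff letter_eq_one_iff assms by auto
qed

end

section \<open>Conjugates of letters and finite subgroups\<close>

context group
begin

lemma cancel_inv_left [simp]:
  assumes "x \<in> carrier G" "y \<in> carrier G"
  shows "inv x \<otimes> (x \<otimes> y) = y" "x \<otimes> (inv x \<otimes> y) = y"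
  using assms by (simp_all add: m_assoc[symmetric])

lemma conj_pow:
  assumes "p \<in> carrier G" "g \<in> carrier G"
  shows "(p \<otimes> g \<otimes> inv p) [^] (n::nat) = p \<otimes> g [^] n \<otimes> inv p"
proof (induction n)
  case (Suc n)
  have "(p \<otimes> g [^] n \<otimes> inv p) \<otimes> (p \<otimes> g \<otimes> inv p) = p \<otimes> g [^] n \<otimes> (inv p \<otimes> p) \<otimes> g \<otimes> inv p"
    using assms by (simp add: m_assoc)
  with Suc show ?case using assms by (simp add: m_assoc)
qed (use assms in simp)

lemma conj_conj:
  assumes "p \<in> carrier G" "q \<in> carrier G" "g \<in> carrier G"
  shows "p \<otimes> (q \<otimes> g \<otimes> inv q) \<otimes> inv p = (p \<otimes> q) \<otimes> g \<otimes> inv (p \<otimes> q)"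
  using assms by (simp add: inv_mult_group m_assoc)

lemma conj_eq_one_iff:
  assumes "p \<in> carrier G" "g \<in> carrier G"
  shows "p \<otimes> g \<otimes> inv p = \<one> \<longleftrightarrow> g = \<one>"
  using assms by (metis inv_closed inv_inv m_closed inv_equality l_cancel_one' r_inv r_one)

lemma conj_eq_iff:
  assumes "p \<in> carrier G" "g \<in> carrier G" "h \<in> carrier G"
  shows "h = p \<otimes> g \<otimes> inv p \<longleftrightarrow> g = inv p \<otimes> h \<otimes> p"
  using assms by (metis inv_closed inv_solve_left inv_solve_right m_assoc m_closed)

text \<open>Lagrange's theorem in the form that is used for finite subgroups of infinite groups.\<close>

lemma finite_subgroup_torsion:
  assumes "subgroup L G" "finite L" "g \<in> L"
  obtains n :: nat where "n > 0" "g [^] n = \<one>"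
proof -
  interpret L: group "G\<lparr>carrier := L\<rparr>" using assms(1) subgroup_imp_group by blast
  have "g [^]\<^bsub>G\<lparr>carrier := L\<rparr>\<^esub> order (G\<lparr>carrier := L\<rparr>) = \<one>"
    using L.pow_order_eq_1[of g] assms by simp
  moreover have "order (G\<lparr>carrier := L\<rparr>) > 0"
    using assms by (auto simp: order_def card_gt_0_iff)
  ultimately show ?thesis
    using that nat_pow_consistent by metis
qed

end

context free_product_of_groups
begin

definition conj_letter :: "('i \<times> 'a) list set \<Rightarrow> bool" where
  "conj_letter g \<longleftrightarrow> (\<exists>p\<in>carrier \<P>. \<exists>i\<in>I. \<exists>x\<in>carrier (\<G> i). g = p \<otimes>\<^bsub>\<P>\<^esub> letter i x \<otimes>\<^bsub>\<P>\<^esub> inv\<^bsub>\<P>\<^esub> p)"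

definition cyclically_reduced :: "('i \<times> 'a) list \<Rightarrow> bool" where
  "cyclically_reduced w \<longleftrightarrow> reduced w \<and> w \<noteq> [] \<and> fst (hd w) \<noteq> fst (last w)"

lemma conj_letter_conj:
  assumes "conj_letter g" "q \<in> carrier \<P>"
  shows "conj_letter (q \<otimes>\<^bsub>\<P>\<^esub> g \<otimes>\<^bsub>\<P>\<^esub> inv\<^bsub>\<P>\<^esub> q)"
proof -
  obtain p i x where *: "p \<in> carrier \<P>" "i \<in> I" "x \<in> carrier (\<G> i)"
    "g = p \<otimes>\<^bsub>\<P>\<^esub> letter i x \<otimes>\<^bsub>\<P>\<^esub> inv\<^bsub>\<P>\<^esub> p"
    using assms(1) unfolding conj_letter_def by blast
  then have "q \<otimes>\<^bsub>\<P>\<^esub> g \<otimes>\<^bsub>\<P>\<^esub> inv\<^bsub>\<P>\<^esub> q = (q \<otimes>\<^bsub>\<P>\<^esub> p) \<otimes>\<^bsub>\<P>\<^esub> letter i x \<otimes>\<^bsub>\<P>\<^esub> inv\<^bsub>\<P>\<^esub> (q \<otimes>\<^bsub>\<P>\<^esub> p)"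
    using assms(2) P.conj_conj by simp
  with * assms(2) show ?thesis unfolding conj_letter_def by blast
qed

text \<open>If the first and the last letter of a word belong to the same factor, then conjugation by the first
  letter merges the two, and the word gets shorter.\<close>

lemma cyclic_reduction:
  assumes "g \<in> carrier \<P>"
  shows "g = \<one>\<^bsub>\<P>\<^esub> \<or> conj_letter g \<or>
    (\<exists>p w. p \<in> carrier \<P> \<and> cyclically_reduced w \<and> g = p \<otimes>\<^bsub>\<P>\<^esub> cl w \<otimes>\<^bsub>\<P>\<^esub> inv\<^bsub>\<P>\<^esub> p)"
proof -
  let ?C = "\<lambda>g. g = \<one>\<^bsub>\<P>\<^esub> \<or> conj_letter g \<or>
    (\<exists>p w. p \<in> carrier \<P> \<and> cyclically_reduced w \<and> g = p \<otimes>\<^bsub>\<P>\<^esub> cl w \<otimes>\<^bsub>\<P>\<^esub> inv\<^bsub>\<P>\<^esub> p)"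
  \<comment> \<open>The claim depends only on the conjugacy class, which makes the induction on the length work.\<close>
  have conj: "?C (q \<otimes>\<^bsub>\<P>\<^esub> h \<otimes>\<^bsub>\<P>\<^esub> inv\<^bsub>\<P>\<^esub> q)" if h: "?C h" and q: "q \<in> carrier \<P>" for q h
    using h
  proof (elim disjE exE conjE)
    assume "h = \<one>\<^bsub>\<P>\<^esub>"
    then show ?thesis using q by simp
  next
    assume "conj_letter h"
    then show ?thesis using conj_letter_conj q by blast
  next
    fix p w assume *: "p \<in> carrier \<P>" "cyclically_reduced w" "h = p \<otimes>\<^bsub>\<P>\<^esub> cl w \<otimes>\<^bsub>\<P>\<^esub> inv\<^bsub>\<P>\<^esub> p"
    then have "cl w \<in> carrier \<P>" by (auto simp: cyclically_reduced_def)
    with * q have "q \<otimes>\<^bsub>\<P>\<^esub> h \<otimes>\<^bsub>\<P>\<^esub> inv\<^bsub>\<P>\<^esub> q = (q \<otimes>\<^bsub>\<P>\<^esub> p) \<otimes>\<^bsub>\<P>\<^esub> cl w \<otimes>\<^bsub>\<P>\<^esub> inv\<^bsub>\<P>\<^esub> (q \<otimes>\<^bsub>\<P>\<^esub> p)"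
      using P.conj_conj by simp
    with * q show ?thesis by blast
  qed
  have "reduced w \<Longrightarrow> ?C (cl w)" for w
  proof (induction "length w" arbitrary: w rule: less_induct)
    case less
    consider "w = []" | i x where "w = [(i, x)]" | "w \<noteq> []" "fst (hd w) \<noteq> fst (last w)"
      | i x u y where "w = (i, x) # u @ [(i, y)]"
    proof (cases w)
      case (Cons p t)
      show ?thesis
      proof (cases t rule: rev_cases)
        case Nil
        then show ?thesis using that(2)[of "fst p" "snd p"] Cons by simp
      next
        case (snoc u q)
        show ?thesis
          using that(3) that(4)[of "fst p" "snd p" u "snd q"] snoc Cons
          by (cases "fst p = fst q") (auto, metis prod.collapse)
      qed
    qed (use that in simp)
    then show ?case
    proof cases
      case 1
      then show ?thesis by (simp add: one_P)
    next
      case 2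
      then have "i \<in> I" "x \<in> carrier (\<G> i)" using less.prems by (auto simp: reduced_Cons)
      then have "conj_letter (cl w)"
        unfolding conj_letter_def using 2
        by (intro bexI[of _ "\<one>\<^bsub>\<P>\<^esub>"] bexI[of _ i] bexI[of _ x]) auto
      then show ?thesis by blast
    next
      case 3
      then have "cyclically_reduced w" using less.prems by (simp add: cyclically_reduced_def)
      moreover have "cl w = \<one>\<^bsub>\<P>\<^esub> \<otimes>\<^bsub>\<P>\<^esub> cl w \<otimes>\<^bsub>\<P>\<^esub> inv\<^bsub>\<P>\<^esub> \<one>\<^bsub>\<P>\<^esub>"
        using less.prems by auto
      ultimately show ?thesis using P.one_closed by blast
    next
      case 4
      then have *: "i \<in> I" "x \<in> carrier (\<G> i)" "y \<in> carrier (\<G> i)" "u \<in> words"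
        using less.prems by (auto simp: reduced_def)
      interpret Gi: group "\<G> i" using factor_group *(1) .
      have "u @ [(i, y \<otimes>\<^bsub>\<G> i\<^esub> x)] \<in> words" using * by simp
      then obtain v where v: "reduced v" "cl v = cl (u @ [(i, y \<otimes>\<^bsub>\<G> i\<^esub> x)])"
        "length v \<le> length (u @ [(i, y \<otimes>\<^bsub>\<G> i\<^esub> x)])"
        by (rule reduced_length_exists)
      have "?C (cl v)" using less.hyps[of v] v 4 by simp
      moreover have "cl w = letter i x \<otimes>\<^bsub>\<P>\<^esub> cl v \<otimes>\<^bsub>\<P>\<^esub> inv\<^bsub>\<P>\<^esub> letter i x"
        using * 4 v(2) cl_Cons[of i x "u @ [(i, y)]"] cl_append[of u "[(i, y)]"]
          cl_append[of u "[(i, y \<otimes>\<^bsub>\<G> i\<^esub> x)]"]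
        by (simp add: letter_mult P.m_assoc)
      ultimately show ?thesis using conj * by simp
    qed
  qed
  moreover obtain w where "reduced w" "cl w = g" using reduced_exists assms .
  ultimately show ?thesis by blast
qed

lemma cyclically_reduced_pow:
  assumes "cyclically_reduced w"
  shows "cl w [^]\<^bsub>\<P>\<^esub> (n::nat) = cl (concat (replicate n w))" "reduced (concat (replicate n w))"
proof -
  have w: "reduced w" "w \<noteq> []" "fst (hd w) \<noteq> fst (last w)"
    using assms by (auto simp: cyclically_reduced_def)
  have r: "reduced (concat (replicate n w)) \<and>
      (n > 0 \<longrightarrow> concat (replicate n w) \<noteq> [] \<and> hd (concat (replicate n w)) = hd w)" for n
    by (induction n) (use w in \<open>auto simp: reduced_append\<close>)
  then show "reduced (concat (replicate n w))" by blast
  show "cl w [^]\<^bsub>\<P>\<^esub> n = cl (concat (replicate n w))"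
  proof (induction n)
    case (Suc n)
    have "cl w [^]\<^bsub>\<P>\<^esub> Suc n = cl w \<otimes>\<^bsub>\<P>\<^esub> cl w [^]\<^bsub>\<P>\<^esub> n"
      using P.nat_pow_Suc2 w(1) by blast
    then show ?case
      using Suc cl_append[of w "concat (replicate n w)"] w r[of n] by auto
  qed (simp add: one_P)
qed

lemma cyclically_reduced_infinite_order:
  assumes "cyclically_reduced w" "n > 0"
  shows "cl w [^]\<^bsub>\<P>\<^esub> (n::nat) \<noteq> \<one>\<^bsub>\<P>\<^esub>"
proof
  assume "cl w [^]\<^bsub>\<P>\<^esub> n = \<one>\<^bsub>\<P>\<^esub>"
  then have "cl (concat (replicate n w)) = cl []"
    using cyclically_reduced_pow(1)[OF assms(1), of n] by (simp add: one_P)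
  then have "concat (replicate n w) = []"
    using reduced_unique[OF cyclically_reduced_pow(2)[OF assms(1)] reduced_Nil] by blast
  then show False using assms by (auto simp: cyclically_reduced_def)
qed

text \<open>The \<open>n\<close>-th power of a cyclically reduced word has normal form of length at least \<open>n\<close>, whereas the
  powers of a conjugate of a letter have bounded length.\<close>

lemma cyclically_reduced_not_conj_letter:
  assumes w: "cyclically_reduced w"
  shows "\<not> conj_letter (cl w)"
proof
  assume "conj_letter (cl w)"
  then obtain p i x where p: "p \<in> carrier \<P>" "i \<in> I" "x \<in> carrier (\<G> i)"
    "cl w = p \<otimes>\<^bsub>\<P>\<^esub> letter i x \<otimes>\<^bsub>\<P>\<^esub> inv\<^bsub>\<P>\<^esub> p"
    unfolding conj_letter_def by blast
  interpret Gi: group "\<G> i" using factor_group p(2) .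
  interpret l: group_hom "\<G> i" \<P> "letter i"
    by unfold_locales (use letter_hom p in auto)
  obtain u where u: "u \<in> words" "p = cl u" using p(1) by (auto simp: carrier_P)
  obtain u' where u': "u' \<in> words" "inv\<^bsub>\<P>\<^esub> p = cl u'"
    using P.inv_closed[OF p(1)] by (auto simp: carrier_P)
  define n where "n = length u + length u' + 2"
  let ?t = "u @ [(i, x [^]\<^bsub>\<G> i\<^esub> n)] @ u'"
  have "cl w [^]\<^bsub>\<P>\<^esub> n = p \<otimes>\<^bsub>\<P>\<^esub> letter i (x [^]\<^bsub>\<G> i\<^esub> n) \<otimes>\<^bsub>\<P>\<^esub> inv\<^bsub>\<P>\<^esub> p"
    using p P.conj_pow l.hom_nat_pow by simp
  also have "\<dots> = cl ?t"
    using u u' p cl_append[of u "[(i, x [^]\<^bsub>\<G> i\<^esub> n)] @ u'"] cl_append[of "[(i, x [^]\<^bsub>\<G> i\<^esub> n)]" u']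
    by (simp add: P.m_assoc)
  finally have eq: "cl (concat (replicate n w)) = cl ?t"
    using cyclically_reduced_pow(1)[OF w] by simp
  have "?t \<in> words" using u u' p by simp
  then obtain v where v: "reduced v" "cl v = cl ?t" "length v \<le> length ?t"
    by (rule reduced_length_exists)
  then have "v = concat (replicate n w)"
    using eq reduced_unique cyclically_reduced_pow(2)[OF w] by simp
  then have "n * length w \<le> length u + length u' + 1"
    using v(3) by (simp add: length_concat sum_list_replicate)
  moreover have "length w \<ge> 1"
    using w by (cases w) (auto simp: cyclically_reduced_def)
  then have "n * 1 \<le> n * length w" by (intro mult_le_mono2)
  ultimately show False by (simp add: n_def)
qed

lemma torsion_conj_letter:
  assumes "g \<in> carrier \<P>" "g [^]\<^bsub>\<P>\<^esub> n = \<one>\<^bsub>\<P>\<^esub>" "(n::nat) > 0"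
  shows "g = \<one>\<^bsub>\<P>\<^esub> \<or> conj_letter g"
proof (rule ccontr)
  assume "\<not> ?thesis"
  then obtain p w where *: "p \<in> carrier \<P>" "cyclically_reduced w" "g = p \<otimes>\<^bsub>\<P>\<^esub> cl w \<otimes>\<^bsub>\<P>\<^esub> inv\<^bsub>\<P>\<^esub> p"
    using cyclic_reduction[OF assms(1)] by blast
  then have "cl w \<in> carrier \<P>" by (auto simp: cyclically_reduced_def)
  then have "cl w [^]\<^bsub>\<P>\<^esub> n = \<one>\<^bsub>\<P>\<^esub>"
    using * assms(2) P.conj_pow P.conj_eq_one_iff by simp
  then show False using cyclically_reduced_infinite_order * assms(3) by blast
qed

text \<open>The double coset decomposition with respect to a factor.\<close>

lemma strip_factor:
  assumes "i \<in> I" "g \<in> carrier \<P>"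
  obtains a v b where "a \<in> carrier (\<G> i)" "b \<in> carrier (\<G> i)" "reduced v"
    "v = [] \<or> fst (hd v) \<noteq> i \<and> fst (last v) \<noteq> i"
    "g = letter i a \<otimes>\<^bsub>\<P>\<^esub> cl v \<otimes>\<^bsub>\<P>\<^esub> letter i b"
proof -
  interpret Gi: group "\<G> i" using factor_group assms(1) .
  obtain w where w: "reduced w" "cl w = g" using reduced_exists assms(2) .
  define a where "a = head_part i w"
  define u where "u = tail_part i w"
  note s = split_head[OF assms(1) w(1), folded a_def u_def]
  have g: "g = letter i a \<otimes>\<^bsub>\<P>\<^esub> cl u"
    using cl_push[of i a u] s assms w by auto
  show ?thesis
  proof (cases "u \<noteq> [] \<and> fst (last u) = i")
    case False
    then show ?thesis
      using that[of a "\<one>\<^bsub>\<G> i\<^esub>" u] s g assms by (auto simp: letter_one)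
  next
    case True
    then obtain v b where u: "u = v @ [(i, b)]" by (cases u rule: rev_cases) auto
    then have *: "reduced v" "v = [] \<or> fst (last v) \<noteq> i" "b \<in> carrier (\<G> i)" "v \<in> words"
      using s(2) by (auto simp: reduced_append reduced_Cons)
    have "v = [] \<or> fst (hd v) \<noteq> i" using s(3) u by (cases v) auto
    moreover have "g = letter i a \<otimes>\<^bsub>\<P>\<^esub> cl v \<otimes>\<^bsub>\<P>\<^esub> letter i b"
      using g u * s assms cl_append[of v "[(i, b)]"] by (simp add: P.m_assoc)
    ultimately show ?thesis using that[of a b v] * s by blast
  qed
qed

text \<open>A nontrivial element of a finite subgroup is conjugate to a letter \<open>x\<close> of some factor \<open>\<G> i\<close>. Suppose that
  the conjugated subgroup also contains \<open>y = a v b\<close> with \<open>a\<close> and \<open>b\<close> in \<open>\<G> i\<close> and with a nonempty reduced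
  word \<open>v\<close> that neither starts nor ends in \<open>\<G> i\<close>. Up to conjugation by \<open>b\<close>, the elements \<open>y\<close> and
  \<open>x y\<close> are \<open>(b a) v\<close> and \<open>(b x a) v\<close>. As \<open>b a\<close> and \<open>b x a\<close> are not both trivial, one of the two words
  is cyclically reduced, hence has infinite order. So the whole subgroup lies in the factor.\<close>

theorem finite_subgroup_in_factor:
  assumes L: "subgroup L \<P>" "finite L" "L \<noteq> {\<one>\<^bsub>\<P>\<^esub>}"
  obtains i A where "i \<in> I" "subgroup A (\<G> i)" "card A = card L" "finite A"
proof -
  interpret L: subgroup L \<P> by fact
  have Lc: "\<And>l. l \<in> L \<Longrightarrow> l \<in> carrier \<P>" using L.subset by blast
  obtain g where g: "g \<in> L" "g \<noteq> \<one>\<^bsub>\<P>\<^esub>" using L(3) L.one_closed by blast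
  have no_cyc: False if "cyclically_reduced w" and l: "l \<in> L" and "q \<in> carrier \<P>" and "cl w = q \<otimes>\<^bsub>\<P>\<^esub> l \<otimes>\<^bsub>\<P>\<^esub> inv\<^bsub>\<P>\<^esub> q" for w l q
  proof -
    obtain n :: nat where n: "n > 0" "l [^]\<^bsub>\<P>\<^esub> n = \<one>\<^bsub>\<P>\<^esub>"
      using P.finite_subgroup_torsion[OF L(1,2) l] .
    then have "cl w [^]\<^bsub>\<P>\<^esub> n = \<one>\<^bsub>\<P>\<^esub>" using that Lc P.conj_pow by simp
    then show False using cyclically_reduced_infinite_order that(1) n(1) by blast
  qed
  obtain n :: nat where "n > 0" "g [^]\<^bsub>\<P>\<^esub> n = \<one>\<^bsub>\<P>\<^esub>"
    using P.finite_subgroup_torsion[OF L(1,2) g(1)] .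
  then have "conj_letter g" using torsion_conj_letter g Lc by blast
  then obtain p i x where p: "p \<in> carrier \<P>" "i \<in> I" "x \<in> carrier (\<G> i)"
    "g = p \<otimes>\<^bsub>\<P>\<^esub> letter i x \<otimes>\<^bsub>\<P>\<^esub> inv\<^bsub>\<P>\<^esub> p"
    unfolding conj_letter_def by blast
  interpret Gi: group "\<G> i" using factor_group p(2) .
  have lc: "a \<in> carrier (\<G> i) \<Longrightarrow> letter i a \<in> carrier \<P>" for a using p(2) by simp
  have x: "x \<noteq> \<one>\<^bsub>\<G> i\<^esub>" using g(2) p letter_one by auto
  let ?c = "\<lambda>a. p \<otimes>\<^bsub>\<P>\<^esub> letter i a \<otimes>\<^bsub>\<P>\<^esub> inv\<^bsub>\<P>\<^esub> p"
  have onto: "\<exists>a\<in>carrier (\<G> i). l = ?c a" if l: "l \<in> L" for l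
  proof -
    define y where "y = inv\<^bsub>\<P>\<^esub> p \<otimes>\<^bsub>\<P>\<^esub> l \<otimes>\<^bsub>\<P>\<^esub> p"
    have yc: "y \<in> carrier \<P>" using p Lc[OF l] by (simp add: y_def)
    have ly: "l = p \<otimes>\<^bsub>\<P>\<^esub> y \<otimes>\<^bsub>\<P>\<^esub> inv\<^bsub>\<P>\<^esub> p"
      using P.conj_eq_iff[of p y l] p yc Lc[OF l] y_def by blast
    obtain a v b where v: "a \<in> carrier (\<G> i)" "b \<in> carrier (\<G> i)" "reduced v"
      "v = [] \<or> fst (hd v) \<noteq> i \<and> fst (last v) \<noteq> i"
      "y = letter i a \<otimes>\<^bsub>\<P>\<^esub> cl v \<otimes>\<^bsub>\<P>\<^esub> letter i b"
      using strip_factor[OF p(2) yc] .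
    have vc: "cl v \<in> carrier \<P>" using v(3) by auto
    show ?thesis
    proof (cases "v = []")
      case True
      then have "y = letter i (a \<otimes>\<^bsub>\<G> i\<^esub> b)" using v p by (simp add: one_P[symmetric] letter_mult)
      then show ?thesis using ly v by blast
    next
      case False
      have cyc: "cyclically_reduced ((i, z) # v)" if "z \<in> carrier (\<G> i)" "z \<noteq> \<one>\<^bsub>\<G> i\<^esub>" for z
        using that False v(3,4) p(2) by (auto simp: cyclically_reduced_def reduced_Cons)
      have c1: "cl ((i, z) # v) = letter i z \<otimes>\<^bsub>\<P>\<^esub> cl v" if "z \<in> carrier (\<G> i)" for z
        using cl_Cons p(2) v(3) that by blast
      let ?q = "letter i b \<otimes>\<^bsub>\<P>\<^esub> inv\<^bsub>\<P>\<^esub> p"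
      have qc: "?q \<in> carrier \<P>" using p v lc by simp
      have E1: "?q \<otimes>\<^bsub>\<P>\<^esub> l \<otimes>\<^bsub>\<P>\<^esub> inv\<^bsub>\<P>\<^esub> ?q = letter i (b \<otimes>\<^bsub>\<G> i\<^esub> a) \<otimes>\<^bsub>\<P>\<^esub> cl v"
      proof -
        have "?q \<otimes>\<^bsub>\<P>\<^esub> l \<otimes>\<^bsub>\<P>\<^esub> inv\<^bsub>\<P>\<^esub> ?q = letter i b \<otimes>\<^bsub>\<P>\<^esub> y \<otimes>\<^bsub>\<P>\<^esub> inv\<^bsub>\<P>\<^esub> letter i b"
          using p(1) v(2) lc yc by (simp add: ly P.inv_mult_group P.m_assoc)
        then show ?thesis using p(2) v lc vc by (simp add: letter_mult P.m_assoc)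
      qed
      have E2: "?q \<otimes>\<^bsub>\<P>\<^esub> (g \<otimes>\<^bsub>\<P>\<^esub> l) \<otimes>\<^bsub>\<P>\<^esub> inv\<^bsub>\<P>\<^esub> ?q = letter i (b \<otimes>\<^bsub>\<G> i\<^esub> x \<otimes>\<^bsub>\<G> i\<^esub> a) \<otimes>\<^bsub>\<P>\<^esub> cl v"
      proof -
        have "?q \<otimes>\<^bsub>\<P>\<^esub> (g \<otimes>\<^bsub>\<P>\<^esub> l) \<otimes>\<^bsub>\<P>\<^esub> inv\<^bsub>\<P>\<^esub> ?q = 
            letter i b \<otimes>\<^bsub>\<P>\<^esub> (inv\<^bsub>\<P>\<^esub> p \<otimes>\<^bsub>\<P>\<^esub> p) \<otimes>\<^bsub>\<P>\<^esub> letter i x \<otimes>\<^bsub>\<P>\<^esub> y \<otimes>\<^bsub>\<P>\<^esub> inv\<^bsub>\<P>\<^esub> letter i b"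
          using p(1,3) v(2) lc yc by (simp add: p(4) ly P.inv_mult_group P.m_assoc)
        then show ?thesis using p v lc vc by (simp add: letter_mult P.m_assoc)
      qed
      have "b \<otimes>\<^bsub>\<G> i\<^esub> a = \<one>\<^bsub>\<G> i\<^esub>"
        using no_cyc[OF cyc[of "b \<otimes>\<^bsub>\<G> i\<^esub> a"] l qc] E1 c1[of "b \<otimes>\<^bsub>\<G> i\<^esub> a"] v by auto
      moreover have "b \<otimes>\<^bsub>\<G> i\<^esub> x \<otimes>\<^bsub>\<G> i\<^esub> a = \<one>\<^bsub>\<G> i\<^esub>"
        using no_cyc[OF cyc[of "b \<otimes>\<^bsub>\<G> i\<^esub> x \<otimes>\<^bsub>\<G> i\<^esub> a"] L.m_closed[OF g(1) l] qc] E2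
          c1[of "b \<otimes>\<^bsub>\<G> i\<^esub> x \<otimes>\<^bsub>\<G> i\<^esub> a"] v p by auto
      ultimately have "b \<otimes>\<^bsub>\<G> i\<^esub> x \<otimes>\<^bsub>\<G> i\<^esub> a = b \<otimes>\<^bsub>\<G> i\<^esub> a" by simp
      then have "x = \<one>\<^bsub>\<G> i\<^esub>"
        using v p by (simp add: Gi.m_assoc Gi.r_cancel_one)
      then show ?thesis using x by simp
    qed
  qed
  define A where "A = {a \<in> carrier (\<G> i). ?c a \<in> L}"
  have bij: "bij_betw ?c A L"
    unfolding bij_betw_def
  proof
    show "inj_on ?c A"
    proof (rule inj_onI)
      fix a b assume ab: "a \<in> A" "b \<in> A" "?c a = ?c b"
      then have "letter i a = letter i b" using p(1) lc unfolding A_def by simp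
      then show "a = b" using letter_inj[OF p(2)] ab unfolding A_def inj_on_def by blast
    qed
    show "?c ` A = L" unfolding A_def using onto by auto
  qed
  have "subgroup A (\<G> i)"
  proof (rule Gi.subgroupI)
    show "A \<subseteq> carrier (\<G> i)" by (auto simp: A_def)
    show "A \<noteq> {}" using bij g(1) by (auto simp: bij_betw_def)
  next
    fix a assume a: "a \<in> A"
    have "?c (inv\<^bsub>\<G> i\<^esub> a) = inv\<^bsub>\<P>\<^esub> (?c a)"
      using a p lc by (simp add: A_def letter_inv P.inv_mult_group P.m_assoc)
    then show "inv\<^bsub>\<G> i\<^esub> a \<in> A" using a unfolding A_def by simp
  next
    fix a b assume ab: "a \<in> A" "b \<in> A"
    have "?c a \<otimes>\<^bsub>\<P>\<^esub> ?c b = p \<otimes>\<^bsub>\<P>\<^esub> letter i a \<otimes>\<^bsub>\<P>\<^esub> (inv\<^bsub>\<P>\<^esub> p \<otimes>\<^bsub>\<P>\<^esub> p) \<otimes>\<^bsub>\<P>\<^esub> letter i b \<otimes>\<^bsub>\<P>\<^esub> inv\<^bsub>\<P>\<^esub> p"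
      using ab p lc by (simp add: A_def P.m_assoc)
    then have "?c (a \<otimes>\<^bsub>\<G> i\<^esub> b) = ?c a \<otimes>\<^bsub>\<P>\<^esub> ?c b"
      using ab p lc by (simp add: A_def letter_mult P.m_assoc)
    then show "a \<otimes>\<^bsub>\<G> i\<^esub> b \<in> A" using ab L.m_closed[of "?c a" "?c b"] unfolding A_def by simp
  qed
  then show ?thesis
    using that[OF p(2)] bij_betw_same_card[OF bij] bij_betw_finite[OF bij] L(2) by auto
qed

end

section \<open>Free products of conjugates of subgroups of the factors\<close>

text \<open>Subgroups \<open>A l\<close> of the factors \<open>\<G> (idx l)\<close> are conjugated by the words \<open>s l\<close>. The word \<open>link l m\<close> is
  the normal form of \<open>(s l)\<^sup>-\<^sup>1 s m\<close>, and it is required that putting it between a letter of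
  \<open>\<G> (idx l)\<close> and a letter of \<open>\<G> (idx m)\<close> gives a reduced word. Then the conjugates of the subgroups
  are in free position.\<close>

locale conjugate_family = free_product_of_groups I \<G>
  for I :: "'i set" and \<G> :: "'i \<Rightarrow> ('a, 'b) monoid_scheme" +
  fixes \<Lambda> :: "'l set" and idx :: "'l \<Rightarrow> 'i" and A :: "'l \<Rightarrow> 'a set"
    and s :: "'l \<Rightarrow> ('i \<times> 'a) list" and link :: "'l \<Rightarrow> 'l \<Rightarrow> ('i \<times> 'a) list"
  assumes idx: "l \<in> \<Lambda> \<Longrightarrow> idx l \<in> I"
    and A: "l \<in> \<Lambda> \<Longrightarrow> subgroup (A l) (\<G> (idx l))"
    and s: "l \<in> \<Lambda> \<Longrightarrow> s l \<in> words"
    and link_reduced: "l \<in> \<Lambda> \<Longrightarrow> m \<in> \<Lambda> \<Longrightarrow> l \<noteq> m \<Longrightarrow> reduced (link l m)"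
    and link_cl: "l \<in> \<Lambda> \<Longrightarrow> m \<in> \<Lambda> \<Longrightarrow> l \<noteq> m \<Longrightarrow> cl (s m) = cl (s l @ link l m)"
    and link_ends: "l \<in> \<Lambda> \<Longrightarrow> m \<in> \<Lambda> \<Longrightarrow> l \<noteq> m \<Longrightarrow>
      distinct_adj (idx l # map fst (link l m) @ [idx m])"
begin

definition fam :: "'l \<Rightarrow> ('a, 'b) monoid_scheme" where
  "fam l = (\<G> (idx l))\<lparr>carrier := A l\<rparr>"

lemma fam_simps [simp]:
  "carrier (fam l) = A l" "\<one>\<^bsub>fam l\<^esub> = \<one>\<^bsub>\<G> (idx l)\<^esub>" "x \<otimes>\<^bsub>fam l\<^esub> y = x \<otimes>\<^bsub>\<G> (idx l)\<^esub> y"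
  by (simp_all add: fam_def)

sublocale sub: free_product_of_groups \<Lambda> fam
  by (rule free_product_of_groups.intro)
    (unfold fam_def, rule group.subgroup_imp_group[OF factor_group[OF idx] A])

lemma A_carrier: "l \<in> \<Lambda> \<Longrightarrow> a \<in> A l \<Longrightarrow> a \<in> carrier (\<G> (idx l))"
  using A subgroup.subset by blast

definition emb :: "('l \<times> 'a) list set \<Rightarrow> ('i \<times> 'a) list set" where
  "emb = (SOME h. h \<in> hom sub.\<P> \<P> \<and> (\<forall>l\<in>\<Lambda>. \<forall>a\<in>A l.
     h (sub.letter l a) = cl (s l) \<otimes>\<^bsub>\<P>\<^esub> letter (idx l) a \<otimes>\<^bsub>\<P>\<^esub> inv\<^bsub>\<P>\<^esub> cl (s l)))"

lemma emb: "emb \<in> hom sub.\<P> \<P>"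
  and emb_letter: "l \<in> \<Lambda> \<Longrightarrow> a \<in> A l \<Longrightarrow>
    emb (sub.letter l a) = cl (s l) \<otimes>\<^bsub>\<P>\<^esub> letter (idx l) a \<otimes>\<^bsub>\<P>\<^esub> inv\<^bsub>\<P>\<^esub> cl (s l)"
proof -
  let ?f = "\<lambda>l a. cl (s l) \<otimes>\<^bsub>\<P>\<^esub> letter (idx l) a \<otimes>\<^bsub>\<P>\<^esub> inv\<^bsub>\<P>\<^esub> cl (s l)"
  have "?f l \<in> hom (fam l) \<P>" if l: "l \<in> \<Lambda>" for l
  proof (rule homI)
    fix a b assume "a \<in> carrier (fam l)" "b \<in> carrier (fam l)"
    then have ab: "a \<in> carrier (\<G> (idx l))" "b \<in> carrier (\<G> (idx l))"
      using A_carrier l by auto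
    then have c: "letter (idx l) a \<in> carrier \<P>" "letter (idx l) b \<in> carrier \<P>"
      using idx l by auto
    show "?f l a \<in> carrier \<P>" using c s[OF l] by simp
    show "?f l (a \<otimes>\<^bsub>fam l\<^esub> b) = ?f l a \<otimes>\<^bsub>\<P>\<^esub> ?f l b"
      using c s[OF l] ab by (simp add: letter_mult idx[OF l] P.m_assoc)
  qed
  then obtain h where "h \<in> hom sub.\<P> \<P>"
    "\<And>l a. l \<in> \<Lambda> \<Longrightarrow> a \<in> carrier (fam l) \<Longrightarrow> h (sub.letter l a) = ?f l a"
    using sub.hom_extends[OF P.is_group, of ?f] by blast
  then have "\<exists>h. h \<in> hom sub.\<P> \<P> \<and> (\<forall>l\<in>\<Lambda>. \<forall>a\<in>A l. h (sub.letter l a) = ?f l a)"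
    by (intro exI[of _ h]) simp
  from someI_ex[OF this, folded emb_def]
  show "emb \<in> hom sub.\<P> \<P>" "l \<in> \<Lambda> \<Longrightarrow> a \<in> A l \<Longrightarrow> emb (sub.letter l a) = ?f l a"
    by blast+
qed

sublocale emb: group_hom sub.\<P> \<P> emb
  by unfold_locales (rule emb)

text \<open>The product of the conjugates \<open>s l a (s l)\<^sup>-\<^sup>1\<close> along a word telescopes: between two consecutive
  letters, \<open>(s l)\<^sup>-\<^sup>1 s m\<close> is replaced by the link. Only the first and the last conjugator remain
  outside of the core.\<close>

fun core :: "('l \<times> 'a) list \<Rightarrow> ('i \<times> 'a) list" where
  "core [] = []"
| "core [(l, a)] = [(idx l, a)]"
| "core ((l, a) # (m, b) # w) = (idx l, a) # link l m @ core ((m, b) # w)"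

lemma distinct_adj_ends:
  "distinct_adj (x # xs @ [y]) \<longleftrightarrow> distinct_adj xs \<and>
    (if xs = [] then x \<noteq> y else x \<noteq> hd xs \<and> last xs \<noteq> y)"
  by (auto simp: distinct_adj_Cons distinct_adj_append_iff)

lemma core_reduced:
  assumes "sub.reduced w" "w \<noteq> []"
  shows "reduced (core w) \<and> core w \<noteq> [] \<and> fst (hd (core w)) = idx (fst (hd w)) \<and>
    fst (last (core w)) = idx (fst (last w))"
  using assms
proof (induction w rule: core.induct)
  case (2 l a)
  then show ?case using idx A_carrier by (auto simp: reduced_Cons sub.reduced_Cons)
next
  case (3 l a m b w)
  then have lm: "l \<in> \<Lambda>" "m \<in> \<Lambda>" "l \<noteq> m" "a \<in> A l" "a \<noteq> \<one>\<^bsub>\<G> (idx l)\<^esub>"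
    and r: "sub.reduced ((m, b) # w)"
    by (auto simp: sub.reduced_Cons)
  note e = link_ends[OF lm(1-3), unfolded distinct_adj_ends]
  have ih: "reduced (core ((m, b) # w))" "core ((m, b) # w) \<noteq> []"
    "fst (hd (core ((m, b) # w))) = idx m"
    "fst (last (core ((m, b) # w))) = idx (fst (last ((m, b) # w)))"
    using 3(1)[OF r] by auto
  show ?case
    using ih e link_reduced[OF lm(1-3)] idx A_carrier lm
    by (auto simp: reduced_Cons reduced_append hd_append hd_map last_map split: if_splits)
qed simp

lemma emb_cl:
  assumes "sub.reduced w" "w \<noteq> []"
  shows "emb (sub.cl w) =
    cl (s (fst (hd w))) \<otimes>\<^bsub>\<P>\<^esub> cl (core w) \<otimes>\<^bsub>\<P>\<^esub> inv\<^bsub>\<P>\<^esub> cl (s (fst (last w)))"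
  using assms
proof (induction w rule: core.induct)
  case (2 l a)
  then show ?case using emb_letter by (auto simp: sub.reduced_Cons)
next
  case (3 l a m b w)
  then have lm: "l \<in> \<Lambda>" "m \<in> \<Lambda>" "l \<noteq> m" "a \<in> A l"
    and r: "sub.reduced ((m, b) # w)"
    by (auto simp: sub.reduced_Cons)
  let ?v = "(m, b) # w"
  let ?n = "fst (last ?v)"
  have n: "?n \<in> \<Lambda>"
    using sub.reduced_words[OF r] last_in_set[of ?v]
    by (auto simp: fp_words_def lists_eq_set simp del: last.simps)
  have c: "core ?v \<in> words" using core_reduced[OF r] by auto
  have lk: "link l m \<in> words" using link_reduced lm by blast
  have sl: "cl (s l) \<in> carrier \<P>" "cl (link l m) \<in> carrier \<P>" "cl (core ?v) \<in> carrier \<P>"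
    "cl (s ?n) \<in> carrier \<P>" "letter (idx l) a \<in> carrier \<P>"
    using s lm lk c n idx A_carrier by auto
  have vw: "sub.cl ?v \<in> carrier sub.\<P>" using r by auto
  have "emb (sub.cl ((l, a) # ?v)) = emb (sub.letter l a \<otimes>\<^bsub>sub.\<P>\<^esub> sub.cl ?v)"
    using sub.cl_Cons[of l a ?v] lm r by auto
  also have "\<dots> = emb (sub.letter l a) \<otimes>\<^bsub>\<P>\<^esub> emb (sub.cl ?v)"
    using lm vw by (intro emb.hom_mult) auto
  also have "emb (sub.cl ?v) = cl (s m) \<otimes>\<^bsub>\<P>\<^esub> cl (core ?v) \<otimes>\<^bsub>\<P>\<^esub> inv\<^bsub>\<P>\<^esub> cl (s ?n)"
    using 3(1)[OF r] by simp
  also have "cl (s m) = cl (s l) \<otimes>\<^bsub>\<P>\<^esub> cl (link l m)"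
    using link_cl[OF lm(1-3)] cl_append[of "s l" "link l m"] s lm lk by simp
  also have "emb (sub.letter l a) = cl (s l) \<otimes>\<^bsub>\<P>\<^esub> letter (idx l) a \<otimes>\<^bsub>\<P>\<^esub> inv\<^bsub>\<P>\<^esub> cl (s l)"
    using emb_letter lm by simp
  finally have "emb (sub.cl ((l, a) # ?v)) =
      cl (s l) \<otimes>\<^bsub>\<P>\<^esub> (letter (idx l) a \<otimes>\<^bsub>\<P>\<^esub> (cl (link l m) \<otimes>\<^bsub>\<P>\<^esub> cl (core ?v))) \<otimes>\<^bsub>\<P>\<^esub> inv\<^bsub>\<P>\<^esub> cl (s ?n)"
    using sl by (simp add: P.m_assoc)
  moreover have "cl (core ((l, a) # ?v)) = letter (idx l) a \<otimes>\<^bsub>\<P>\<^esub> (cl (link l m) \<otimes>\<^bsub>\<P>\<^esub> cl (core ?v))"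
    using cl_Cons[of "idx l" a "link l m @ core ?v"] cl_append[OF lk c] lm lk c idx A_carrier by simp
  ultimately show ?case by simp
qed simp

text \<open>If a nonempty reduced word were mapped to the unit, then its core would be trivial or equal to a link.
  Both contradict the uniqueness of normal forms, as the core starts in the factor that precedes the link.\<close>

theorem emb_inj: "inj_on emb (carrier sub.\<P>)"
proof -
  have "g = \<one>\<^bsub>sub.\<P>\<^esub>" if g: "g \<in> carrier sub.\<P>" "emb g = \<one>\<^bsub>\<P>\<^esub>" for g
  proof (rule ccontr)
    assume ng: "g \<noteq> \<one>\<^bsub>sub.\<P>\<^esub>"
    obtain w where w: "sub.reduced w" "sub.cl w = g" using sub.reduced_exists g(1) .
    then have "w \<noteq> []" using ng sub.one_P by auto
    define l m where "l = fst (hd w)" and "m = fst (last w)"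
    have "hd w \<in> set w" "last w \<in> set w" using \<open>w \<noteq> []\<close> by auto
    then have lm: "l \<in> \<Lambda>" "m \<in> \<Lambda>"
      using sub.reduced_words[OF w(1)]
      unfolding l_def m_def by (auto intro: sub.words_index)
    note c = core_reduced[OF w(1) \<open>w \<noteq> []\<close>, folded l_def m_def]
    have sc: "cl (s l) \<in> carrier \<P>" "cl (s m) \<in> carrier \<P>" "cl (core w) \<in> carrier \<P>"
      using s lm c by auto
    have e: "cl (s l) \<otimes>\<^bsub>\<P>\<^esub> cl (core w) \<otimes>\<^bsub>\<P>\<^esub> inv\<^bsub>\<P>\<^esub> cl (s m) = \<one>\<^bsub>\<P>\<^esub>"
      using emb_cl[OF w(1) \<open>w \<noteq> []\<close>] w(2) g(2) by (simp add: l_def m_def)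
    then have e': "cl (s l) \<otimes>\<^bsub>\<P>\<^esub> cl (core w) = cl (s m)"
      using sc by (metis P.inv_equality P.inv_inv P.inv_closed P.m_closed)
    show False
    proof (cases "l = m")
      case True
      then have "cl (core w) = cl []"
        using e' sc by (simp add: P.r_cancel_one one_P[symmetric])
      then show False using reduced_unique[of "core w" "[]"] c by auto
    next
      case False
      have lr: "reduced (link l m)" using link_reduced lm False by blast
      have "cl (s m) = cl (s l) \<otimes>\<^bsub>\<P>\<^esub> cl (link l m)"
        using link_cl[OF lm False] cl_append[of "s l" "link l m"] s lm lr by auto
      then have "cl (core w) = cl (link l m)"
        using e' sc(1,3) cl_closed[OF reduced_words[OF lr]] by simp
      then have "core w = link l m" using reduced_unique c lr by blast
      then show False
        using c link_ends[OF lm False] by (auto simp: distinct_adj_ends hd_map)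
    qed
  qed
  then show ?thesis using emb.inj_on_one_iff by blast
qed

text \<open>The image of a cyclically reduced word is conjugate to its core followed by the link from its last to
  its first factor, and this word is cyclically reduced as well.\<close>

theorem emb_conj_letter:
  assumes g: "g \<in> carrier sub.\<P>" and "conj_letter (emb g)"
  shows "g = \<one>\<^bsub>sub.\<P>\<^esub> \<or> sub.conj_letter g"
proof (rule ccontr)
  assume "\<not> ?thesis"
  then obtain p w where p: "p \<in> carrier sub.\<P>" "sub.cyclically_reduced w"
    "g = p \<otimes>\<^bsub>sub.\<P>\<^esub> sub.cl w \<otimes>\<^bsub>sub.\<P>\<^esub> inv\<^bsub>sub.\<P>\<^esub> p"
    using sub.cyclic_reduction[OF g] by blast
  then have w: "sub.reduced w" "w \<noteq> []" by (auto simp: sub.cyclically_reduced_def)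
  define l m where "l = fst (hd w)" and "m = fst (last w)"
  have lm: "m \<noteq> l" using p(2) by (auto simp: sub.cyclically_reduced_def l_def m_def)
  have "hd w \<in> set w" "last w \<in> set w" using w(2) by auto
  then have lm': "m \<in> \<Lambda>" "l \<in> \<Lambda>"
    using sub.reduced_words[OF w(1)]
    unfolding l_def m_def by (auto intro: sub.words_index)
  note c = core_reduced[OF w, folded l_def m_def]
  have lr: "reduced (link m l)" using link_reduced lm lm' by blast
  have sc: "cl (s l) \<in> carrier \<P>" "cl (s m) \<in> carrier \<P>" "cl (core w) \<in> carrier \<P>"
    "cl (link m l) \<in> carrier \<P>" "emb p \<in> carrier \<P>" "emb (sub.cl w) \<in> carrier \<P>"
    using s lm' c lr p(1) w(1) by auto
  have sl: "cl (s l) = cl (s m) \<otimes>\<^bsub>\<P>\<^esub> cl (link m l)"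
    using link_cl[OF lm' lm] cl_append[of "s m" "link m l"] s lm' lr by auto
  have "inv\<^bsub>\<P>\<^esub> cl (s l) \<otimes>\<^bsub>\<P>\<^esub> emb (sub.cl w) \<otimes>\<^bsub>\<P>\<^esub> cl (s l)
      = cl (core w) \<otimes>\<^bsub>\<P>\<^esub> inv\<^bsub>\<P>\<^esub> cl (s m) \<otimes>\<^bsub>\<P>\<^esub> cl (s l)"
    using emb_cl[OF w] sc by (simp add: l_def[symmetric] m_def[symmetric] P.m_assoc)
  also have "\<dots> = cl (core w) \<otimes>\<^bsub>\<P>\<^esub> cl (link m l)"
    using sc by (simp add: sl P.m_assoc)
  also have "\<dots> = cl (core w @ link m l)"
    using cl_append c lr by (metis reduced_words)
  finally have cw: "cl (core w @ link m l) = inv\<^bsub>\<P>\<^esub> cl (s l) \<otimes>\<^bsub>\<P>\<^esub> emb (sub.cl w) \<otimes>\<^bsub>\<P>\<^esub> cl (s l)" by simp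
  have "cyclically_reduced (core w @ link m l)"
    using c lr link_ends[OF lm' lm]
    by (auto simp: cyclically_reduced_def distinct_adj_ends reduced_append hd_append hd_map last_map
        split: if_splits)
  moreover have "conj_letter (emb (sub.cl w))"
  proof -
    have eg: "emb g = emb p \<otimes>\<^bsub>\<P>\<^esub> emb (sub.cl w) \<otimes>\<^bsub>\<P>\<^esub> inv\<^bsub>\<P>\<^esub> emb p"
      using p(1,3) w(1) by auto
    have "conj_letter (inv\<^bsub>\<P>\<^esub> emb p \<otimes>\<^bsub>\<P>\<^esub> emb g \<otimes>\<^bsub>\<P>\<^esub> inv\<^bsub>\<P>\<^esub> (inv\<^bsub>\<P>\<^esub> emb p))"
      by (rule conj_letter_conj[OF assms(2)]) (use sc in simp)
    then show ?thesis using eg sc by (simp add: P.m_assoc)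
  qed
  then have "conj_letter (inv\<^bsub>\<P>\<^esub> cl (s l) \<otimes>\<^bsub>\<P>\<^esub> emb (sub.cl w) \<otimes>\<^bsub>\<P>\<^esub> inv\<^bsub>\<P>\<^esub> (inv\<^bsub>\<P>\<^esub> cl (s l)))"
    by (rule conj_letter_conj) (use sc in simp)
  then have "conj_letter (cl (core w @ link m l))" using cw sc by simp
  ultimately show False using cyclically_reduced_not_conj_letter by blast
qed

end

section \<open>Counting generators of a kernel in a free subgroup\<close>

context group
begin

text \<open>The lower half of the Schreier index formula for the kernel \<open>L\<close> of a homomorphism from \<open>K\<close> onto \<open>Q\<close>:
  if \<open>K\<close> is free on \<open>k 0, \<dots>, k (r - 1)\<close>, then \<open>L\<close> needs at least \<open>|Q| (r - 1) + 1\<close> generators. Freeness is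
  used in the form that the cocycles on \<open>K\<close> with values in the functions from \<open>Q\<close> to the group of order
  two (written as \<open>bool\<close>, with \<open>\<noteq>\<close> as addition) can be prescribed on the generators; so there are at
  least \<open>2\<^bsup>r |Q|\<^esup>\<close> of them. A cocycle is determined by its restriction to \<open>L\<close>, which is a homomorphism
  and so is given by its values on a generating set \<open>T\<close> of \<open>L\<close>, together with
  its values on representatives of the nontrivial cosets of \<open>L\<close>.\<close>

lemma kernel_rank_lower_bound:
  fixes k :: "nat \<Rightarrow> 'a" and \<phi> :: "'a \<Rightarrow> 'q" and r :: nat
  assumes k: "\<And>i. i < r \<Longrightarrow> k i \<in> carrier G"
    and K: "K = generate G (k ` {..<r})"
    and Q: "group Q" "finite (carrier Q)" and \<phi>: "\<phi> \<in> hom G Q" "\<phi> ` K = carrier Q"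
    and cocycle: "\<And>f :: nat \<Rightarrow> 'q \<Rightarrow> bool. \<exists>c. (\<forall>g\<in>K. \<forall>h\<in>K. \<forall>x\<in>carrier Q.
        c (g \<otimes> h) x = (c g (\<phi> h \<otimes>\<^bsub>Q\<^esub> x) \<noteq> c h x)) \<and> (\<forall>i<r. \<forall>x\<in>carrier Q. c (k i) x = f i x)"
    and T: "finite T" "generate G T = K \<inter> kernel G Q \<phi>"
  shows "r * card (carrier Q) \<le> card T + (card (carrier Q) - 1)"
proof -
  interpret Q: group Q by fact
  interpret \<phi>: group_hom G Q \<phi> by unfold_locales fact
  let ?n = "card (carrier Q)"
  have ks: "k ` {..<r} \<subseteq> carrier G" using k by auto
  interpret K: subgroup K G unfolding K by (rule generate_is_subgroup[OF ks])
  have Kc: "\<And>g. g \<in> K \<Longrightarrow> g \<in> carrier G" using K.subset by blast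
  have kK: "k i \<in> K" if "i < r" for i unfolding K using that by (intro generate.incl) auto
  have TL: "T \<subseteq> K \<inter> kernel G Q \<phi>" unfolding T(2)[symmetric] by (auto intro: generate.incl)
  have "\<exists>c. \<forall>f :: nat \<Rightarrow> 'q \<Rightarrow> bool. (\<forall>g\<in>K. \<forall>h\<in>K. \<forall>x\<in>carrier Q.
        c f (g \<otimes> h) x = (c f g (\<phi> h \<otimes>\<^bsub>Q\<^esub> x) \<noteq> c f h x)) \<and> (\<forall>i<r. \<forall>x\<in>carrier Q. c f (k i) x = f i x)"
    by (rule choice) (use cocycle in blast)
  then obtain c :: "(nat \<Rightarrow> 'q \<Rightarrow> bool) \<Rightarrow> 'a \<Rightarrow> 'q \<Rightarrow> bool" where
    c: "\<And>f g h x. g \<in> K \<Longrightarrow> h \<in> K \<Longrightarrow> x \<in> carrier Q \<Longrightarrow>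
        c f (g \<otimes> h) x = (c f g (\<phi> h \<otimes>\<^bsub>Q\<^esub> x) \<noteq> c f h x)"
    and ck: "\<And>f i x. i < r \<Longrightarrow> x \<in> carrier Q \<Longrightarrow> c f (k i) x = f i x"
    by metis
  have c1: "\<not> c f \<one> x" if "x \<in> carrier Q" for f x
    using c[OF K.one_closed K.one_closed that, of f] that by simp
  have "\<exists>t. \<forall>x\<in>carrier Q. t x \<in> K \<and> \<phi> (t x) = x"
    by (rule bchoice) (metis \<phi>(2) imageE)
  then obtain t0 where t0: "\<And>x. x \<in> carrier Q \<Longrightarrow> t0 x \<in> K \<and> \<phi> (t0 x) = x" by blast
  \<comment> \<open>The trivial coset is represented by the unit, where every cocycle vanishes; this saves one bit.\<close>
  define t where "t = t0(\<one>\<^bsub>Q\<^esub> := \<one>)"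
  have t: "t x \<in> K" "\<phi> (t x) = x" if "x \<in> carrier Q" for x
    using t0[OF that] that by (auto simp: t_def)
  define \<Psi> where "\<Psi> F = (restrict (\<lambda>g. c (curry F) g \<one>\<^bsub>Q\<^esub>) T,
    restrict (\<lambda>x. c (curry F) (t x) \<one>\<^bsub>Q\<^esub>) (carrier Q - {\<one>\<^bsub>Q\<^esub>}))" for F
  let ?D = "({..<r} \<times> carrier Q) \<rightarrow>\<^sub>E (UNIV :: bool set)"
  let ?R = "(T \<rightarrow>\<^sub>E (UNIV :: bool set)) \<times> ((carrier Q - {\<one>\<^bsub>Q\<^esub>}) \<rightarrow>\<^sub>E (UNIV :: bool set))"
  have "inj_on \<Psi> ?D"
  proof (rule inj_onI)
    fix F F' assume F: "F \<in> ?D" "F' \<in> ?D" and eq: "\<Psi> F = \<Psi> F'"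
    define f f' where "f = curry F" and "f' = curry F'"
    have eqs: "restrict (\<lambda>g. c f g \<one>\<^bsub>Q\<^esub>) T = restrict (\<lambda>g. c f' g \<one>\<^bsub>Q\<^esub>) T"
      "restrict (\<lambda>x. c f (t x) \<one>\<^bsub>Q\<^esub>) (carrier Q - {\<one>\<^bsub>Q\<^esub>}) =
       restrict (\<lambda>x. c f' (t x) \<one>\<^bsub>Q\<^esub>) (carrier Q - {\<one>\<^bsub>Q\<^esub>})"
      using eq by (simp_all only: \<Psi>_def f_def f'_def prod.inject)
    have eqT: "c f g \<one>\<^bsub>Q\<^esub> = c f' g \<one>\<^bsub>Q\<^esub>" if "g \<in> T" for g
      using fun_cong[OF eqs(1), of g] that by simp
    have eqt: "c f (t x) \<one>\<^bsub>Q\<^esub> = c f' (t x) \<one>\<^bsub>Q\<^esub>" if "x \<in> carrier Q" for x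
    proof (cases "x = \<one>\<^bsub>Q\<^esub>")
      case True
      then show ?thesis using c1 by (simp add: t_def)
    next
      case False
      then have "x \<in> carrier Q - {\<one>\<^bsub>Q\<^esub>}" using that by simp
      then show ?thesis
        using fun_cong[OF eqs(2), of x] by simp
    qed
    have L: "g \<in> K \<and> \<phi> g = \<one>\<^bsub>Q\<^esub> \<and> c f g \<one>\<^bsub>Q\<^esub> = c f' g \<one>\<^bsub>Q\<^esub>" if "g \<in> generate G T" for g
      using that
    proof (induction rule: generate.induct)
      case one
      then show ?case using c1 by simp
    next
      case (incl h)
      then show ?case using TL eqT by (auto simp: kernel_def)
    next
      case (inv h)
      then have h: "h \<in> K" "\<phi> h = \<one>\<^bsub>Q\<^esub>" "inv h \<in> K" using TL by (auto simp: kernel_def)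
      have "c f'' (inv h) \<one>\<^bsub>Q\<^esub> = c f'' h \<one>\<^bsub>Q\<^esub>" for f''
        using c[OF h(3,1), of "\<one>\<^bsub>Q\<^esub>" f''] c1[of "\<one>\<^bsub>Q\<^esub>" f''] h Kc[OF h(1)] by auto
      then show ?case using h eqT[OF inv] Kc[OF h(1)] by simp
    next
      case (eng g h)
      then show ?case using c[of g h "\<one>\<^bsub>Q\<^esub>"] Kc by simp
    qed
    have cK: "c f g \<one>\<^bsub>Q\<^esub> = c f' g \<one>\<^bsub>Q\<^esub>" if g: "g \<in> K" for g
    proof -
      define x where "x = \<phi> g"
      have x: "x \<in> carrier Q" using g Kc by (simp add: x_def)
      define l where "l = inv (t x) \<otimes> g"
      have l: "l \<in> K" "\<phi> l = \<one>\<^bsub>Q\<^esub>"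
        using t[OF x] g Kc by (auto simp: l_def x_def)
      then have "l \<in> generate G T" unfolding T(2) using Kc by (auto simp: kernel_def)
      then have "c f l \<one>\<^bsub>Q\<^esub> = c f' l \<one>\<^bsub>Q\<^esub>" using L by blast
      moreover have "g = t x \<otimes> l" using t[OF x] g Kc by (simp add: l_def)
      ultimately show ?thesis using c[OF t(1)[OF x] l(1), of "\<one>\<^bsub>Q\<^esub>"] l(2) eqt[OF x] by simp
    qed
    have "F (i, x) = F' (i, x)" if ix: "i < r" "x \<in> carrier Q" for i x
    proof -
      have "c f'' (k i \<otimes> t x) \<one>\<^bsub>Q\<^esub> = (f'' i x \<noteq> c f'' (t x) \<one>\<^bsub>Q\<^esub>)" for f''
        using c[OF kK[OF ix(1)] t(1)[OF ix(2)], of "\<one>\<^bsub>Q\<^esub>" f''] t(2)[OF ix(2)] ck[OF ix] ix(2) by simp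
      from this[of f] this[of f'] have "f i x = f' i x"
        using cK[of "k i \<otimes> t x"] cK[of "t x"] t(1)[OF ix(2)] kK[OF ix(1)] by auto
      then show ?thesis by (simp add: f_def f'_def)
    qed
    then show "F = F'" using F by (intro PiE_ext[OF F]) auto
  qed
  moreover have "\<Psi> ` ?D \<subseteq> ?R" by (auto simp: \<Psi>_def)
  moreover have "finite ?R" using T(1) Q(2) by (intro finite_cartesian_product finite_PiE) auto
  ultimately have "card ?D \<le> card ?R" by (rule card_inj_on_le)
  moreover have "card ?D = 2 ^ (r * ?n)"
    using Q(2) by (subst card_PiE) (auto simp: card_cartesian_product)
  moreover have "card ?R = 2 ^ (card T + (?n - 1))"
    using T(1) Q(2) by (simp add: card_cartesian_product card_PiE power_add)
  ultimately show ?thesis by simp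
qed

end

section \<open>Free subgroups obtained by gluing loops\<close>

lemma acts_on_conjugate:
  assumes "acts_on G Y act" and "\<And>y. y \<in> Y \<Longrightarrow> D y \<in> Y" "\<And>y. y \<in> Y \<Longrightarrow> D (D y) = y"
  shows "acts_on G Y (\<lambda>g y. D (act g (D y)))"
  using assms acts_onD[OF assms(1)] unfolding acts_on_def by simp

text \<open>The subgroup \<open>K\<close> is generated by the elements \<open>\<alpha>\<^sub>i\<^sup>-\<^sup>1 \<beta>\<^sub>i\<close>, where the reduced words \<open>\<alpha>\<^sub>i\<close> and \<open>\<beta>\<^sub>i\<close> prolong a
  common stem by \<open>a\<^sub>i\<close> and by \<open>c\<^sub>i a'\<^sub>i\<close>. Words are read from the right as paths that start at the empty
  word; so the \<open>i\<close>-th generator is the loop that appears when the end of \<open>\<beta>\<^sub>i\<close> is glued to the end of \<open>\<alpha>\<^sub>i\<close>.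
  As no stem is a suffix of another one, the loops do not interfere and \<open>K\<close> is free on them. The
  gluing modifies the action of a single factor \<open>\<kappa>\<close>, the one that contains the \<open>c\<^sub>i\<close>.\<close>

locale glued_loops = free_product_of_groups I \<G>
  for I :: "'i set" and \<G> :: "'i \<Rightarrow> ('a, 'b) monoid_scheme" +
  fixes \<kappa> :: 'i and r :: nat and a a' :: "nat \<Rightarrow> 'i \<times> 'a" and c :: "nat \<Rightarrow> 'a"
    and stem :: "nat \<Rightarrow> ('i \<times> 'a) list"
  assumes \<kappa>: "\<kappa> \<in> I"
    and a: "i < r \<Longrightarrow> reduced (a i # stem i)" "i < r \<Longrightarrow> fst (a i) \<noteq> \<kappa>"
    and a': "i < r \<Longrightarrow> reduced (a' i # stem i)" "i < r \<Longrightarrow> fst (a' i) \<noteq> \<kappa>"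
    and a_a': "i < r \<Longrightarrow> a i \<noteq> a' i"
    and c: "i < r \<Longrightarrow> c i \<in> carrier (\<G> \<kappa>)" "i < r \<Longrightarrow> c i \<noteq> \<one>\<^bsub>\<G> \<kappa>\<^esub>"
    and stem: "i < r \<Longrightarrow> j < r \<Longrightarrow> suffix (stem i) (stem j) \<Longrightarrow> i = j"
begin

definition \<alpha> :: "nat \<Rightarrow> ('i \<times> 'a) list" where "\<alpha> i = a i # stem i"
definition \<beta> :: "nat \<Rightarrow> ('i \<times> 'a) list" where "\<beta> i = (\<kappa>, c i) # a' i # stem i"

definition loop :: "nat \<Rightarrow> ('i \<times> 'a) list set" where
  "loop i = inv\<^bsub>\<P>\<^esub> cl (\<alpha> i) \<otimes>\<^bsub>\<P>\<^esub> cl (\<beta> i)"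

lemma \<alpha>_reduced: "i < r \<Longrightarrow> reduced (\<alpha> i)"
  using a by (simp add: \<alpha>_def)

lemma \<beta>_reduced: "i < r \<Longrightarrow> reduced (\<beta> i)"
  using a' c \<kappa> by (simp add: \<beta>_def reduced_Cons)

lemma loop_closed: "i < r \<Longrightarrow> loop i \<in> carrier \<P>"
  unfolding loop_def using cl_closed[OF reduced_words[OF \<alpha>_reduced]]
    cl_closed[OF reduced_words[OF \<beta>_reduced]] by simp

lemma \<alpha>_eq_iff: "i < r \<Longrightarrow> j < r \<Longrightarrow> \<alpha> i = \<alpha> j \<longleftrightarrow> i = j"
  using stem by (auto simp: \<alpha>_def)

lemma \<beta>_eq_iff: "i < r \<Longrightarrow> j < r \<Longrightarrow> \<beta> i = \<beta> j \<longleftrightarrow> i = j"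
  using stem by (auto simp: \<beta>_def)

lemma \<alpha>_neq_\<beta>: "i < r \<Longrightarrow> \<alpha> i \<noteq> \<beta> j"
  using a(2)[of i] by (auto simp: \<alpha>_def \<beta>_def)

text \<open>The involution that exchanges the ends of \<open>\<alpha>\<^sub>i\<close> and \<open>\<beta>\<^sub>i\<close>, with the permutation \<open>q i\<close> of a fibre
  (and its inverse \<open>q' i\<close>) as transition from the end of \<open>\<beta>\<^sub>i\<close> to the end of \<open>\<alpha>\<^sub>i\<close>.\<close>

definition swap :: "(nat \<Rightarrow> 'z \<Rightarrow> 'z) \<Rightarrow> (nat \<Rightarrow> 'z \<Rightarrow> 'z) \<Rightarrow>
    'z \<times> ('i \<times> 'a) list \<Rightarrow> 'z \<times> ('i \<times> 'a) list" where
  "swap q q' y = (case y of (z, w) \<Rightarrow>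
     if \<exists>i<r. w = \<alpha> i then (q' (THE i. i < r \<and> w = \<alpha> i) z, \<beta> (THE i. i < r \<and> w = \<alpha> i))
     else if \<exists>i<r. w = \<beta> i then (q (THE i. i < r \<and> w = \<beta> i) z, \<alpha> (THE i. i < r \<and> w = \<beta> i))
     else (z, w))"

lemma swap_simps:
  shows "i < r \<Longrightarrow> swap q q' (z, \<alpha> i) = (q' i z, \<beta> i)"
    and "i < r \<Longrightarrow> swap q q' (z, \<beta> i) = (q i z, \<alpha> i)"
    and "w \<notin> \<alpha> ` {..<r} \<Longrightarrow> w \<notin> \<beta> ` {..<r} \<Longrightarrow> swap q q' (z, w) = (z, w)"
proof -
  assume i: "i < r"
  have "(THE j. j < r \<and> \<alpha> i = \<alpha> j) = i" "(THE j. j < r \<and> \<beta> i = \<beta> j) = i"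
    using i \<alpha>_eq_iff \<beta>_eq_iff by (auto intro!: the_equality)
  then show "swap q q' (z, \<alpha> i) = (q' i z, \<beta> i)" "swap q q' (z, \<beta> i) = (q i z, \<alpha> i)"
    using i \<alpha>_neq_\<beta>[symmetric] unfolding swap_def by auto
next
  assume "w \<notin> \<alpha> ` {..<r}" "w \<notin> \<beta> ` {..<r}"
  then show "swap q q' (z, w) = (z, w)" unfolding swap_def by auto
qed

text \<open>All factors act on \<open>Z\<close> times the reduced words by their normal form action, but the action of \<open>\<kappa>\<close> is
  conjugated by \<open>swap\<close>. Along a stem nothing changes; the last step of \<open>\<beta>\<^sub>i\<close> is a step in \<open>\<kappa>\<close>, and it now
  leads to the end of \<open>\<alpha>\<^sub>i\<close>, over the point \<open>q i z\<close>. The factors still act freely.\<close>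

theorem prescribed_action:
  fixes Z :: "'z set" and q q' :: "nat \<Rightarrow> 'z \<Rightarrow> 'z"
  assumes q: "\<And>i z. i < r \<Longrightarrow> z \<in> Z \<Longrightarrow> q i z \<in> Z \<and> q' i (q i z) = z"
    and q': "\<And>i z. i < r \<Longrightarrow> z \<in> Z \<Longrightarrow> q' i z \<in> Z \<and> q i (q' i z) = z"
  obtains act where "acts_on \<P> (Z \<times> {w. reduced w}) act"
    "\<And>i z. i < r \<Longrightarrow> z \<in> Z \<Longrightarrow> act (loop i) (z, []) = (q i z, [])"
    "\<And>i x y. i \<in> I \<Longrightarrow> x \<in> carrier (\<G> i) \<Longrightarrow> y \<in> Z \<times> {w. reduced w} \<Longrightarrow>
      act (letter i x) y = y \<Longrightarrow> x = \<one>\<^bsub>\<G> i\<^esub>"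
proof -
  let ?Y = "Z \<times> {w. reduced w}"
  let ?D = "swap q q'"
  let ?S = "\<alpha> ` {..<r} \<union> \<beta> ` {..<r}"
  define base where "base i x y = (fst y, mult_letter i x (snd y))"
    for i x and y :: "'z \<times> ('i \<times> 'a) list"
  define \<rho> where "\<rho> i x y = (if i = \<kappa> then ?D (base i x (?D y)) else base i x y)" for i x y
  have D: "?D y \<in> ?Y \<and> ?D (?D y) = y" if y: "y \<in> ?Y" for y
  proof -
    obtain z w where zw: "y = (z, w)" "z \<in> Z" "reduced w" using y by auto
    consider i where "i < r" "w = \<alpha> i" | i where "i < r" "w = \<beta> i" | "w \<notin> ?S" by blast
    then show ?thesis
      by cases (use zw q q' \<alpha>_reduced \<beta>_reduced in \<open>auto simp: swap_simps\<close>)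
  qed
  have base: "acts_on (\<G> i) ?Y (base i)" if "i \<in> I" for i
    using acts_onD[OF mult_letter_acts[OF that]] unfolding acts_on_def base_def by auto
  have "acts_on (\<G> i) ?Y (\<rho> i)" if i: "i \<in> I" for i
  proof (cases "i = \<kappa>")
    case True
    have "acts_on (\<G> i) ?Y (\<lambda>x y. ?D (base i x (?D y)))"
      by (rule acts_on_conjugate[OF base[OF i]]) (use D in auto)
    then show ?thesis using True by (simp add: \<rho>_def[abs_def])
  next
    case False
    then show ?thesis using base[OF i] by (simp add: \<rho>_def[abs_def])
  qed
  then obtain act where act: "acts_on \<P> ?Y act"
    and l: "\<And>i x y. i \<in> I \<Longrightarrow> x \<in> carrier (\<G> i) \<Longrightarrow> y \<in> ?Y \<Longrightarrow> act (letter i x) y = \<rho> i x y"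
    using action_extends[of ?Y \<rho>] by blast
  note actD = acts_onD[OF act]
  have step: "act (cl ((i, x) # w)) (z, []) = \<rho> i x (z, w)"
    if "reduced ((i, x) # w)" "z \<in> Z" "act (cl w) (z, []) = (z, w)" for i x w z
  proof -
    have *: "i \<in> I" "x \<in> carrier (\<G> i)" "reduced w" using that(1) by (auto simp: reduced_Cons)
    have "act (letter i x \<otimes>\<^bsub>\<P>\<^esub> cl w) (z, []) = act (letter i x) (act (cl w) (z, []))"
      by (rule actD(3)) (use * that in auto)
    then show ?thesis using l[of i x "(z, w)"] * that cl_Cons[of i x w] by auto
  qed
  have walk: "act (cl w) (z, []) = (z, w)"
    if "reduced w" "z \<in> Z" "\<And>v. suffix v w \<Longrightarrow> v \<notin> ?S" for w z
    using that
  proof (induction w)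
    case Nil
    then show ?case using actD(1)[of "(z, [])"] by (simp add: one_P)
  next
    case (Cons p w)
    obtain i x where p: "p = (i, x)" by force
    have "reduced w" using Cons.prems(1) p by (simp add: reduced_Cons)
    have ih: "act (cl w) (z, []) = (z, w)"
      using Cons.IH \<open>reduced w\<close> Cons.prems(2,3) by (simp add: suffix_Cons)
    have s: "w \<notin> ?S" "p # w \<notin> ?S"
      using Cons.prems(3)[of w] Cons.prems(3)[of "p # w"] by (auto simp: suffix_Cons)
    have "\<rho> i x (z, w) = (z, p # w)"
      using s mult_letter_Cons[of i x w] Cons.prems(1) p
      by (cases "i = \<kappa>") (auto simp: \<rho>_def base_def swap_simps)
    then show ?case using step[of i x w z] ih Cons.prems(1,2) p by simp
  qed
  have stem_walk: "act (cl (stem i)) (z, []) = (z, stem i)" if i: "i < r" and z: "z \<in> Z" for i z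
  proof (rule walk[OF _ z])
    show "reduced (stem i)" using a(1)[OF i] by (cases "a i") (simp add: reduced_Cons)
    fix v assume v: "suffix v (stem i)"
    show "v \<notin> ?S"
    proof
      assume "v \<in> ?S"
      then obtain j u where j: "j < r" "v = u @ stem j" "u \<noteq> []"
        by (auto simp: \<alpha>_def \<beta>_def)
      then have "suffix (stem j) v" by (simp add: suffix_def)
      then have "suffix (stem j) (stem i)" using v suffix_order.trans by blast
      then have "i = j" using stem i j(1) by blast
      then show False using v j(2,3) by (auto simp: suffix_def)
    qed
  qed
  have untwisted: "act (cl (p # stem i)) (z, []) = (z, p # stem i)"
    if "i < r" "z \<in> Z" "reduced (p # stem i)" "fst p \<noteq> \<kappa>" for i z p
    using step[of "fst p" "snd p" "stem i" z] stem_walk that mult_letter_Cons[of "fst p" "snd p"]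
    by (simp add: \<rho>_def base_def)
  have \<beta>: "act (cl (\<beta> i)) (z, []) = (q i z, \<alpha> i)" if i: "i < r" and z: "z \<in> Z" for i z
  proof -
    have g: "a' i # stem i \<notin> ?S"
    proof
      assume "a' i # stem i \<in> ?S"
      then consider j where "j < r" "a' i # stem i = \<alpha> j" | j where "j < r" "a' i # stem i = \<beta> j"
        by auto
      then show False
      proof cases
        case 1
        then have "i = j" using stem[OF i, of j] by (simp add: \<alpha>_def)
        then show False using 1 a_a'[OF i] by (simp add: \<alpha>_def)
      next
        case 2
        then show False using a'(2)[OF i] by (auto simp: \<beta>_def)
      qed
    qed
    have "act (cl (\<beta> i)) (z, []) = \<rho> \<kappa> (c i) (z, a' i # stem i)"
      unfolding \<beta>_def
      by (rule step) (use \<beta>_reduced[OF i] z untwisted[OF i z a'(1)[OF i] a'(2)[OF i]] in \<open>auto simp: \<beta>_def\<close>)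
    also have "\<dots> = ?D (z, \<beta> i)"
      using g mult_letter_Cons[of \<kappa> "c i" "a' i # stem i"] \<beta>_reduced[OF i]
      by (simp add: \<rho>_def base_def swap_simps \<beta>_def)
    finally show ?thesis using swap_simps(2)[OF i] by simp
  qed
  show ?thesis
  proof (rule that[OF act])
    fix i z assume i: "i < r" and z: "(z :: 'z) \<in> Z"
    have ac: "cl (\<alpha> i) \<in> carrier \<P>" "cl (\<beta> i) \<in> carrier \<P>"
      using \<alpha>_reduced[OF i] \<beta>_reduced[OF i] by auto
    have qz: "q i z \<in> Z" using q i z by blast
    have "act (loop i) (z, []) = act (inv\<^bsub>\<P>\<^esub> cl (\<alpha> i)) (act (cl (\<beta> i)) (z, []))"
      unfolding loop_def by (rule actD(3)) (use z ac in auto)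
    also have "\<dots> = act (inv\<^bsub>\<P>\<^esub> cl (\<alpha> i)) (act (cl (\<alpha> i)) (q i z, []))"
      using \<beta>[OF i z] untwisted[OF i qz a(1)[OF i] a(2)[OF i]] by (simp add: \<alpha>_def)
    also have "\<dots> = (q i z, [])"
      by (rule P.acts_on_inv[OF act]) (use qz ac in auto)
    finally show "act (loop i) (z, []) = (q i z, [])" .
  next
    fix i x y assume i: "i \<in> I" and x: "x \<in> carrier (\<G> i)" and y: "y \<in> ?Y"
      and fix_y: "act (letter i x) y = y"
    have base_fix: "x = \<one>\<^bsub>\<G> i\<^esub>" if "y' \<in> ?Y" "base i x y' = y'" for y'
      using mult_letter_free[OF i x] that by (cases y') (auto simp: base_def)
    show "x = \<one>\<^bsub>\<G> i\<^esub>"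
    proof (cases "i = \<kappa>")
      case True
      then have "?D (base i x (?D y)) = y" using l[OF i x y] fix_y by (simp add: \<rho>_def)
      moreover have "base i x (?D y) \<in> ?Y" using acts_onD(2)[OF base[OF i]] D y x by blast
      ultimately have "base i x (?D y) = ?D y" using D by metis
      then show ?thesis using base_fix D y by blast
    next
      case False
      then show ?thesis using l[OF i x y] fix_y base_fix y by (simp add: \<rho>_def)
    qed
  qed
qed

definition loop_group :: "('i \<times> 'a) list set set" where
  "loop_group = generate \<P> (loop ` {..<r})"

lemma loop_group_subgroup: "subgroup loop_group \<P>"
  unfolding loop_group_def by (rule P.generate_is_subgroup) (use loop_closed in auto)

text \<open>With trivial fibre, \<open>K\<close> fixes the empty word, whereas the factors act freely.\<close>

lemma loop_group_factor_free:
  assumes g: "g \<in> loop_group" "conj_letter g"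
  shows "g = \<one>\<^bsub>\<P>\<^esub>"
proof -
  let ?Y = "{()} \<times> {w. reduced w}"
  obtain act where act: "acts_on \<P> ?Y act"
    and lo: "\<And>i z. i < r \<Longrightarrow> z \<in> {()} \<Longrightarrow> act (loop i) (z, []) = (z, [])"
    and fr: "\<And>i x y. i \<in> I \<Longrightarrow> x \<in> carrier (\<G> i) \<Longrightarrow> y \<in> ?Y \<Longrightarrow> act (letter i x) y = y \<Longrightarrow> x = \<one>\<^bsub>\<G> i\<^esub>"
    using prescribed_action[of "{()}" "\<lambda>i z. z" "\<lambda>i z. z"] by auto
  note actD = acts_onD[OF act]
  have base: "((), []) \<in> ?Y" by simp
  have "g \<in> carrier \<P> \<and> act g ((), []) = ((), [])"
    using g(1) unfolding loop_group_def
  proof (induction rule: generate.induct)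
    case (inv h)
    then have h: "h \<in> carrier \<P>" "act h ((), []) = ((), [])" using lo loop_closed by auto
    then show ?case using P.acts_on_inv(1)[OF act base h(1)] by simp
  qed (use actD(1)[OF base] actD(3)[OF base] lo loop_closed in auto)
  then have gc: "g \<in> carrier \<P>" "act g ((), []) = ((), [])" by auto
  obtain p i x where p: "p \<in> carrier \<P>" "i \<in> I" "x \<in> carrier (\<G> i)"
    "g = p \<otimes>\<^bsub>\<P>\<^esub> letter i x \<otimes>\<^bsub>\<P>\<^esub> inv\<^bsub>\<P>\<^esub> p"
    using g(2) unfolding conj_letter_def by blast
  define y where "y = act (inv\<^bsub>\<P>\<^esub> p) ((), [])"
  have y: "y \<in> ?Y" using actD(2)[OF base] p(1) by (simp add: y_def)
  have lx: "letter i x = inv\<^bsub>\<P>\<^esub> p \<otimes>\<^bsub>\<P>\<^esub> g \<otimes>\<^bsub>\<P>\<^esub> p"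
    using P.conj_eq_iff[of p "letter i x" g] p gc by simp
  have "act p y = ((), [])" unfolding y_def by (rule P.acts_on_inv(2)[OF act base p(1)])
  then have "act (letter i x) y = y"
    unfolding lx using actD(3)[OF y] actD(3)[OF base] p(1) gc by (simp add: y_def P.m_assoc)
  then show ?thesis using fr[OF p(2,3) y] p letter_one by simp
qed

text \<open>The fibre is \<open>Q \<times> bool\<close>, and the \<open>i\<close>-th loop acts on it by \<open>(x, b) \<mapsto> (\<phi>(loop i) x, b + f i x)\<close>. Then every
  element \<open>g\<close> of \<open>K\<close> acts by a formula of the same kind, whose second part is the cocycle.\<close>

lemma loop_group_cocycle:
  fixes f :: "nat \<Rightarrow> 'q \<Rightarrow> bool"
  assumes Q: "group Q" and \<phi>: "\<phi> \<in> hom \<P> Q"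
  shows "\<exists>c. (\<forall>g\<in>loop_group. \<forall>h\<in>loop_group. \<forall>x\<in>carrier Q.
      c (g \<otimes>\<^bsub>\<P>\<^esub> h) x = (c g (\<phi> h \<otimes>\<^bsub>Q\<^esub> x) \<noteq> c h x)) \<and>
    (\<forall>i<r. \<forall>x\<in>carrier Q. c (loop i) x = f i x)"
proof -
  interpret Q: group Q by fact
  interpret \<phi>: group_hom \<P> Q \<phi> by unfold_locales fact
  let ?Z = "carrier Q \<times> (UNIV :: bool set)"
  let ?Y = "?Z \<times> {w. reduced w}"
  define q where "q i z = (\<phi> (loop i) \<otimes>\<^bsub>Q\<^esub> fst z, snd z \<noteq> f i (fst z))" for i and z :: "'q \<times> bool"
  define q' where "q' i z = (let x = inv\<^bsub>Q\<^esub> \<phi> (loop i) \<otimes>\<^bsub>Q\<^esub> fst z in (x, snd z \<noteq> f i x))"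
    for i and z :: "'q \<times> bool"
  have 1: "q i z \<in> ?Z \<and> q' i (q i z) = z" if "i < r" "z \<in> ?Z" for i z
    using that loop_closed[of i] by (cases z) (auto simp: q_def q'_def)
  have 2: "q' i z \<in> ?Z \<and> q i (q' i z) = z" if "i < r" "z \<in> ?Z" for i z
    using that loop_closed[of i] by (cases z) (auto simp: q_def q'_def Let_def)
  obtain act where act: "acts_on \<P> ?Y act"
    and lo: "\<And>i z. i < r \<Longrightarrow> z \<in> ?Z \<Longrightarrow> act (loop i) (z, []) = (q i z, [])"
    by (rule prescribed_action[of ?Z q q', OF 1 2]) blast+
  note actD = acts_onD[OF act]
  have base: "((x, b), []) \<in> ?Y" if "x \<in> carrier Q" for x and b :: bool using that by simp
  define c where "c g x = snd (fst (act g ((x, False), [])))" for g x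
  have K: "g \<in> carrier \<P> \<and> (\<forall>x\<in>carrier Q. \<exists>d. \<forall>b. act g ((x, b), []) = ((\<phi> g \<otimes>\<^bsub>Q\<^esub> x, b \<noteq> d), []))"
    if "g \<in> loop_group" for g
    using that unfolding loop_group_def
  proof (induction rule: generate.induct)
    case one
    have "act \<one>\<^bsub>\<P>\<^esub> ((x, b), []) = ((\<phi> \<one>\<^bsub>\<P>\<^esub> \<otimes>\<^bsub>Q\<^esub> x, b \<noteq> False), [])" if "x \<in> carrier Q" for x b
      using actD(1)[OF base[OF that]] that by simp
    then show ?case by blast
  next
    case (incl g)
    then obtain i where i: "i < r" "g = loop i" by auto
    then have "act g ((x, b), []) = ((\<phi> g \<otimes>\<^bsub>Q\<^esub> x, b \<noteq> f i x), [])" if "x \<in> carrier Q" for x b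
      using lo[of i "(x, b)"] that by (simp add: q_def)
    then show ?case using loop_closed i by blast
  next
    case (inv g)
    then obtain i where i: "i < r" "g = loop i" by auto
    have gc: "g \<in> carrier \<P>" using i loop_closed by simp
    have "act (inv\<^bsub>\<P>\<^esub> g) ((x, b), []) =
        ((\<phi> (inv\<^bsub>\<P>\<^esub> g) \<otimes>\<^bsub>Q\<^esub> x, b \<noteq> f i (\<phi> (inv\<^bsub>\<P>\<^esub> g) \<otimes>\<^bsub>Q\<^esub> x)), [])" if x: "x \<in> carrier Q" for x b
    proof -
      let ?x = "\<phi> (inv\<^bsub>\<P>\<^esub> g) \<otimes>\<^bsub>Q\<^esub> x"
      have xc: "?x \<in> carrier Q" using gc x by simp
      have "act g ((?x, b \<noteq> f i ?x), []) = ((x, b), [])"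
        using lo[of i "(?x, b \<noteq> f i ?x)"] i xc x gc by (auto simp: q_def)
      then show ?thesis
        using P.acts_on_inv(1)[OF act base[OF xc] gc] by metis
    qed
    then show ?case using gc by blast
  next
    case (eng g h)
    then have gh: "g \<in> carrier \<P>" "h \<in> carrier \<P>" by auto
    have "\<exists>d. \<forall>b. act (g \<otimes>\<^bsub>\<P>\<^esub> h) ((x, b), []) = ((\<phi> (g \<otimes>\<^bsub>\<P>\<^esub> h) \<otimes>\<^bsub>Q\<^esub> x, b \<noteq> d), [])"
      if x: "x \<in> carrier Q" for x
    proof -
      obtain d where d: "\<And>b. act h ((x, b), []) = ((\<phi> h \<otimes>\<^bsub>Q\<^esub> x, b \<noteq> d), [])"
        using eng x by blast
      obtain e where e: "\<And>b. act g ((\<phi> h \<otimes>\<^bsub>Q\<^esub> x, b), []) = ((\<phi> g \<otimes>\<^bsub>Q\<^esub> (\<phi> h \<otimes>\<^bsub>Q\<^esub> x), b \<noteq> e), [])"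
        using eng x gh by (meson Q.m_closed \<phi>.hom_closed)
      have "act (g \<otimes>\<^bsub>\<P>\<^esub> h) ((x, b), []) = ((\<phi> (g \<otimes>\<^bsub>\<P>\<^esub> h) \<otimes>\<^bsub>Q\<^esub> x, b \<noteq> (d \<noteq> e)), [])" for b
        using actD(3)[OF base[OF x] gh(2,1)] d e gh x by (auto simp: Q.m_assoc)
      then show ?thesis by blast
    qed
    then show ?case using gh by blast
  qed
  have cv: "act g ((x, b), []) = ((\<phi> g \<otimes>\<^bsub>Q\<^esub> x, b \<noteq> c g x), [])"
    if g: "g \<in> loop_group" and x: "x \<in> carrier Q" for g x b
  proof -
    obtain d where d: "\<And>b. act g ((x, b), []) = ((\<phi> g \<otimes>\<^bsub>Q\<^esub> x, b \<noteq> d), [])"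
      using K[OF g] x by blast
    then have "c g x = d" by (simp add: c_def)
    then show ?thesis using d by blast
  qed
  have kl: "loop i \<in> loop_group" if "i < r" for i
    unfolding loop_group_def using that by (intro generate.incl) auto
  show ?thesis
  proof (intro exI[of _ c] conjI ballI allI impI)
    fix g h x assume gh: "g \<in> loop_group" "h \<in> loop_group" and x: "x \<in> carrier Q"
    have ghc: "g \<in> carrier \<P>" "h \<in> carrier \<P>" using K gh by auto
    have "g \<otimes>\<^bsub>\<P>\<^esub> h \<in> loop_group" using loop_group_subgroup gh by (rule subgroup.m_closed)
    from cv[OF this x, of False] cv[OF gh(2) x, of False] cv[OF gh(1), of "\<phi> h \<otimes>\<^bsub>Q\<^esub> x"]
    show "c (g \<otimes>\<^bsub>\<P>\<^esub> h) x = (c g (\<phi> h \<otimes>\<^bsub>Q\<^esub> x) \<noteq> c h x)"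
      using actD(3)[OF base[OF x, of False] ghc(2,1)] ghc x by auto
  next
    fix i x assume "i < r" "x \<in> carrier Q"
    then show "c (loop i) x = f i x"
      using cv[OF kl, of i x False] lo[of i "(x, False)"] by (simp add: q_def)
  qed
qed

theorem loop_group_kernel_rank:
  assumes "group Q" "finite (carrier Q)" "\<phi> \<in> hom \<P> Q" "\<phi> ` loop_group = carrier Q"
    and "finite T" "generate \<P> T = loop_group \<inter> kernel \<P> Q \<phi>"
  shows "r * card (carrier Q) \<le> card T + (card (carrier Q) - 1)"
  by (rule P.kernel_rank_lower_bound[OF _ loop_group_def assms(1-4) loop_group_cocycle[OF assms(1,3)] assms(5,6)])
    (rule loop_closed)

end

section \<open>Ranks of subgroups\<close>

context group
begin

lemma group_rank_le:
  assumes "subgroup H G" "finite S" "generate G S = H"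
  shows "group_rank (G\<lparr>carrier := H\<rparr>) \<le> enat (card S)"
proof -
  have "S \<subseteq> H" using assms(3) by (auto intro: generate.incl)
  then have "generate (G\<lparr>carrier := H\<rparr>) S = H" using generate_consistent assms by simp
  then show ?thesis
    unfolding group_rank_def using \<open>S \<subseteq> H\<close> assms(2)
    by (intro INF_lower2[of S]) (auto simp: ecard_def)
qed

lemma group_rank_ge:
  assumes "subgroup H G" "\<And>S. finite S \<Longrightarrow> generate G S = H \<Longrightarrow> m \<le> card S"
  shows "enat m \<le> group_rank (G\<lparr>carrier := H\<rparr>)"
  unfolding group_rank_def
proof (rule INF_greatest)
  fix S assume "S \<in> {S. S \<subseteq> carrier (G\<lparr>carrier := H\<rparr>) \<and>
    generate (G\<lparr>carrier := H\<rparr>) S = carrier (G\<lparr>carrier := H\<rparr>)}"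
  then have "generate G S = H" using generate_consistent[OF _ assms(1), of S] by simp
  then show "enat m \<le> ecard S" using assms(2)[of S] by (auto simp: ecard_def)
qed

lemma group_rank_attained:
  assumes "subgroup H G" "group_rank (G\<lparr>carrier := H\<rparr>) = enat n"
  obtains S where "finite S" "card S = n" "generate G S = H"
proof -
  let ?R = "ecard ` {S. S \<subseteq> H \<and> generate (G\<lparr>carrier := H\<rparr>) S = H}"
  have eq: "group_rank (G\<lparr>carrier := H\<rparr>) = Inf ?R" by (simp add: group_rank_def)
  have "?R \<noteq> {}" using eq assms(2) by (auto simp: Inf_enat_def split: if_splits)
  then obtain z where "z \<in> ?R" by (meson ex_in_conv)
  then have "Inf ?R \<in> ?R" by (rule wellorder_InfI)
  then obtain S where S: "S \<subseteq> H" "generate (G\<lparr>carrier := H\<rparr>) S = H" "ecard S = enat n"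
    using eq assms(2) by auto
  then show ?thesis
    using that[of S] generate_consistent[OF S(1) assms(1)]
    by (auto simp: ecard_def split: if_splits)
qed

text \<open>The generator is the smallest positive power of \<open>x\<close> in \<open>L\<close>, by division with remainder.\<close>

lemma subgroup_of_cyclic:
  assumes x: "x \<in> carrier G" and L: "subgroup L G" "L \<subseteq> generate G {x}"
  obtains y where "y \<in> L" "L = generate G {y}"
proof -
  interpret L: subgroup L G by fact
  show ?thesis
  proof (cases "\<exists>n::nat. n > 0 \<and> x [^] n \<in> L")
    case False
    have "l = \<one>" if l: "l \<in> L" for l
    proof -
      obtain k :: int where k: "l = x [^] k" using l L(2) generate_pow[OF x] by auto
      have "inv l \<in> L" using l by simp
      then have "x [^] (- k) \<in> L" using k x by (simp add: int_pow_neg)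
      moreover have "\<not> j > 0" if "x [^] j \<in> L" for j :: int
        using False that by (metis int_pow_int zero_less_imp_eq_int)
      ultimately have "k = 0" using l k by (metis linorder_neqE_linordered_idom neg_0_less_iff_less)
      then show ?thesis using k by simp
    qed
    then have "L = generate G {\<one>}" using L.one_closed by (auto simp: generate_one)
    then show ?thesis using that L.one_closed by blast
  next
    case True
    define n where "n = (LEAST n::nat. n > 0 \<and> x [^] n \<in> L)"
    have n: "n > 0" "x [^] n \<in> L" using LeastI_ex[OF True] by (auto simp: n_def)
    have least: "m = 0" if "m < n" "x [^] m \<in> L" for m :: nat
      using not_less_Least[of m "\<lambda>n. n > 0 \<and> x [^] n \<in> L"] that by (auto simp: n_def)
    have "l \<in> generate G {x [^] n}" if l: "l \<in> L" for l
    proof -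
      obtain k :: int where k: "l = x [^] k" using l L(2) generate_pow[OF x] by auto
      have nk: "(x [^] n) [^] (k div int n) = x [^] (int n * (k div int n))"
        using x int_pow_pow[of x "int n" "k div int n"] by (simp add: int_pow_int)
      have "(x [^] n) [^] (- (k div int n)) \<otimes> l \<in> L"
        using subgroup_int_pow_closed[OF L(1) n(2)] l by blast
      also have "(x [^] n) [^] (- (k div int n)) \<otimes> l = x [^] (- (int n * (k div int n)) + k)"
        using x nk k int_pow_neg[of x "int n * (k div int n)"]
          int_pow_mult[of x "- (int n * (k div int n))" k] by (simp add: int_pow_neg)
      also have "- (int n * (k div int n)) + k = k mod int n"
        by (simp add: minus_mult_div_eq_mod[symmetric])
      finally have "x [^] (nat (k mod int n)) \<in> L"
        using n(1) int_pow_int[of G x "nat (k mod int n)"] by simp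
      moreover have "nat (k mod int n) < n" using n(1) by (simp add: nat_less_iff)
      ultimately have "nat (k mod int n) = 0" using least by blast
      moreover have "k mod int n \<ge> 0" using n(1) by simp
      ultimately have "k mod int n = 0" by linarith
      then have "l = (x [^] n) [^] (k div int n)" using nk k by (simp add: mod_eq_0_iff_dvd)
      then show ?thesis using generate_pow[of "x [^] n"] x by auto
    qed
    moreover have "generate G {x [^] n} \<subseteq> L"
      using n(2) L(1) by (intro generate_subgroup_incl) auto
    ultimately show ?thesis using that[OF n(2)] by blast
  qed
qed

lemma cyclic_iff_group_rank:
  assumes H: "subgroup H G"
  shows "group_rank (G\<lparr>carrier := H\<rparr>) < 2 \<longleftrightarrow> (\<exists>x\<in>H. H = generate G {x})"
proof
  assume "\<exists>x\<in>H. H = generate G {x}"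
  then have "group_rank (G\<lparr>carrier := H\<rparr>) \<le> enat 1"
    using group_rank_le[OF H] by (metis card_1_singleton_iff finite.emptyI finite_insert One_nat_def)
  also have "enat 1 < 2" by (simp add: numeral_eq_enat)
  finally show "group_rank (G\<lparr>carrier := H\<rparr>) < 2" .
next
  assume *: "group_rank (G\<lparr>carrier := H\<rparr>) < 2"
  then obtain n where n: "group_rank (G\<lparr>carrier := H\<rparr>) = enat n"
    by (cases "group_rank (G\<lparr>carrier := H\<rparr>)") auto
  with * have "n = 0 \<or> n = 1" by (auto simp: numeral_eq_enat)
  obtain S where S: "finite S" "card S = n" "generate G S = H"
    using group_rank_attained[OF H n] .
  show "\<exists>x\<in>H. H = generate G {x}"
  proof (cases "n = 0")
    case True
    then have "H = {\<one>}" using S by (simp add: generate_empty)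
    then show ?thesis by (simp add: generate_one)
  next
    case False
    then obtain x where "S = {x}" using S \<open>n = 0 \<or> n = 1\<close> by (auto simp: card_1_singleton_iff)
    then show ?thesis using S(3) by (auto intro: generate.incl)
  qed
qed

text \<open>Rank at least two means noncyclic, and this passes to larger subgroups, although the rank is not
  monotone.\<close>

lemma group_rank_ge_2_mono:
  assumes "subgroup L G" "subgroup H G" "L \<subseteq> H" "2 \<le> group_rank (G\<lparr>carrier := L\<rparr>)"
  shows "2 \<le> group_rank (G\<lparr>carrier := H\<rparr>)"
proof (rule ccontr)
  assume "\<not> ?thesis"
  then obtain x where x: "x \<in> H" "H = generate G {x}"
    using cyclic_iff_group_rank[OF assms(2)] by auto
  then have "x \<in> carrier G" using subgroup.subset[OF assms(2)] by blast
  then obtain y where "y \<in> L" "L = generate G {y}"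
    using subgroup_of_cyclic[OF _ assms(1)] assms(3) x(2) by metis
  then show False using cyclic_iff_group_rank[OF assms(1)] assms(4) by (auto simp: not_less[symmetric])
qed

text \<open>Bounds on the ranks suffice; that the denominator is positive is inherited from the intersection.\<close>

lemma sigma_ratio_lower_bound:
  fixes h k m :: nat
  assumes HK: "H \<in> \<F>" "K \<in> \<F>" "subgroup H G" "subgroup K G"
    and h: "group_rank (G\<lparr>carrier := H\<rparr>) \<le> enat h"
    and k: "group_rank (G\<lparr>carrier := K\<rparr>) \<le> enat k"
    and m: "enat (m + 1) \<le> group_rank (G\<lparr>carrier := H \<inter> K\<rparr>)" "m \<ge> 1"
  shows "ereal (real m / (real (h - 1) * real (k - 1))) \<le> sigma_ratio G \<F>"
proof -
  have L: "subgroup (H \<inter> K) G" using HK subgroups_Inter_pair by blast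
  have "(2::enat) \<le> enat (m + 1)" using m(2) by (simp add: numeral_eq_enat)
  then have L2: "2 \<le> group_rank (G\<lparr>carrier := H \<inter> K\<rparr>)" using m(1) by (rule order_trans)
  obtain a where a: "group_rank (G\<lparr>carrier := H\<rparr>) = enat a" "a \<le> h"
    using h by (cases "group_rank (G\<lparr>carrier := H\<rparr>)") auto
  obtain b where b: "group_rank (G\<lparr>carrier := K\<rparr>) = enat b" "b \<le> k"
    using k by (cases "group_rank (G\<lparr>carrier := K\<rparr>)") auto
  have "a \<ge> 2" "b \<ge> 2"
    using group_rank_ge_2_mono[OF L HK(3) _ L2] group_rank_ge_2_mono[OF L HK(4) _ L2] a b
    by (auto simp: numeral_eq_enat)
  have ra: "reduced_rank (G\<lparr>carrier := H\<rparr>) = enat (a - 1)"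
    and rb: "reduced_rank (G\<lparr>carrier := K\<rparr>) = enat (b - 1)"
    using a b by (auto simp: reduced_rank_def one_enat_def)
  have "enat m = enat (m + 1) - 1" by (simp add: one_enat_def)
  also have "\<dots> \<le> reduced_rank (G\<lparr>carrier := H \<inter> K\<rparr>)"
    unfolding reduced_rank_def using m(1)
    by (cases "group_rank (G\<lparr>carrier := H \<inter> K\<rparr>)") (auto simp: one_enat_def)
  finally have rm: "ereal (real m) \<le> ereal_of_enat (reduced_rank (G\<lparr>carrier := H \<inter> K\<rparr>))"
    by (metis ereal_of_enat_le_iff ereal_of_enat_simps(1))
  have "real m / (real (h - 1) * real (k - 1)) \<le> real m / (real (a - 1) * real (b - 1))"
    using \<open>a \<ge> 2\<close> \<open>b \<ge> 2\<close> a(2) b(2) by (intro divide_left_mono mult_mono mult_pos_pos) auto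
  then have "ereal (real m / (real (h - 1) * real (k - 1))) \<le> ereal (real m) / ereal (real (a - 1) * real (b - 1))"
    using \<open>a \<ge> 2\<close> \<open>b \<ge> 2\<close> by simp
  also have "\<dots> \<le> ereal_of_enat (reduced_rank (G\<lparr>carrier := H \<inter> K\<rparr>)) /
      ereal_of_enat (reduced_rank (G\<lparr>carrier := H\<rparr>) * reduced_rank (G\<lparr>carrier := K\<rparr>))"
  proof -
    have "ereal_of_enat (enat (a - 1) * enat (b - 1)) = ereal (real (a - 1) * real (b - 1))" by simp
    moreover have "0 < ereal (real (a - 1) * real (b - 1))" using \<open>a \<ge> 2\<close> \<open>b \<ge> 2\<close> by simp
    ultimately show ?thesis unfolding ra rb using ereal_divide_right_mono[OF rm] by metis
  qed
  also have "\<dots> \<le> sigma_ratio G \<F>"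
    unfolding sigma_ratio_def
  proof (intro Sup_upper CollectI exI conjI)
    show "reduced_rank (G\<lparr>carrier := H\<rparr>) * reduced_rank (G\<lparr>carrier := K\<rparr>) \<noteq> 0"
      using \<open>a \<ge> 2\<close> \<open>b \<ge> 2\<close> by (simp add: ra rb zero_enat_def)
  qed (use HK in auto)
  finally show ?thesis .
qed

end

section \<open>A lower bound for the ratio\<close>

context free_product_of_groups
begin

text \<open>The form in which the family of subgroups in the theorem enters the constructions. As \<open>conj_letter\<close>
  refers to all factors, the free factor included, the condition on \<open>H\<close> is stronger than the one that
  defines the family; the subgroups that are constructed satisfy it.\<close>

definition factor_free_closed :: "('i \<times> 'a) list set set set \<Rightarrow> bool" where
  "factor_free_closed \<F> \<longleftrightarrow>
     (\<forall>H. fin_gen_subgroup H \<P> \<longrightarrow> (\<forall>g\<in>H. conj_letter g \<longrightarrow> g = \<one>\<^bsub>\<P>\<^esub>) \<longrightarrow> H \<in> \<F>)"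

text \<open>The \<open>i\<close>-th stem, read from the right, runs \<open>i\<close> times through the letters \<open>z\<close> and \<open>c\<close> and then leaves this
  line by \<open>y\<close> instead of \<open>z\<close>. So the stems branch off at different places, and none continues another.\<close>

lemma stem_exists:
  assumes \<kappa>: "\<kappa> \<in> I" "c \<in> carrier (\<G> \<kappa>)" "c \<noteq> \<one>\<^bsub>\<G> \<kappa>\<^esub>"
    and y: "reduced [y]" "fst y \<noteq> \<kappa>" and z: "reduced [z]" "fst z \<noteq> \<kappa>" and yz: "y \<noteq> z"
  obtains stem :: "nat \<Rightarrow> ('i \<times> 'a) list" where
    "\<And>i p. reduced [p] \<Longrightarrow> fst p \<noteq> \<kappa> \<Longrightarrow> reduced (p # stem i)"
    "\<And>i j. suffix (stem i) (stem j) \<Longrightarrow> i = j"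
proof -
  define W where "W i = concat (replicate i [(\<kappa>, c), z])" for i :: nat
  have Wadd: "W (i + j) = W i @ W j" for i j by (simp add: W_def replicate_add)
  define stem where "stem i = [(\<kappa>, c), y] @ W i" for i
  have W: "reduced (W i) \<and> (W i \<noteq> [] \<longrightarrow> fst (hd (W i)) = \<kappa>)" for i
    unfolding W_def
  proof (induction i)
    case (Suc i)
    then show ?case using \<kappa> z by (cases z) (auto simp: reduced_Cons hd_append)
  qed simp
  have stem: "reduced (stem i)" "fst (hd (stem i)) = \<kappa>" for i
    using W[of i] \<kappa> y by (cases y; auto simp: stem_def reduced_Cons)+
  show ?thesis
  proof (rule that[of stem])
    show "reduced (p # stem i)" if "reduced [p]" "fst p \<noteq> \<kappa>" for p i
      using that stem[of i] by (cases p) (auto simp: reduced_Cons)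
    fix i j assume suf: "suffix (stem i) (stem j)"
    have len: "length (stem n) = 2 + n * 2" for n
      by (simp add: stem_def W_def length_concat sum_list_replicate)
    show "i = j"
    proof (rule ccontr)
      assume "i \<noteq> j"
      then obtain d where d: "j = d + (1 + i)"
        using suffix_length_le[OF suf] len[of i] len[of j] less_imp_Suc_add[of i j] by auto
      have "stem j = (([(\<kappa>, c), y] @ W d) @ [(\<kappa>, c), z]) @ W i"
        using Wadd[of d "1 + i"] Wadd[of 1 i] d by (simp add: stem_def W_def)
      moreover obtain u where "stem j = (u @ [(\<kappa>, c), y]) @ W i"
        using suf by (auto simp: suffix_def stem_def)
      \<comment> \<open>Compare the letters in the place where the shorter stem branches off.\<close>
      ultimately have "([(\<kappa>, c), y] @ W d) @ [(\<kappa>, c), z] = u @ [(\<kappa>, c), y]"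
        by (simp only: append_same_eq)
      then show False using yz by simp
    qed
  qed
qed

end

context conjugate_family
begin

definition letter_pair :: "'l \<Rightarrow> ('l \<times> 'a) \<Rightarrow> ('l \<times> 'a) \<Rightarrow> bool" where
  "letter_pair \<kappa> y z \<longleftrightarrow> sub.reduced [y] \<and> fst y \<noteq> \<kappa> \<and> sub.reduced [z] \<and> fst z \<noteq> \<kappa> \<and> y \<noteq> z"

text \<open>The kernel of \<open>\<phi>\<close> plays the role of \<open>H\<close>, and a group of glued loops that of \<open>K\<close>. The loops at the
  ends of the stems take the values \<open>y\<^sup>-\<^sup>1 c z\<close> under \<open>\<phi>\<close>, up to conjugation by the stem. If these values
  contain a conjugation invariant generating set \<open>E\<close> of \<open>Q\<close>, then suitable loops hit every element of \<open>E\<close>.\<close>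

theorem sigma_ratio_bound:
  fixes \<phi> :: "('l \<times> 'a) list set \<Rightarrow> 'q" and h :: nat
  assumes \<kappa>: "\<kappa> \<in> \<Lambda>"
    and Q: "group Q" "finite (carrier Q)" and \<phi>: "\<phi> \<in> hom sub.\<P> Q"
    and \<phi>_inj: "\<And>l x. l \<in> \<Lambda> \<Longrightarrow> x \<in> A l \<Longrightarrow> \<phi> (sub.letter l x) = \<one>\<^bsub>Q\<^esub> \<Longrightarrow> x = \<one>\<^bsub>\<G> (idx l)\<^esub>"
    and E: "generate Q E = carrier Q" "E \<noteq> {}"
      "\<And>e g. e \<in> E \<Longrightarrow> g \<in> carrier Q \<Longrightarrow> g \<otimes>\<^bsub>Q\<^esub> e \<otimes>\<^bsub>Q\<^esub> inv\<^bsub>Q\<^esub> g \<in> E"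
      "\<And>e. e \<in> E \<Longrightarrow> \<exists>y z c. letter_pair \<kappa> y z \<and> c \<in> A \<kappa> \<and> c \<noteq> \<one>\<^bsub>\<G> (idx \<kappa>)\<^esub> \<and>
         e = inv\<^bsub>Q\<^esub> \<phi> (sub.cl [y]) \<otimes>\<^bsub>Q\<^esub> \<phi> (sub.letter \<kappa> c) \<otimes>\<^bsub>Q\<^esub> \<phi> (sub.cl [z])"
    and S: "finite S" "generate sub.\<P> S = kernel sub.\<P> Q \<phi>" "card S \<le> h"
    and closed: "factor_free_closed \<F>"
  shows "ereal (real (card (carrier Q)) / real (h - 1)) \<le> sigma_ratio \<P> \<F>"
proof -
  have \<F>: "H \<in> \<F>"
    if "fin_gen_subgroup H \<P>" "\<And>g. g \<in> H \<Longrightarrow> conj_letter g \<Longrightarrow> g = \<one>\<^bsub>\<P>\<^esub>" for H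
    using closed that unfolding factor_free_closed_def by blast
  interpret Q: group Q by fact
  interpret \<phi>: group_hom sub.\<P> Q \<phi> by unfold_locales fact
  have EQ: "e \<in> carrier Q" if "e \<in> E" for e
    using E(1) generate.incl[OF that, of Q] by simp
  then have "finite E" using Q(2) by (meson finite_subset subsetI)
  then obtain es where es: "set es = E" using finite_list by blast
  \<comment> \<open>Listing \<open>E\<close> twice ensures that there are at least two loops.\<close>
  define fs where "fs = es @ es"
  define r where "r = length fs"
  have "es \<noteq> []" using es E(2) by auto
  then have r: "r \<ge> 2" by (cases es) (auto simp: r_def fs_def)
  have fs: "set fs = E" using es by (simp add: fs_def)
  obtain e0 where "e0 \<in> E" using E(2) by blast
  then obtain y z c0 where yz: "letter_pair \<kappa> y z" and c0: "c0 \<in> A \<kappa>" "c0 \<noteq> \<one>\<^bsub>\<G> (idx \<kappa>)\<^esub>"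
    using E(4) by metis
  obtain stem :: "nat \<Rightarrow> ('l \<times> 'a) list" where
    st: "\<And>i p. sub.reduced [p] \<Longrightarrow> fst p \<noteq> \<kappa> \<Longrightarrow> sub.reduced (p # stem i)"
    "\<And>i j. suffix (stem i) (stem j) \<Longrightarrow> i = j"
    using sub.stem_exists[of \<kappa> c0 y z] \<kappa> c0 yz unfolding letter_pair_def by auto
  have stc: "stem i \<in> sub.words" for i
    using st(1)[of y i] yz by (cases y) (auto simp: letter_pair_def sub.reduced_Cons)
  define U where "U i = \<phi> (sub.cl (stem i))" for i
  have U: "U i \<in> carrier Q" for i using stc by (simp add: U_def)
  \<comment> \<open>The value at the end of the \<open>i\<close>-th stem is conjugated in advance, so that the stem cancels out.\<close>
  have "\<exists>y z c. letter_pair \<kappa> y z \<and> c \<in> A \<kappa> \<and> c \<noteq> \<one>\<^bsub>\<G> (idx \<kappa>)\<^esub> \<and>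
         U i \<otimes>\<^bsub>Q\<^esub> fs ! i \<otimes>\<^bsub>Q\<^esub> inv\<^bsub>Q\<^esub> U i =
         inv\<^bsub>Q\<^esub> \<phi> (sub.cl [y]) \<otimes>\<^bsub>Q\<^esub> \<phi> (sub.letter \<kappa> c) \<otimes>\<^bsub>Q\<^esub> \<phi> (sub.cl [z])" if "i < r" for i
    using E(3)[OF _ U] E(4) fs that nth_mem[of i fs] by (simp add: r_def)
  then obtain a a' c where ac: "\<And>i. i < r \<Longrightarrow> letter_pair \<kappa> (a i) (a' i)"
      "\<And>i. i < r \<Longrightarrow> c i \<in> A \<kappa> \<and> c i \<noteq> \<one>\<^bsub>\<G> (idx \<kappa>)\<^esub>"
    and eq: "\<And>i. i < r \<Longrightarrow> U i \<otimes>\<^bsub>Q\<^esub> fs ! i \<otimes>\<^bsub>Q\<^esub> inv\<^bsub>Q\<^esub> U i =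
         inv\<^bsub>Q\<^esub> \<phi> (sub.cl [a i]) \<otimes>\<^bsub>Q\<^esub> \<phi> (sub.letter \<kappa> (c i)) \<otimes>\<^bsub>Q\<^esub> \<phi> (sub.cl [a' i])"
    by metis
  interpret gl: glued_loops \<Lambda> fam \<kappa> r a a' c stem
    by unfold_locales (use \<kappa> ac st in \<open>auto simp: letter_pair_def\<close>)
  have \<phi>loop: "\<phi> (gl.loop i) = fs ! i" if i: "i < r" for i
  proof -
    have w: "[a i] \<in> sub.words" "[a' i] \<in> sub.words"
      using ac(1)[OF i] by (auto simp: letter_pair_def)
    have cc: "sub.cl [a i] \<in> carrier sub.\<P>" "sub.cl [a' i] \<in> carrier sub.\<P>"
      "sub.letter \<kappa> (c i) \<in> carrier sub.\<P>" "sub.cl (stem i) \<in> carrier sub.\<P>"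
      using w stc \<kappa> ac(2)[OF i] by auto
    have \<alpha>: "sub.cl (gl.\<alpha> i) = sub.cl [a i] \<otimes>\<^bsub>sub.\<P>\<^esub> sub.cl (stem i)"
      using sub.cl_append[OF w(1) stc] by (simp add: gl.\<alpha>_def)
    have \<beta>: "sub.cl (gl.\<beta> i) = sub.letter \<kappa> (c i) \<otimes>\<^bsub>sub.\<P>\<^esub> (sub.cl [a' i] \<otimes>\<^bsub>sub.\<P>\<^esub> sub.cl (stem i))"
      using sub.cl_append[OF w(2) stc] sub.cl_append[of "[(\<kappa>, c i)]" "a' i # stem i"] w stc \<kappa> ac(2)[OF i]
      by (cases "a' i") (simp add: gl.\<beta>_def)
    have fi: "fs ! i \<in> carrier Q" using EQ fs nth_mem[of i fs] i by (auto simp: r_def)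
    have "\<phi> (gl.loop i) = inv\<^bsub>Q\<^esub> U i \<otimes>\<^bsub>Q\<^esub> (inv\<^bsub>Q\<^esub> \<phi> (sub.cl [a i]) \<otimes>\<^bsub>Q\<^esub> \<phi> (sub.letter \<kappa> (c i)) \<otimes>\<^bsub>Q\<^esub> \<phi> (sub.cl [a' i])) \<otimes>\<^bsub>Q\<^esub> U i"
      unfolding gl.loop_def \<alpha> \<beta> U_def using cc by (simp add: Q.inv_mult_group Q.m_assoc)
    also have "\<dots> = fs ! i"
      unfolding eq[OF i, symmetric] using U[of i] fi by (simp add: Q.m_assoc)
    finally show ?thesis .
  qed
  let ?K = "gl.loop_group"
  let ?H = "kernel sub.\<P> Q \<phi>"
  let ?L = "?K \<inter> ?H"
  have loops: "gl.loop ` {..<r} \<subseteq> carrier sub.\<P>" using gl.loop_closed by auto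
  have "\<phi> ` gl.loop ` {..<r} = E"
    using \<phi>loop fs by (auto simp: r_def set_conv_nth image_iff)
  then have onto: "\<phi> ` ?K = carrier Q"
    using \<phi>.generate_img[OF loops] E(1) by (simp add: gl.loop_group_def)
  have sH: "subgroup ?H sub.\<P>" by (rule \<phi>.subgroup_kernel)
  have sK: "subgroup ?K sub.\<P>" by (rule gl.loop_group_subgroup)
  have sL: "subgroup ?L sub.\<P>" using sub.P.subgroups_Inter_pair sH sK by blast
  have cH: "?H \<subseteq> carrier sub.\<P>" "?K \<subseteq> carrier sub.\<P>" using subgroup.subset sH sK by blast+
  have SH: "S \<subseteq> carrier sub.\<P>" using S(2) cH(1) by (auto intro: generate.incl)
  have genH: "generate \<P> (emb ` S) = emb ` ?H" using emb.generate_img[OF SH] S(2) by simp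
  have genK: "generate \<P> (emb ` gl.loop ` {..<r}) = emb ` ?K"
    using emb.generate_img[OF loops] by (simp add: gl.loop_group_def)
  have eH: "subgroup (emb ` ?H) \<P>" and eK: "subgroup (emb ` ?K) \<P>"
    using emb.subgroup_img_is_subgroup sH sK by blast+
  have HF: "emb ` ?H \<in> \<F>"
  proof (rule \<F>)
    show "fin_gen_subgroup (emb ` ?H) \<P>"
      unfolding fin_gen_subgroup_def using eH genH S(1) SH
      by (intro conjI exI[of _ "emb ` S"]) auto
    fix g assume "g \<in> emb ` ?H" "conj_letter g"
    then obtain g0 where g0: "g0 \<in> ?H" "g = emb g0" "conj_letter (emb g0)" by auto
    have "g0 = \<one>\<^bsub>sub.\<P>\<^esub>"
    proof (rule ccontr)
      assume n: "g0 \<noteq> \<one>\<^bsub>sub.\<P>\<^esub>"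
      then have "sub.conj_letter g0" using emb_conj_letter g0 cH by blast
      then obtain p l x where p: "p \<in> carrier sub.\<P>" "l \<in> \<Lambda>" "x \<in> A l"
        "g0 = p \<otimes>\<^bsub>sub.\<P>\<^esub> sub.letter l x \<otimes>\<^bsub>sub.\<P>\<^esub> inv\<^bsub>sub.\<P>\<^esub> p"
        unfolding sub.conj_letter_def by auto
      then have "\<phi> p \<otimes>\<^bsub>Q\<^esub> \<phi> (sub.letter l x) \<otimes>\<^bsub>Q\<^esub> inv\<^bsub>Q\<^esub> \<phi> p = \<one>\<^bsub>Q\<^esub>"
        using g0(1) by (simp add: kernel_def)
      then have "\<phi> (sub.letter l x) = \<one>\<^bsub>Q\<^esub>" using Q.conj_eq_one_iff p by simp
      then have "x = \<one>\<^bsub>\<G> (idx l)\<^esub>" using \<phi>_inj p by blast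
      then show False using n p sub.letter_one[of l] by simp
    qed
    then show "g = \<one>\<^bsub>\<P>\<^esub>" using g0 by simp
  qed
  have KF: "emb ` ?K \<in> \<F>"
  proof (rule \<F>)
    show "fin_gen_subgroup (emb ` ?K) \<P>"
      unfolding fin_gen_subgroup_def using eK genK loops
      by (intro conjI exI[of _ "emb ` gl.loop ` {..<r}"]) auto
    fix g assume "g \<in> emb ` ?K" "conj_letter g"
    then obtain g0 where g0: "g0 \<in> ?K" "g = emb g0" "conj_letter (emb g0)" by auto
    then have "g0 = \<one>\<^bsub>sub.\<P>\<^esub>"
      using emb_conj_letter gl.loop_group_factor_free cH by blast
    then show "g = \<one>\<^bsub>\<P>\<^esub>" using g0 by simp
  qed
  let ?q = "card (carrier Q)"
  have q: "?q \<ge> 1" using Q(2) Q.one_closed by (metis One_nat_def Suc_leI card_gt_0_iff empty_iff)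
  have inter: "emb ` ?H \<inter> emb ` ?K = emb ` ?L"
    using inj_on_image_Int[OF emb_inj cH] by (simp add: Int_commute)
  have "enat ((r - 1) * ?q + 1) \<le> group_rank (\<P>\<lparr>carrier := emb ` ?H \<inter> emb ` ?K\<rparr>)"
    unfolding inter
  proof (rule P.group_rank_ge)
    show "subgroup (emb ` ?L) \<P>" using emb.subgroup_img_is_subgroup sL by blast
    fix T assume T: "finite T" "generate \<P> T = emb ` ?L"
    then have TL: "T \<subseteq> emb ` ?L" by (auto intro: generate.incl)
    then obtain T' where T': "T' \<subseteq> ?L" "T = emb ` T'" by (meson subset_imageE)
    have T'c: "T' \<subseteq> carrier sub.\<P>" using T'(1) cH by blast
    then have injT: "inj_on emb T'" using emb_inj inj_on_subset by blast
    have "emb ` generate sub.\<P> T' = emb ` ?L" using emb.generate_img[OF T'c] T T'(2) by simp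
    moreover have "generate sub.\<P> T' \<subseteq> carrier sub.\<P>"
      by (rule sub.P.generate_incl[OF T'c])
    moreover have "?L \<subseteq> carrier sub.\<P>" using cH by blast
    ultimately have "generate sub.\<P> T' = ?L"
      by (simp only: inj_on_image_eq_iff[OF emb_inj])
    moreover have "finite T'" using T(1) T'(2) injT finite_image_iff by blast
    ultimately have "r * ?q \<le> card T' + (?q - 1)"
      using gl.loop_group_kernel_rank[OF Q \<phi> onto] by blast
    moreover have "card T = card T'" using T'(2) injT card_image by blast
    moreover have "r * ?q = (r - 1) * ?q + ?q" using r by (cases r) auto
    ultimately show "(r - 1) * ?q + 1 \<le> card T" using q by linarith
  qed
  moreover have "group_rank (\<P>\<lparr>carrier := emb ` ?H\<rparr>) \<le> enat h"
    using P.group_rank_le[OF eH _ genH] S card_image_le[OF S(1), of emb]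
    by (meson enat_ord_simps(1) finite_imageI order_trans)
  moreover have "group_rank (\<P>\<lparr>carrier := emb ` ?K\<rparr>) \<le> enat r"
  proof -
    have "card (emb ` gl.loop ` {..<r}) \<le> r"
      by (metis card_image_le card_lessThan finite_imageI finite_lessThan le_trans)
    then show ?thesis
      using P.group_rank_le[OF eK _ genK] by (meson enat_ord_simps(1) finite_imageI finite_lessThan order_trans)
  qed
  ultimately have "ereal (real ((r - 1) * ?q) / (real (h - 1) * real (r - 1))) \<le> sigma_ratio \<P> \<F>"
    using r q by (intro P.sigma_ratio_lower_bound[OF HF KF eH eK]) auto
  moreover have "real ((r - 1) * ?q) / (real (h - 1) * real (r - 1)) = real ?q / real (h - 1)"
    using r by simp
  ultimately show ?thesis by simp
qed

end

section \<open>Two finite groups\<close>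

context group
begin

text \<open>The commutators of \<open>A\<close> and \<open>C\<close> generate a subgroup \<open>N\<close> with \<open>A C N\<close> closed under left multiplication by
  \<open>A\<close> and \<open>C\<close>. The point is that \<open>N\<close> is normalized by \<open>C\<close>, because of the identity
  \<open>c\<^sup>-\<^sup>1 [a, d] c = [a, c\<^sup>-\<^sup>1]\<^sup>-\<^sup>1 [a, c\<^sup>-\<^sup>1 d]\<close>.\<close>

lemma commutator_decomposition_left:
  assumes A: "subgroup A G" and C: "subgroup C G" and S: "S \<subseteq> carrier G"
    and comm: "\<forall>a\<in>A. \<forall>c\<in>C. a \<otimes> c \<otimes> inv a \<otimes> inv c \<in> generate G S"
    and S_comm: "\<forall>g\<in>S. \<exists>a\<in>A. \<exists>c\<in>C. g = a \<otimes> c \<otimes> inv a \<otimes> inv c"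
    and ac: "a \<in> A" "c \<in> C" "h \<in> generate G S"
  shows "b \<in> A \<Longrightarrow> \<exists>a'\<in>A. \<exists>c'\<in>C. \<exists>h'\<in>generate G S. b \<otimes> (a \<otimes> c \<otimes> h) = a' \<otimes> c' \<otimes> h'"
    and "d \<in> C \<Longrightarrow> \<exists>a'\<in>A. \<exists>c'\<in>C. \<exists>h'\<in>generate G S. d \<otimes> (a \<otimes> c \<otimes> h) = a' \<otimes> c' \<otimes> h'"
proof -
  interpret A: subgroup A G by fact
  interpret C: subgroup C G by fact
  interpret N: subgroup "generate G S" G by (rule generate_is_subgroup[OF S])
  note mem [simp] = A.mem_carrier C.mem_carrier N.mem_carrier
  have conj: "inv c \<otimes> g \<otimes> c \<in> generate G S" if c: "c \<in> C" and g: "g \<in> generate G S" for c g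
    using g
  proof (induction rule: generate.induct)
    case one
    then show ?case using c by simp
  next
    case (incl g)
    then obtain a d where ad: "a \<in> A" "d \<in> C" "g = a \<otimes> d \<otimes> inv a \<otimes> inv d"
      using S_comm by blast
    let ?c = "inv c"
    let ?w = "inv (a \<otimes> ?c \<otimes> inv a \<otimes> inv ?c) \<otimes> (a \<otimes> (?c \<otimes> d) \<otimes> inv a \<otimes> inv (?c \<otimes> d))"
    have "?w \<in> generate G S"
      using bspec[OF bspec[OF comm], of a ?c] bspec[OF bspec[OF comm], of a "?c \<otimes> d"] ad c by simp
    also have "?w =
        inv c \<otimes> g \<otimes> c"
      using ad c by (simp add: inv_mult_group m_assoc)
    finally show ?case .
  next
    case (inv g)
    then obtain a d where ad: "a \<in> A" "d \<in> C" "g = a \<otimes> d \<otimes> inv a \<otimes> inv d"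
      using S_comm by blast
    let ?c = "inv c"
    let ?w = "inv (a \<otimes> ?c \<otimes> inv a \<otimes> inv ?c) \<otimes> (a \<otimes> (?c \<otimes> d) \<otimes> inv a \<otimes> inv (?c \<otimes> d))"
    have "inv ?w \<in> generate G S"
      using bspec[OF bspec[OF comm], of a ?c] bspec[OF bspec[OF comm], of a "?c \<otimes> d"] ad c by simp
    also have "inv ?w =
        inv c \<otimes> inv g \<otimes> c"
      using ad c by (simp add: inv_mult_group m_assoc)
    finally show ?case .
  next
    case (eng g h)
    have "(inv c \<otimes> g \<otimes> c) \<otimes> (inv c \<otimes> h \<otimes> c) = inv c \<otimes> (g \<otimes> h) \<otimes> c"
      using eng c by (simp add: m_assoc)
    then show ?case using eng.IH N.m_closed by metis
  qed
  show "\<exists>a'\<in>A. \<exists>c'\<in>C. \<exists>h'\<in>generate G S. b \<otimes> (a \<otimes> c \<otimes> h) = a' \<otimes> c' \<otimes> h'" if "b \<in> A"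
    using that ac by (intro bexI[of _ "b \<otimes> a"] bexI[of _ c] bexI[of _ h]) (auto simp: m_assoc)
  assume d: "d \<in> C"
  let ?g = "inv a \<otimes> d \<otimes> inv (inv a) \<otimes> inv d"
  have "inv (d \<otimes> c) \<otimes> ?g \<otimes> (d \<otimes> c) \<otimes> h \<in> generate G S"
    using conj[of "d \<otimes> c" ?g] bspec[OF bspec[OF comm], of "inv a" d] d ac by simp
  moreover have "d \<otimes> (a \<otimes> c \<otimes> h) = a \<otimes> (d \<otimes> c) \<otimes> (inv (d \<otimes> c) \<otimes> ?g \<otimes> (d \<otimes> c) \<otimes> h)"
    using d ac by (simp add: inv_mult_group m_assoc)
  ultimately show "\<exists>a'\<in>A. \<exists>c'\<in>C. \<exists>h'\<in>generate G S. d \<otimes> (a \<otimes> c \<otimes> h) = a' \<otimes> c' \<otimes> h'"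
    using d ac by blast
qed

end

lemma ex_outside:
  assumes "finite B" "card B < card X"
  shows "\<exists>x\<in>X. x \<notin> B"
  using card_mono[of B X] assms by (auto simp: subset_iff)

text \<open>As \<open>X\<close> has at least three elements, each of its elements is a product of two nontrivial ones; so
  \<open>(x, 1)\<close> is a product \<open>(u, y) (u\<^sup>-\<^sup>1 x, y\<^sup>-\<^sup>1)\<close> of pairs of nontrivial elements.\<close>

lemma DirProd_generated_by_nontrivial_pairs:
  assumes X: "group X" "3 \<le> card (carrier X)" and Y: "group Y" "2 \<le> card (carrier Y)"
  shows "generate (X \<times>\<times> Y) ((carrier X - {\<one>\<^bsub>X\<^esub>}) \<times> (carrier Y - {\<one>\<^bsub>Y\<^esub>})) = carrier (X \<times>\<times> Y)"
    (is "generate ?Q ?E = _")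
proof -
  interpret X: group X by fact
  interpret Y: group Y by fact
  interpret Q: group ?Q using X(1) Y(1) by (rule DirProd_group)
  interpret N: subgroup "generate ?Q ?E" ?Q by (rule Q.generate_is_subgroup) (auto simp: DirProd_def)
  have "\<exists>y\<in>carrier Y. y \<notin> {\<one>\<^bsub>Y\<^esub>}"
    by (rule ex_outside) (use Y(2) in auto)
  then obtain y where y: "y \<in> carrier Y" "y \<noteq> \<one>\<^bsub>Y\<^esub>" by blast
  have E: "(x, z) \<in> generate ?Q ?E" if "x \<in> carrier X" "x \<noteq> \<one>\<^bsub>X\<^esub>" "z \<in> carrier Y" "z \<noteq> \<one>\<^bsub>Y\<^esub>" for x z
    using that by (intro generate.incl) auto
  have iy: "inv\<^bsub>Y\<^esub> y \<noteq> \<one>\<^bsub>Y\<^esub>" using y by simp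
  have third: "\<exists>u\<in>carrier X. u \<noteq> \<one>\<^bsub>X\<^esub> \<and> u \<noteq> v" for v
    using ex_outside[of "{\<one>\<^bsub>X\<^esub>, v}" "carrier X"] X(2) by (auto simp: card_insert_if)
  have X1: "(x, \<one>\<^bsub>Y\<^esub>) \<in> generate ?Q ?E" if x: "x \<in> carrier X" for x
  proof -
    obtain u where u: "u \<in> carrier X" "u \<noteq> \<one>\<^bsub>X\<^esub>" "u \<noteq> x" using third by blast
    have "inv\<^bsub>X\<^esub> u \<otimes>\<^bsub>X\<^esub> x \<noteq> \<one>\<^bsub>X\<^esub>"
      using u x X.inv_solve_left[of "\<one>\<^bsub>X\<^esub>" u x] by auto
    then have "(u, y) \<otimes>\<^bsub>?Q\<^esub> (inv\<^bsub>X\<^esub> u \<otimes>\<^bsub>X\<^esub> x, inv\<^bsub>Y\<^esub> y) \<in> generate ?Q ?E"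
      using u x y iy by (intro N.m_closed E) auto
    then show ?thesis using u x y by simp
  qed
  have "(x, z) \<in> generate ?Q ?E" if x: "x \<in> carrier X" and z: "z \<in> carrier Y" for x z
  proof (cases "z = \<one>\<^bsub>Y\<^esub>")
    case True
    then show ?thesis using X1 x by simp
  next
    case False
    obtain u where u: "u \<in> carrier X" "u \<noteq> \<one>\<^bsub>X\<^esub>" using third by blast
    have "(u, z) \<otimes>\<^bsub>?Q\<^esub> (inv\<^bsub>X\<^esub> u \<otimes>\<^bsub>X\<^esub> x, \<one>\<^bsub>Y\<^esub>) \<in> generate ?Q ?E"
      using u x z False by (intro N.m_closed E X1) auto
    then show ?thesis using u x z by simp
  qed
  then show ?thesis using N.subset by (auto simp: DirProd_def)
qed

context free_product_of_groups
begin

text \<open>The map from \<open>A * C\<close> to \<open>A \<times> C\<close> has as its kernel the group generated by the \<open>(|A| - 1) (|C| - 1)\<close>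
  commutators of nontrivial elements. The words \<open>u\<close> and \<open>u'\<close> are inverse to each other; conjugation
  by \<open>u\<close> moves \<open>C\<close> into free position to \<open>A\<close>. Both may be empty if the factors are different.\<close>

theorem sigma_ratio_two_subgroups:
  assumes i: "i \<in> I" "subgroup A (\<G> i)" "finite A" "3 \<le> card A"
    and j: "j \<in> I" "subgroup C (\<G> j)" "finite C" "2 \<le> card C"
    and u: "reduced u" "distinct_adj (i # map fst u @ [j])"
    and u': "reduced u'" "distinct_adj (j # map fst u' @ [i])"
    and uu': "cl (u @ u') = \<one>\<^bsub>\<P>\<^esub>"
    and \<F>: "factor_free_closed \<F>"
  shows "ereal (real (card A * card C) / real ((card A - 1) * (card C - 1) - 1)) \<le> sigma_ratio \<P> \<F>"
proof -
  define idx where "idx b = (if b then j else i)" for b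
  define B where "B b = (if b then C else A)" for b
  define s where "s b = (if b then u else [])" for b
  define link :: "bool \<Rightarrow> bool \<Rightarrow> ('i \<times> 'a) list" where "link b b' = (if b then u' else u)" for b b'
  interpret cf: conjugate_family I \<G> "UNIV :: bool set" idx B s link
    by (intro conjugate_family.intro[OF free_product_of_groups_axioms] conjugate_family_axioms.intro)
      (use i j u u' uu' in \<open>auto simp: idx_def B_def s_def link_def one_P split: if_splits\<close>)
  let ?P = cf.sub.\<P>
  let ?l = cf.sub.letter
  let ?X = "cf.fam False" and ?Y = "cf.fam True"
  let ?Q = "?X \<times>\<times> ?Y"
  interpret X: group ?X by (rule cf.sub.factor_group) simp
  interpret Y: group ?Y by (rule cf.sub.factor_group) simp
  interpret Q: group ?Q by (rule DirProd_group) unfold_locales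
  have cX: "carrier ?X = A" and cY: "carrier ?Y = C" by (simp_all add: B_def)
  define f where "f b x = (if b then (\<one>\<^bsub>?X\<^esub>, x) else (x, \<one>\<^bsub>?Y\<^esub>))" for b x
  have "f b \<in> hom (cf.fam b) ?Q" for b
    by (cases b; rule homI)
      (simp_all add: f_def del: cf.fam_simps)
  then obtain \<phi> where \<phi>: "\<phi> \<in> hom ?P ?Q"
    and \<phi>l0: "\<And>b x. b \<in> UNIV \<Longrightarrow> x \<in> carrier (cf.fam b) \<Longrightarrow> \<phi> (?l b x) = f b x"
    by (rule cf.sub.hom_extends[OF Q.is_group]) auto
  have \<phi>F: "\<phi> (?l False a) = (a, \<one>\<^bsub>?Y\<^esub>)" if "a \<in> A" for a
    using \<phi>l0[of False a] that by (simp add: f_def B_def)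
  have \<phi>T: "\<phi> (?l True c) = (\<one>\<^bsub>?X\<^esub>, c)" if "c \<in> C" for c
    using \<phi>l0[of True c] that by (simp add: f_def B_def)
  interpret \<phi>: group_hom ?P ?Q \<phi> by unfold_locales fact
  have lc: "a \<in> A \<Longrightarrow> ?l False a \<in> carrier ?P" "c \<in> C \<Longrightarrow> ?l True c \<in> carrier ?P" for a c
    by (simp_all add: B_def)
  interpret lA: group_hom ?X ?P "?l False"
    by unfold_locales (rule cf.sub.letter_hom, simp)
  interpret lC: group_hom ?Y ?P "?l True"
    by unfold_locales (rule cf.sub.letter_hom, simp)
  have oX: "\<one>\<^bsub>?X\<^esub> \<in> A" and oY: "\<one>\<^bsub>?Y\<^esub> \<in> C" using X.one_closed Y.one_closed cX cY by auto
  define E where "E = (A - {\<one>\<^bsub>?X\<^esub>}) \<times> (C - {\<one>\<^bsub>?Y\<^esub>})"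
  define cm where "cm = (\<lambda>(a, c). ?l False a \<otimes>\<^bsub>?P\<^esub> ?l True c \<otimes>\<^bsub>?P\<^esub> inv\<^bsub>?P\<^esub> ?l False a \<otimes>\<^bsub>?P\<^esub> inv\<^bsub>?P\<^esub> ?l True c)"
  define S where "S = cm ` E"
  have Sc: "S \<subseteq> carrier ?P" using lc by (auto simp: S_def E_def cm_def)
  have cm_N: "cm (a, c) \<in> generate ?P S" if "a \<in> A" "c \<in> C" for a c
  proof (cases "a = \<one>\<^bsub>?X\<^esub> \<or> c = \<one>\<^bsub>?Y\<^esub>")
    case True
    then have "cm (a, c) = \<one>\<^bsub>?P\<^esub>"
      using lc that lA.hom_one lC.hom_one unfolding cm_def by auto
    then show ?thesis by (simp add: generate.one)
  next
    case False
    then show ?thesis using that by (intro generate.incl) (auto simp: S_def E_def)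
  qed
  have sA: "subgroup (?l False ` A) ?P" and sC: "subgroup (?l True ` C) ?P"
    using lA.subgroup_img_is_subgroup[OF X.subgroup_self] lC.subgroup_img_is_subgroup[OF Y.subgroup_self]
    by (simp_all add: B_def)
  have dec: "\<exists>a\<in>?l False ` A. \<exists>c\<in>?l True ` C. \<exists>h\<in>generate ?P S. g = a \<otimes>\<^bsub>?P\<^esub> c \<otimes>\<^bsub>?P\<^esub> h"
    if "g \<in> carrier ?P" for g
    using that
  proof (induction rule: cf.sub.carrier_induct)
    case one
    have "\<one>\<^bsub>?P\<^esub> = ?l False \<one>\<^bsub>?X\<^esub> \<otimes>\<^bsub>?P\<^esub> ?l True \<one>\<^bsub>?Y\<^esub> \<otimes>\<^bsub>?P\<^esub> \<one>\<^bsub>?P\<^esub>"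
      using lA.hom_one lC.hom_one by simp
    then show ?case using oX oY generate.one by blast
  next
    case (letter b x g)
    then obtain a c h where ach: "a \<in> ?l False ` A" "c \<in> ?l True ` C" "h \<in> generate ?P S"
      "g = a \<otimes>\<^bsub>?P\<^esub> c \<otimes>\<^bsub>?P\<^esub> h" by blast
    have comm: "\<forall>a\<in>?l False ` A. \<forall>c\<in>?l True ` C.
        a \<otimes>\<^bsub>?P\<^esub> c \<otimes>\<^bsub>?P\<^esub> inv\<^bsub>?P\<^esub> a \<otimes>\<^bsub>?P\<^esub> inv\<^bsub>?P\<^esub> c \<in> generate ?P S"
      using cm_N by (auto simp: cm_def)
    have S_comm: "\<forall>g\<in>S. \<exists>a\<in>?l False ` A. \<exists>c\<in>?l True ` C.
        g = a \<otimes>\<^bsub>?P\<^esub> c \<otimes>\<^bsub>?P\<^esub> inv\<^bsub>?P\<^esub> a \<otimes>\<^bsub>?P\<^esub> inv\<^bsub>?P\<^esub> c"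
      by (auto simp: S_def E_def cm_def)
    note left = cf.sub.P.commutator_decomposition_left[OF sA sC Sc comm S_comm ach(1-3)]
    show ?case
    proof (cases b)
      case True
      then have "?l b x \<in> ?l True ` C" using letter(2) by (simp add: B_def)
      from left(2)[OF this] show ?thesis unfolding ach(4) by simp
    next
      case False
      then have "?l b x \<in> ?l False ` A" using letter(2) by (simp add: B_def)
      from left(1)[OF this] show ?thesis unfolding ach(4) by simp
    qed
  qed
  have N_ker: "h \<in> kernel ?P ?Q \<phi>" if "h \<in> generate ?P S" for h
  proof -
    have "S \<subseteq> kernel ?P ?Q \<phi>"
    proof
      fix g assume g: "g \<in> S"
      then obtain a c where ac: "a \<in> A" "c \<in> C" "g = cm (a, c)" by (auto simp: S_def E_def)
      have "\<phi> g = f False a \<otimes>\<^bsub>?Q\<^esub> f True c \<otimes>\<^bsub>?Q\<^esub> inv\<^bsub>?Q\<^esub> f False a \<otimes>\<^bsub>?Q\<^esub> inv\<^bsub>?Q\<^esub> f True c"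
        using ac lc \<phi>F \<phi>T by (simp add: cm_def f_def)
      also have "\<dots> = \<one>\<^bsub>?Q\<^esub>"
        using ac(1,2)[folded cX cY] by (simp add: f_def inv_DirProd X.is_group Y.is_group del: cf.fam_simps)
      finally show "g \<in> kernel ?P ?Q \<phi>" using g Sc by (auto simp: kernel_def)
    qed
    then show ?thesis
      using cf.sub.P.generate_subgroup_incl[OF _ \<phi>.subgroup_kernel] that by blast
  qed
  have gen: "generate ?P S = kernel ?P ?Q \<phi>"
  proof
    show "generate ?P S \<subseteq> kernel ?P ?Q \<phi>" using N_ker by blast
    show "kernel ?P ?Q \<phi> \<subseteq> generate ?P S"
    proof
      fix g assume g: "g \<in> kernel ?P ?Q \<phi>"
      then have gc: "g \<in> carrier ?P" "\<phi> g = \<one>\<^bsub>?Q\<^esub>" by (auto simp: kernel_def)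
      obtain a c h where ach: "a \<in> A" "c \<in> C" "h \<in> generate ?P S"
        "g = ?l False a \<otimes>\<^bsub>?P\<^esub> ?l True c \<otimes>\<^bsub>?P\<^esub> h" using dec[OF gc(1)] by blast
      have h: "h \<in> carrier ?P" "\<phi> h = \<one>\<^bsub>?Q\<^esub>" using N_ker[OF ach(3)] by (auto simp: kernel_def)
      have "\<phi> g = f False a \<otimes>\<^bsub>?Q\<^esub> f True c \<otimes>\<^bsub>?Q\<^esub> \<one>\<^bsub>?Q\<^esub>"
        using ach h lc \<phi>F \<phi>T by (simp add: f_def)
      also have "\<dots> = (a, c)"
        using ach(1,2)[folded cX cY] by (simp add: f_def del: cf.fam_simps)
      finally have "a = \<one>\<^bsub>?X\<^esub>" "c = \<one>\<^bsub>?Y\<^esub>" using gc(2) by (simp_all del: cf.fam_simps)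
      then show "g \<in> generate ?P S" using ach h lA.hom_one lC.hom_one by simp
    qed
  qed
  have fE: "finite E" using i(3) j(3) by (simp add: E_def)
  have cE: "card E = (card A - 1) * (card C - 1)"
    using oX oY i(3) j(3) by (simp add: E_def card_cartesian_product card_Diff_singleton del: cf.fam_simps)
  have "ereal (real (card (carrier ?Q)) / real ((card A - 1) * (card C - 1) - 1)) \<le> sigma_ratio \<P> \<F>"
  proof (rule cf.sigma_ratio_bound[where \<kappa> = True and E = E and S = S and \<phi> = \<phi>])
    show "finite (carrier ?Q)" using i(3) j(3) by (simp add: DirProd_def B_def)
    show "x = \<one>\<^bsub>\<G> (idx b)\<^esub>" if "x \<in> B b" "\<phi> (?l b x) = \<one>\<^bsub>?Q\<^esub>" for b x
      using that \<phi>l0[of b x] by (cases b) (auto simp: f_def)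
    show "generate ?Q E = carrier ?Q"
      using DirProd_generated_by_nontrivial_pairs[OF X.is_group _ Y.is_group] i(4) j(4) cX cY
      by (simp add: E_def del: cf.fam_simps)
    have "card E \<noteq> 0" using cE i(4) j(4) by simp
    then show "E \<noteq> {}" by auto
    show "g \<otimes>\<^bsub>?Q\<^esub> e \<otimes>\<^bsub>?Q\<^esub> inv\<^bsub>?Q\<^esub> g \<in> E" if "e \<in> E" "g \<in> carrier ?Q" for e g
    proof -
      obtain x y a c where eg: "g = (x, y)" "e = (a, c)" by (cases g, cases e) auto
      have *: "x \<in> carrier ?X" "y \<in> carrier ?Y" "a \<in> carrier ?X" "c \<in> carrier ?Y" "a \<noteq> \<one>\<^bsub>?X\<^esub>" "c \<noteq> \<one>\<^bsub>?Y\<^esub>"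
        using that cX cY unfolding eg E_def by auto
      have "x \<otimes>\<^bsub>?X\<^esub> a \<otimes>\<^bsub>?X\<^esub> inv\<^bsub>?X\<^esub> x \<in> carrier ?X - {\<one>\<^bsub>?X\<^esub>}"
        "y \<otimes>\<^bsub>?Y\<^esub> c \<otimes>\<^bsub>?Y\<^esub> inv\<^bsub>?Y\<^esub> y \<in> carrier ?Y - {\<one>\<^bsub>?Y\<^esub>}"
        using * X.conj_eq_one_iff Y.conj_eq_one_iff by (simp_all del: cf.fam_simps)
      then show ?thesis
        using * unfolding eg E_def cX[symmetric] cY[symmetric]
        by (simp add: inv_DirProd X.is_group Y.is_group del: cf.fam_simps)
    qed
    show "\<exists>y z c. cf.letter_pair True y z \<and> c \<in> B True \<and> c \<noteq> \<one>\<^bsub>\<G> (idx True)\<^esub> \<and>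
         e = inv\<^bsub>?Q\<^esub> \<phi> (cf.sub.cl [y]) \<otimes>\<^bsub>?Q\<^esub> \<phi> (?l True c) \<otimes>\<^bsub>?Q\<^esub> \<phi> (cf.sub.cl [z])" if "e \<in> E" for e
    proof -
      obtain g c where e: "e = (g, c)" by (cases e)
      have gc: "g \<in> A" "g \<noteq> \<one>\<^bsub>?X\<^esub>" "c \<in> C" "c \<noteq> \<one>\<^bsub>?Y\<^esub>" using that by (auto simp: e E_def)
      \<comment> \<open>Write \<open>g = a\<^sup>-\<^sup>1 b\<close> with two distinct nontrivial elements of \<open>A\<close>.\<close>
      have "\<exists>a\<in>A. a \<notin> {\<one>\<^bsub>?X\<^esub>, inv\<^bsub>?X\<^esub> g}"
        by (rule ex_outside) (use i(4) in \<open>auto simp: card_insert_if\<close>)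
      then obtain a where a: "a \<in> A" "a \<noteq> \<one>\<^bsub>?X\<^esub>" "a \<noteq> inv\<^bsub>?X\<^esub> g" by blast
      have X: "a \<in> carrier ?X" "g \<in> carrier ?X" "c \<in> carrier ?Y" using a gc cX cY by auto
      let ?b = "a \<otimes>\<^bsub>?X\<^esub> g"
      have b: "?b \<in> carrier ?X" "?b \<noteq> \<one>\<^bsub>?X\<^esub>" "?b \<noteq> a"
        using X a gc X.inv_equality[of a g] X.l_cancel_one[of a g] by (auto simp del: cf.fam_simps)
      have "cf.letter_pair True (False, a) (False, ?b)"
        unfolding cf.letter_pair_def using X b a by (simp add: cf.sub.reduced_Cons del: cf.fam_simps)
      moreover have "e = inv\<^bsub>?Q\<^esub> \<phi> (?l False a) \<otimes>\<^bsub>?Q\<^esub> \<phi> (?l True c) \<otimes>\<^bsub>?Q\<^esub> \<phi> (?l False ?b)"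
        using \<phi>F[OF a(1)] \<phi>F[OF b(1)[unfolded cX]] \<phi>T[OF gc(3)] X b(1)
        by (simp add: e inv_DirProd X.is_group Y.is_group del: cf.fam_simps)
      ultimately show ?thesis using gc(3,4) by (intro exI[of _ "(False, a)"] exI[of _ "(False, ?b)"] exI[of _ c]) (simp add: B_def)
    qed
    show "finite S" "card S \<le> (card A - 1) * (card C - 1)"
      using fE card_image_le[OF fE, of cm] cE by (simp_all add: S_def)
  qed (use \<phi> gen Q.is_group \<F> in simp_all)
  moreover have "card (carrier ?Q) = card A * card C"
    by (simp add: DirProd_def card_cartesian_product B_def)
  ultimately show ?thesis by simp
qed

end

section \<open>Three conjugate involutions\<close>

context free_product_of_groups
begin

text \<open>The involution \<open>c\<close> and its conjugates by two distinct letters outside of its factor generate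
  \<open>C\<^sub>2 * C\<^sub>2 * C\<^sub>2\<close>. The map to \<open>C\<^sub>2\<close> that sends all three generators to \<open>c\<close> is injective on each of them,
  and its kernel is generated by the products of \<open>c\<close> with the two conjugates.\<close>

theorem sigma_ratio_three_involutions:
  assumes i: "i \<in> I" and c: "c \<in> carrier (\<G> i)" "c \<noteq> \<one>\<^bsub>\<G> i\<^esub>" "c \<otimes>\<^bsub>\<G> i\<^esub> c = \<one>\<^bsub>\<G> i\<^esub>"
    and y: "reduced [y]" "fst y \<noteq> i" and z: "reduced [z]" "fst z \<noteq> i" and yz: "y \<noteq> z"
    and \<F>: "factor_free_closed \<F>"
  shows "2 \<le> sigma_ratio \<P> \<F>"
proof -
  interpret Gi: group "\<G> i" using factor_group i .
  \<comment> \<open>The index \<open>None\<close> stands for \<open>c\<close> itself; the two conjugates are indexed by \<open>Some True\<close> and \<open>Some False\<close>.\<close>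
  define p where "p l = (if l = Some True then y else z)" for l :: "bool option"
  let ?v = "\<lambda>l. inv\<^bsub>\<G> (fst (p l))\<^esub> snd (p l)"
  define s where "s l = (if l = None then [] else [p l])" for l
  define link where "link l m = (if l = None then [p m] else
     if m = None then [(fst (p l), ?v l)] else
     if fst (p l) = fst (p m) then [(fst (p l), ?v l \<otimes>\<^bsub>\<G> (fst (p l))\<^esub> snd (p m))]
     else [(fst (p l), ?v l), p m])" for l m
  let ?B = "{\<one>\<^bsub>\<G> i\<^esub>, c}"
  let ?\<Lambda> = "UNIV :: bool option set"
  have p: "fst (p l) \<in> I" "snd (p l) \<in> carrier (\<G> (fst (p l)))" "snd (p l) \<noteq> \<one>\<^bsub>\<G> (fst (p l))\<^esub>"
    "fst (p l) \<noteq> i" for l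
    using y z by (cases y; cases z; auto simp: p_def reduced_Cons)+
  have sw: "s l \<in> words" for l using p[of l] by (cases "p l") (simp add: s_def)
  have ic: "inv\<^bsub>\<G> i\<^esub> c = c" using c Gi.inv_equality by auto
  have B: "subgroup ?B (\<G> i)"
    by (rule Gi.subgroupI) (use c ic in auto)
  have linkl: "reduced (link l m) \<and> cl (s m) = cl (s l @ link l m) \<and>
      distinct_adj (i # map fst (link l m) @ [i])"
    if lm: "l \<in> ?\<Lambda>" "m \<in> ?\<Lambda>" "l \<noteq> m" for l m
  proof -
    interpret Gl: group "\<G> (fst (p l))" by (rule factor_group[OF p(1)])
    have pl: "?v l \<noteq> \<one>\<^bsub>\<G> (fst (p l))\<^esub>"
      using p by (simp add: Gl.inv_eq_1_iff)
    have l1: "letter (fst (p l)) (snd (p l)) = cl [p l]" for l by simp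
    have plc: "cl [p l] \<in> carrier \<P>" for l using p[of l] by (cases "p l") auto
    have inv_l: "letter (fst (p l)) (?v l) = inv\<^bsub>\<P>\<^esub> cl [p l]"
      using letter_inv[OF p(1,2)] by simp
    have w: "[p l] \<in> words" for l using p[of l] by (cases "p l") auto
    have wi: "[(fst (p l), ?v l)] \<in> words" using p[of l] by simp
    consider "l = None" | "l \<noteq> None" "m = None" | "l \<noteq> None" "m \<noteq> None" "fst (p l) = fst (p m)"
      | "l \<noteq> None" "m \<noteq> None" "fst (p l) \<noteq> fst (p m)" by blast
    then show ?thesis
    proof cases
      case 1
      then show ?thesis using lm p[of m] by (cases "p m") (auto simp: link_def s_def reduced_Cons)
    next
      case 2
      have "cl [p l, (fst (p l), ?v l)] = \<one>\<^bsub>\<P>\<^esub>"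
        using cl_append[OF w wi] inv_l plc by simp
      then show ?thesis using 2 p[of l] pl by (auto simp: link_def s_def reduced_Cons one_P)
    next
      case 3
      define j a b where "j = fst (p l)" and "a = snd (p l)" and "b = snd (p m)"
      have pj: "p l = (j, a)" "p m = (j, b)" using 3 by (auto simp: j_def a_def b_def prod_eq_iff)
      interpret Gj: group "\<G> j" using Gl.is_group by (simp add: j_def)
      have j: "j \<in> I" "a \<in> carrier (\<G> j)" "b \<in> carrier (\<G> j)" "j \<noteq> i"
        using p[of l] p[of m] by (simp_all add: pj)
      have "p l \<noteq> p m" using lm 3 yz by (cases l; cases m) (auto simp: p_def)
      then have "a \<noteq> b" by (simp add: pj)
      then have ne: "inv\<^bsub>\<G> j\<^esub> a \<otimes>\<^bsub>\<G> j\<^esub> b \<noteq> \<one>\<^bsub>\<G> j\<^esub>"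
        using Gj.cancel_inv_left(2)[OF j(2,3)] j(2) by auto
      have "cl ([(j, a)] @ [(j, inv\<^bsub>\<G> j\<^esub> a \<otimes>\<^bsub>\<G> j\<^esub> b)]) = letter j a \<otimes>\<^bsub>\<P>\<^esub> (inv\<^bsub>\<P>\<^esub> letter j a \<otimes>\<^bsub>\<P>\<^esub> letter j b)"
        using j by (subst cl_append) (auto simp: letter_mult letter_inv)
      also have "\<dots> = letter j b" using j by simp
      finally show ?thesis
        using 3 j ne by (auto simp: link_def s_def pj reduced_Cons)
    next
      case 4
      have "cl ([p l] @ ([(fst (p l), ?v l)] @ [p m])) =
          cl [p l] \<otimes>\<^bsub>\<P>\<^esub> (inv\<^bsub>\<P>\<^esub> cl [p l] \<otimes>\<^bsub>\<P>\<^esub> cl [p m])"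
        using inv_l w wi cl_append[OF w, of "[(fst (p l), ?v l)] @ [p m]" l]
          cl_append[OF wi w, of m] by simp
      then show ?thesis
        using 4 p[of l] p[of m] pl plc
        by (cases "p m") (auto simp: link_def s_def reduced_Cons)
    qed
  qed
  interpret cf: conjugate_family I \<G> ?\<Lambda> "\<lambda>_. i" "\<lambda>_. ?B" s link
    by (intro conjugate_family.intro[OF free_product_of_groups_axioms] conjugate_family_axioms.intro)
      (use i B linkl sw in \<open>simp_all only: not_False_eq_True\<close>)
  let ?P = cf.sub.\<P>
  let ?l = cf.sub.letter
  let ?Q = "(\<G> i)\<lparr>carrier := ?B\<rparr>"
  interpret Q: group ?Q using Gi.subgroup_imp_group[OF B] .
  have iQ: "inv\<^bsub>?Q\<^esub> x = inv\<^bsub>\<G> i\<^esub> x" if "x \<in> ?B" for x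
    using Gi.m_inv_consistent[OF B that] .
  have "(\<lambda>x. x) \<in> hom (cf.fam l) ?Q" for l by (rule homI) (auto simp: c)
  then obtain \<phi> where \<phi>: "\<phi> \<in> hom ?P ?Q"
    and \<phi>l: "\<And>l x. l \<in> ?\<Lambda> \<Longrightarrow> x \<in> carrier (cf.fam l) \<Longrightarrow> \<phi> (?l l x) = x"
    by (rule cf.sub.hom_extends[OF Q.is_group, of "\<lambda>_ x. x"]) auto
  interpret \<phi>: group_hom ?P ?Q \<phi> by unfold_locales fact
  define x where "x l = ?l l c" for l
  have xc: "x l \<in> carrier ?P" and \<phi>x: "\<phi> (x l) = c" if "l \<in> ?\<Lambda>" for l
    using that \<phi>l[OF that, of c] by (auto simp: x_def)
  have xx: "x l \<otimes>\<^bsub>?P\<^esub> x l = \<one>\<^bsub>?P\<^esub>" if "l \<in> ?\<Lambda>" for l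
    using cf.sub.letter_mult[OF that, of c c] cf.sub.letter_one[OF that] c by (simp add: x_def)
  have ix: "inv\<^bsub>?P\<^esub> x l = x l" if "l \<in> ?\<Lambda>" for l
    using xx xc that cf.sub.P.inv_equality by blast
  define S where "S = {x None \<otimes>\<^bsub>?P\<^esub> x (Some True), x None \<otimes>\<^bsub>?P\<^esub> x (Some False)}"
  let ?N = "generate ?P S"
  have Sc: "S \<subseteq> carrier ?P" using xc by (auto simp: S_def)
  interpret N: subgroup ?N ?P by (rule cf.sub.P.generate_is_subgroup[OF Sc])
  have N0: "x None \<otimes>\<^bsub>?P\<^esub> x l \<in> ?N" "x l \<otimes>\<^bsub>?P\<^esub> x None \<in> ?N" if l: "l \<in> ?\<Lambda>" for l
  proof -
    show 1: "x None \<otimes>\<^bsub>?P\<^esub> x l \<in> ?N"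
      using xx[of None] N.one_closed
      by (cases l; cases "l = Some True") (auto simp: S_def intro: generate.incl)
    have "inv\<^bsub>?P\<^esub> (x None \<otimes>\<^bsub>?P\<^esub> x l) \<in> ?N" using 1 by simp
    then show "x l \<otimes>\<^bsub>?P\<^esub> x None \<in> ?N" using xc ix l by (simp add: cf.sub.P.inv_mult_group)
  qed
  have dec: "g \<in> ?N \<or> (\<exists>n\<in>?N. g = x None \<otimes>\<^bsub>?P\<^esub> n)" if "g \<in> carrier ?P" for g
    using that
  proof (induction rule: cf.sub.carrier_induct)
    case (letter l a g)
    show ?case
    proof (cases "a = \<one>\<^bsub>\<G> i\<^esub>")
      case True
      then have "?l l a \<otimes>\<^bsub>?P\<^esub> g = g" using letter(1,3) cf.sub.letter_one[of l] by simp
      then show ?thesis using letter.IH by simp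
    next
      case False
      then have a: "?l l a = x l" using letter(2) by (auto simp: x_def)
      have x0: "x None \<in> carrier ?P" and xl: "x l \<in> carrier ?P" using xc letter(1) by auto
      from letter.IH show ?thesis
      proof
        assume g: "g \<in> ?N"
        have "x l \<otimes>\<^bsub>?P\<^esub> g = x None \<otimes>\<^bsub>?P\<^esub> ((x None \<otimes>\<^bsub>?P\<^esub> x l) \<otimes>\<^bsub>?P\<^esub> g)"
          using xx[of None] x0 xl N.mem_carrier[OF g] by (simp add: cf.sub.P.m_assoc[symmetric])
        then show ?thesis using a N0(1)[OF letter(1)] g N.m_closed by metis
      next
        assume "\<exists>n\<in>?N. g = x None \<otimes>\<^bsub>?P\<^esub> n"
        then obtain n where n: "n \<in> ?N" "g = x None \<otimes>\<^bsub>?P\<^esub> n" by blast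
        have "x l \<otimes>\<^bsub>?P\<^esub> g = (x l \<otimes>\<^bsub>?P\<^esub> x None) \<otimes>\<^bsub>?P\<^esub> n"
          using x0 xl N.mem_carrier[OF n(1)] n(2) by (simp add: cf.sub.P.m_assoc)
        then show ?thesis using a N0(2)[OF letter(1)] n(1) N.m_closed by metis
      qed
    qed
  qed (use N.one_closed in simp)
  have Nk: "?N \<subseteq> kernel ?P ?Q \<phi>"
    by (rule cf.sub.P.generate_subgroup_incl[OF _ \<phi>.subgroup_kernel])
      (use xc \<phi>x c in \<open>auto simp: S_def kernel_def\<close>)
  have gen: "?N = kernel ?P ?Q \<phi>"
  proof
    show "kernel ?P ?Q \<phi> \<subseteq> ?N"
    proof
      fix g assume g: "g \<in> kernel ?P ?Q \<phi>"
      then have gc: "g \<in> carrier ?P" "\<phi> g = \<one>\<^bsub>\<G> i\<^esub>" by (auto simp: kernel_def)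
      have "\<phi> (x None \<otimes>\<^bsub>?P\<^esub> n) = c" if "n \<in> ?N" for n
        using that Nk xc[of None] \<phi>x[of None] c by (auto simp: kernel_def)
      then show "g \<in> ?N" using dec[OF gc(1)] gc(2) c(2) by auto
    qed
  qed (rule Nk)
  have "ereal (real (card (carrier ?Q)) / real (2 - 1)) \<le> sigma_ratio \<P> \<F>"
  proof (rule cf.sigma_ratio_bound[where \<kappa> = None and E = "{c}" and S = S and \<phi> = \<phi>])
    show "a = \<one>\<^bsub>\<G> i\<^esub>" if "l \<in> ?\<Lambda>" "a \<in> ?B" "\<phi> (?l l a) = \<one>\<^bsub>?Q\<^esub>" for l a
      using that \<phi>l[OF that(1), of a] by simp
    show "generate ?Q {c} = carrier ?Q"
    proof
      show "generate ?Q {c} \<subseteq> carrier ?Q" by (rule Q.generate_incl) simp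
      have "\<one>\<^bsub>?Q\<^esub> \<in> generate ?Q {c}" "c \<in> generate ?Q {c}"
        by (rule generate.one, rule generate.incl) simp
      then show "carrier ?Q \<subseteq> generate ?Q {c}" by simp
    qed
    show "g \<otimes>\<^bsub>?Q\<^esub> e \<otimes>\<^bsub>?Q\<^esub> inv\<^bsub>?Q\<^esub> g \<in> {c}" if "e \<in> {c}" "g \<in> carrier ?Q" for e g
      using that iQ[of g] c ic by (auto simp: Gi.m_assoc)
    show "\<exists>y z d. cf.letter_pair None y z \<and> d \<in> ?B \<and> d \<noteq> \<one>\<^bsub>\<G> i\<^esub> \<and>
        e = inv\<^bsub>?Q\<^esub> \<phi> (cf.sub.cl [y]) \<otimes>\<^bsub>?Q\<^esub> \<phi> (?l None d) \<otimes>\<^bsub>?Q\<^esub> \<phi> (cf.sub.cl [z])" if "e \<in> {c}" for e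
    proof (rule exI[of _ "(Some True, c)"], rule exI[of _ "(Some False, c)"], rule exI[of _ c], intro conjI)
      show "cf.letter_pair None (Some True, c) (Some False, c)"
        using c by (simp add: cf.letter_pair_def cf.sub.reduced_Cons)
      show "e = inv\<^bsub>?Q\<^esub> \<phi> (?l (Some True) c) \<otimes>\<^bsub>?Q\<^esub> \<phi> (?l None c) \<otimes>\<^bsub>?Q\<^esub> \<phi> (?l (Some False) c)"
        using that \<phi>x[of None] \<phi>x[of "Some True"] \<phi>x[of "Some False"] iQ[of c] ic c by (simp add: x_def)
    qed (use c in auto)
    show "card S \<le> 2" by (simp add: S_def card_insert_if)
  qed (use \<phi> gen Q.is_group \<F> in \<open>simp_all add: S_def\<close>)
  moreover have "card (carrier ?Q) = 2" using c by (simp add: card_insert_if)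
  ultimately show ?thesis by simp
qed

end

section \<open>Free groups are torsion-free\<close>

lemma (in group) group_word_value_simps:
  "group_word_value G [] = \<one>"
  "group_word_value G ((x, e) # w) = (if e then x else inv x) \<otimes> group_word_value G w"
  by (simp_all add: group_word_value_def)

lemma (in group) group_word_value_append:
  assumes "set v \<subseteq> carrier G \<times> UNIV" "set w \<subseteq> carrier G \<times> UNIV"
  shows "group_word_value G w \<in> carrier G"
    and "group_word_value G (v @ w) = group_word_value G v \<otimes> group_word_value G w"
proof -
  have c: "set w \<subseteq> carrier G \<times> UNIV \<Longrightarrow> group_word_value G w \<in> carrier G" for w
    by (induction w) (auto simp: group_word_value_simps)
  then show "group_word_value G w \<in> carrier G" using assms by blast
  show "group_word_value G (v @ w) = group_word_value G v \<otimes> group_word_value G w"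
    using assms by (induction v) (auto simp: group_word_value_simps m_assoc c)
qed

text \<open>If the ends of a reduced word do not cancel, then its powers are reduced words, too; otherwise
  conjugation makes it shorter.\<close>

theorem free_group_torsion_free:
  fixes F :: "('a, 'b) monoid_scheme" (structure)
  assumes "free_group F" "x \<in> carrier F" "x [^]\<^bsub>F\<^esub> (n::nat) = \<one>\<^bsub>F\<^esub>" "n > 0"
  shows "x = \<one>\<^bsub>F\<^esub>"
proof -
  interpret group F using assms(1) by (simp add: free_group_def)
  obtain B where B: "B \<subseteq> carrier F"
    and ex: "\<And>g. g \<in> carrier F \<Longrightarrow> \<exists>!w. w \<in> reduced_group_words B \<and> group_word_value F w = g"
    using assms(1) by (auto simp: free_group_def free_basis_def)
  let ?v = "group_word_value F" and ?R = "reduced_group_words B"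
  let ?ok = "\<lambda>(x :: 'a, e :: bool) (y, d). \<not> (x = y \<and> e \<noteq> d)"
  have R: "w \<in> ?R \<longleftrightarrow> set w \<subseteq> B \<times> UNIV \<and> successively ?ok w" for w
    by (auto simp: reduced_group_words_def lists_eq_set)
  have sub: "w \<in> ?R \<Longrightarrow> set w \<subseteq> carrier F \<times> UNIV" for w using B R by blast
  have vc: "w \<in> ?R \<Longrightarrow> ?v w \<in> carrier F" for w using group_word_value_append(1)[of "[]"] sub by auto
  have "w \<in> ?R \<Longrightarrow> ?v w [^] n = \<one> \<Longrightarrow> w = []" for w
  proof (induction "length w" arbitrary: w rule: less_induct)
    case less
    show ?case
    proof (rule ccontr)
      assume ne: "w \<noteq> []"
      show False
      proof (cases "?ok (last w) (hd w)")
        case True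
        define W where "W k = concat (replicate k w)" for k
        have W: "W k \<in> ?R \<and> ?v (W k) = ?v w [^] k \<and> (k > 0 \<longrightarrow> W k \<noteq> [] \<and> hd (W k) = hd w)" for k
        proof (induction k)
          case 0
          then show ?case by (simp add: W_def R group_word_value_simps)
        next
          case (Suc k)
          have e: "W (Suc k) = w @ W k" by (simp add: W_def)
          have "W (Suc k) \<in> ?R"
            using Suc less.prems(1) True ne unfolding e R by (cases k) (auto simp: successively_append_iff W_def)
          moreover have "?v (W (Suc k)) = ?v w \<otimes> ?v w [^] k"
            unfolding e using group_word_value_append(2)[of w "W k"] sub Suc less.prems(1) by simp
          ultimately show ?case using ne vc[OF less.prems(1)] nat_pow_Suc2 e by simp
        qed
        have "W n \<in> ?R" "?v (W n) = \<one>" "W n \<noteq> []" using W[of n] less.prems(2) assms(4) by auto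
        moreover have "[] \<in> ?R" "?v [] = \<one>" by (simp_all add: R group_word_value_simps)
        ultimately show False using ex[OF one_closed] by metis
      next
        case False
        obtain b e t where w: "w = (b, e) # t" using ne by (cases w) auto
        then have "last w = (b, \<not> e)" using False by (cases "last w") auto
        moreover have "t \<noteq> []" using calculation w by auto
        ultimately obtain u where u: "w = [(b, e)] @ u @ [(b, \<not> e)]"
          using w append_butlast_last_id[of t] by (metis append_Cons append_Nil last_ConsR)
        have uR: "u \<in> ?R" using less.prems(1) unfolding R u by (auto simp: successively_append_iff successively_Cons)
        have bc: "b \<in> carrier F" using less.prems(1) B unfolding R u by auto
        define q where "q = (if e then b else inv b)"
        have qc: "q \<in> carrier F" using bc by (simp add: q_def)
        have "?v w = q \<otimes> (?v u \<otimes> inv q)"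
          using bc sub[OF uR] vc[OF uR] group_word_value_append(2)[of u "[(b, \<not> e)]"]
          by (simp add: u group_word_value_simps q_def)
        then have "?v w = q \<otimes> ?v u \<otimes> inv q" using qc vc[OF uR] by (simp add: m_assoc)
        then have "?v u [^] n = \<one>"
          using less.prems(2) conj_pow[OF qc vc[OF uR]] conj_eq_one_iff[OF qc] vc[OF uR] by simp
        then have "u = []" using less.hyps[of u] uR u by simp
        then show False using less.prems(1) unfolding R u by simp
      qed
    qed
  qed
  moreover obtain w where "w \<in> ?R" "?v w = x" using ex[OF assms(2)] by blast
  ultimately show ?thesis using assms(3) group_word_value_simps(1) by metis
qed

section \<open>Cyclic subgroups\<close>

context group
begin

text \<open>If any two elements of \<open>H\<close> generate a cyclic group, then finitely many elements do as well, by induction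
  on their number: all but one of them can be replaced by a single generator.\<close>

lemma noncyclic_two_generated:
  assumes H: "subgroup H G" "finite S" "generate G S = H" "2 \<le> group_rank (G\<lparr>carrier := H\<rparr>)"
  shows "\<exists>x\<in>H. \<exists>y\<in>H. 2 \<le> group_rank (G\<lparr>carrier := generate G {x, y}\<rparr>)"
proof (rule ccontr)
  assume neg: "\<not> ?thesis"
  have Hc: "H \<subseteq> carrier G" using subgroup.subset[OF H(1)] .
  have cyc: "\<exists>z\<in>generate G {x, y}. generate G {x, y} = generate G {z}" if "x \<in> H" "y \<in> H" for x y
  proof -
    have "\<not> 2 \<le> group_rank (G\<lparr>carrier := generate G {x, y}\<rparr>)" using neg that by blast
    moreover have "subgroup (generate G {x, y}) G"
      using that Hc by (intro generate_is_subgroup) auto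
    ultimately show ?thesis using cyclic_iff_group_rank[of "generate G {x, y}"] by (simp add: not_le)
  qed
  have "finite S \<Longrightarrow> S \<subseteq> H \<Longrightarrow> \<exists>z\<in>H. generate G S = generate G {z}" for S
  proof (induction rule: finite_induct)
    case empty
    then show ?case using subgroup.one_closed[OF H(1)]
      by (intro bexI[of _ "\<one>"]) (simp_all add: generate_empty generate_one)
  next
    case (insert x S)
    then obtain y where y: "y \<in> H" "generate G S = generate G {y}" by auto
    have x: "x \<in> H" using insert by simp
    obtain z where z: "z \<in> generate G {x, y}" "generate G {x, y} = generate G {z}" using cyc[OF x y(1)] by blast
    have sub: "subgroup (generate G (insert x S)) G" "subgroup (generate G {x, y}) G"
      using insert.prems x y Hc by (auto intro!: generate_is_subgroup)
    have "S \<subseteq> generate G {x, y}"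
    proof -
      have "S \<subseteq> generate G S" by (auto intro: generate.incl)
      also have "\<dots> \<subseteq> generate G {x, y}" unfolding y(2) by (rule mono_generate) auto
      finally show ?thesis .
    qed
    then have "generate G (insert x S) \<subseteq> generate G {x, y}"
      by (intro generate_subgroup_incl[OF _ sub(2)]) (auto intro: generate.incl)
    moreover have "y \<in> generate G (insert x S)"
      using mono_generate[of S "insert x S"] generate.incl[of y "{y}" G] y(2) by auto
    then have "generate G {x, y} \<subseteq> generate G (insert x S)"
      by (intro generate_subgroup_incl[OF _ sub(1)]) (auto intro: generate.incl)
    moreover have "generate G {x, y} \<subseteq> H" using x y by (intro generate_subgroup_incl[OF _ H(1)]) auto
    ultimately show ?case using z by blast
  qed
  moreover have "S \<subseteq> H" using H(3) by (auto intro: generate.incl)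
  ultimately obtain z where "z \<in> H" "H = generate G {z}" using H(2,3) by metis
  then show False using cyclic_iff_group_rank[OF H(1)] H(4) by (auto simp: not_less[symmetric])
qed

text \<open>Two involutions generate a dihedral group: \<open>X\<close> inverts the powers of \<open>X T\<close>, so the elements outside of
  the group of rotations are involutions.\<close>

lemma involution_product_conj:
  assumes X: "X \<in> carrier G" "X \<otimes> X = \<one>" and T: "T \<in> carrier G" "T \<otimes> T = \<one>"
    and n: "n \<in> generate G {X \<otimes> T}"
  shows "(X \<otimes> n) \<otimes> (X \<otimes> n) = \<one>"
proof -
  define R where "R = X \<otimes> T"
  have Rc: "R \<in> carrier G" using X T by (simp add: R_def)
  have iX: "inv X = X" and iT: "inv T = T" using X T inv_equality by auto
  have XRX: "X \<otimes> R \<otimes> inv X = inv R"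
    using X T by (simp add: R_def iX iT inv_mult_group m_assoc[symmetric])
  have XnX: "X \<otimes> R [^] m \<otimes> inv X = inv (R [^] m)" for m :: nat
    using conj_pow[OF X(1) Rc, of m] Rc by (simp add: XRX nat_pow_inv)
  obtain k :: int where k: "n = R [^] k" using n generate_pow[OF Rc] by (auto simp: R_def)
  have "X \<otimes> n \<otimes> inv X = inv n"
  proof (cases k rule: int_cases2)
    case (nonneg m)
    then show ?thesis using XnX[of m] k by (simp add: int_pow_int)
  next
    case (nonpos m)
    then have n: "n = inv (R [^] m)" using k Rc by (simp add: int_pow_neg_int)
    have "X \<otimes> inv (R [^] m) \<otimes> inv X = inv (X \<otimes> R [^] m \<otimes> inv X)"
      using X Rc by (simp add: inv_mult_group m_assoc)
    then show ?thesis using XnX[of m] n by simp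
  qed
  moreover have "n \<in> carrier G" using k Rc by simp
  ultimately show ?thesis using X iX by (metis m_assoc m_closed l_inv)
qed

end

context free_product_of_groups
begin

text \<open>If the only nontrivial letters are two involutions, then the free product is dihedral, and a subgroup
  without involutions consists of rotations.\<close>

lemma dihedral_free_product_cyclic:
  assumes c: "i \<in> I" "c \<in> carrier (\<G> i)" "c \<otimes>\<^bsub>\<G> i\<^esub> c = \<one>\<^bsub>\<G> i\<^esub>"
    and t: "j \<in> I" "t \<in> carrier (\<G> j)" "t \<otimes>\<^bsub>\<G> j\<^esub> t = \<one>\<^bsub>\<G> j\<^esub>"
    and only: "\<And>l x. l \<in> I \<Longrightarrow> x \<in> carrier (\<G> l) \<Longrightarrow> x \<noteq> \<one>\<^bsub>\<G> l\<^esub> \<Longrightarrow> (l, x) = (i, c) \<or> (l, x) = (j, t)"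
    and H: "subgroup H \<P>" and tf: "\<And>g. g \<in> H \<Longrightarrow> g \<otimes>\<^bsub>\<P>\<^esub> g = \<one>\<^bsub>\<P>\<^esub> \<Longrightarrow> g = \<one>\<^bsub>\<P>\<^esub>"
  shows "group_rank (\<P>\<lparr>carrier := H\<rparr>) < 2"
proof -
  define X T where "X = letter i c" and "T = letter j t"
  have X: "X \<in> carrier \<P>" "X \<otimes>\<^bsub>\<P>\<^esub> X = \<one>\<^bsub>\<P>\<^esub>"
    using c letter_mult[OF c(1,2,2)] letter_one[OF c(1)] by (simp_all add: X_def)
  have T: "T \<in> carrier \<P>" "T \<otimes>\<^bsub>\<P>\<^esub> T = \<one>\<^bsub>\<P>\<^esub>"
    using t letter_mult[OF t(1,2,2)] letter_one[OF t(1)] by (simp_all add: T_def)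
  let ?N = "generate \<P> {X \<otimes>\<^bsub>\<P>\<^esub> T}"
  interpret N: subgroup ?N \<P> using X T by (intro P.generate_is_subgroup) auto
  have R: "X \<otimes>\<^bsub>\<P>\<^esub> T \<in> ?N" by (intro generate.incl) simp
  have "inv\<^bsub>\<P>\<^esub> (X \<otimes>\<^bsub>\<P>\<^esub> T) = T \<otimes>\<^bsub>\<P>\<^esub> X"
    using X T P.inv_equality[of X X] P.inv_equality[of T T] by (simp add: P.inv_mult_group)
  then have R': "T \<otimes>\<^bsub>\<P>\<^esub> X \<in> ?N" using N.m_inv_closed[OF R] by simp
  have dec: "g \<in> ?N \<or> (\<exists>n\<in>?N. g = X \<otimes>\<^bsub>\<P>\<^esub> n)" if "g \<in> carrier \<P>" for g
    using that
  proof (induction rule: carrier_induct)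
    case (letter l a g)
    consider "a = \<one>\<^bsub>\<G> l\<^esub>" | "letter l a = X" | "letter l a = T"
      using only[OF letter(1,2)] by (auto simp: X_def T_def)
    then show ?case
    proof cases
      case 1
      then show ?thesis using letter letter_one[of l] by simp
    next
      case 2
      from letter.IH show ?thesis
      proof
        assume "\<exists>n\<in>?N. g = X \<otimes>\<^bsub>\<P>\<^esub> n"
        then obtain n where n: "n \<in> ?N" "g = X \<otimes>\<^bsub>\<P>\<^esub> n" by blast
        then have "X \<otimes>\<^bsub>\<P>\<^esub> g = n" using X N.mem_carrier by (simp add: P.m_assoc[symmetric])
        then show ?thesis using 2 n by simp
      qed (use 2 in blast)
    next
      case 3
      from letter.IH show ?thesis
      proof
        assume g: "g \<in> ?N"
        have "T \<otimes>\<^bsub>\<P>\<^esub> g = X \<otimes>\<^bsub>\<P>\<^esub> ((X \<otimes>\<^bsub>\<P>\<^esub> T) \<otimes>\<^bsub>\<P>\<^esub> g)"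
          using X T N.mem_carrier[OF g] by (simp add: P.m_assoc[symmetric])
        then show ?thesis using 3 N.m_closed[OF R g] by metis
      next
        assume "\<exists>n\<in>?N. g = X \<otimes>\<^bsub>\<P>\<^esub> n"
        then obtain n where n: "n \<in> ?N" "g = X \<otimes>\<^bsub>\<P>\<^esub> n" by blast
        then have "T \<otimes>\<^bsub>\<P>\<^esub> g = (T \<otimes>\<^bsub>\<P>\<^esub> X) \<otimes>\<^bsub>\<P>\<^esub> n" using X T N.mem_carrier by (simp add: P.m_assoc)
        then show ?thesis using 3 N.m_closed[OF R' n(1)] by metis
      qed
    qed
  qed (use N.one_closed in simp)
  have "H \<subseteq> ?N"
  proof
    fix g assume g: "g \<in> H"
    then have "g \<in> carrier \<P>" using subgroup.subset[OF H] by blast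
    from dec[OF this] show "g \<in> ?N"
      using P.involution_product_conj[OF X T] tf[OF g] N.one_closed by auto
  qed
  then obtain y where "y \<in> H" "H = generate \<P> {y}"
    using P.subgroup_of_cyclic[OF _ H, of "X \<otimes>\<^bsub>\<P>\<^esub> T"] X T by auto
  then show ?thesis using P.cyclic_iff_group_rank[OF H] by blast
qed

end

lemma ecard_eq_enat: "ecard S = enat n \<longleftrightarrow> finite S \<and> card S = n" if "n > 0"
  using that by (auto simp: ecard_def)

lemma alpha3_attained:
  assumes "alpha3 G = enat n"
  obtains L where "subgroup L G" "finite L" "card L = n" "n \<ge> 3"
proof -
  let ?E = "ecard ` {L. subgroup L G \<and> 3 \<le> ecard L}"
  have "?E \<noteq> {}" using assms by (auto simp: alpha3_def Inf_enat_def split: if_splits)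
  then obtain z where "z \<in> ?E" by (meson ex_in_conv)
  then have "Inf ?E \<in> ?E" by (rule wellorder_InfI)
  then have "enat n \<in> ?E" using assms by (simp add: alpha3_def)
  then obtain L where "enat n = ecard L" "L \<in> {L. subgroup L G \<and> 3 \<le> ecard L}" by (rule imageE)
  then have L: "subgroup L G" "3 \<le> ecard L" "ecard L = enat n" by simp_all
  then have "n \<ge> 3" by (simp add: numeral_eq_enat)
  then show ?thesis using that[of L] L ecard_eq_enat[of n L] by simp
qed

lemma theta_enat:
  assumes "n \<ge> 3"
  shows "theta (ereal_of_enat (enat n)) = ereal (real n / (real n - 2))"
proof -
  have "ereal (real n) - 2 = ereal (real n - 2)"
    by (metis ereal_minus(1) numeral_eq_ereal)
  then show ?thesis using assms by (simp add: theta_def)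
qed

lemma (in group) order_two_involution:
  assumes "subgroup C G" "card C = 2"
  obtains c where "C = {\<one>, c}" "c \<in> carrier G" "c \<noteq> \<one>" "c \<otimes> c = \<one>"
proof -
  interpret C: subgroup C G by fact
  obtain x y where xy: "C = {x, y}" "x \<noteq> y" using assms(2) by (auto simp: card_2_iff)
  obtain c where c: "C = {\<one>, c}" "c \<noteq> \<one>"
  proof (cases "x = \<one>")
    case True
    then show ?thesis using that[of y] xy by simp
  next
    case False
    then show ?thesis using that[of x] xy C.one_closed by auto
  qed
  have cc: "c \<in> carrier G" using c by auto
  have "c \<otimes> c \<in> {\<one>, c}" using c C.m_closed[of c c] by auto
  then have "c \<otimes> c = \<one>" using c(2) cc by (auto simp: l_cancel_one)
  then show ?thesis using that c cc by blast
qed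

theorem proposition2p9:
  fixes I :: "'i set"
    and \<G> :: "'i \<Rightarrow> ('a, 'b) monoid_scheme"
    and F :: "('a, 'b) monoid_scheme"
    and G :: "('i option \<times> 'a) list set monoid"
    and \<F> :: "('i option \<times> 'a) list set set set"
  assumes "\<And>i. i \<in> I \<Longrightarrow> group (\<G> i)"
    and "free_group F"
    and "G = free_product_with F I \<G>"
    and "\<F> = factor_free_subgroups F I \<G>"
    and "\<exists>H\<in>\<F>. 2 \<le> group_rank (G\<lparr>carrier := H\<rparr>)"
  shows "beta2 G * theta (ereal_of_enat (alpha3 G)) \<le> sigma_ratio G \<F>"
proof -
  define J where "J = with_index I"
  define M where "M = with_factor F \<G>"
  have M: "M None = F" "M (Some i) = \<G> i" for i by (simp_all add: M_def with_factor_def)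
  have J: "None \<in> J" "Some i \<in> J \<longleftrightarrow> i \<in> I" for i by (auto simp: J_def with_index_def)
  have "group (M j)" if "j \<in> J" for j
    using that assms(1,2) J M by (cases j) (auto simp: free_group_def)
  then interpret free_product_of_groups J M by (rule free_product_of_groups.intro)
  have G: "G = \<P>" using assms(3) unfolding \<P>_def by (simp add: free_product_with_def J_def M_def)
  have factor: "factor_subgroup F I \<G> i = letter (Some i) ` carrier (\<G> i)" for i
    by (simp add: factor_subgroup_def fp_factor_def cl_def J_def[symmetric] M_def[symmetric] M)
  have \<F>_iff: "H \<in> \<F> \<longleftrightarrow> fin_gen_subgroup H \<P> \<and>
      (\<forall>g\<in>carrier \<P>. \<forall>i\<in>I. H \<inter> conjugate \<P> (letter (Some i) ` carrier (\<G> i)) g = {\<one>\<^bsub>\<P>\<^esub>})" for H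
    unfolding assms(4) factor_free_subgroups_def factor using assms(3) G by simp
  have closed: "factor_free_closed \<F>"
    unfolding factor_free_closed_def
  proof (intro allI impI)
    fix H assume H: "fin_gen_subgroup H \<P>" "\<forall>g\<in>H. conj_letter g \<longrightarrow> g = \<one>\<^bsub>\<P>\<^esub>"
    have "H \<inter> conjugate \<P> (letter (Some i) ` carrier (\<G> i)) g = {\<one>\<^bsub>\<P>\<^esub>}"
      if g: "g \<in> carrier \<P>" and i: "i \<in> I" for g i
    proof -
      interpret Gi: group "\<G> i" using assms(1) i .
      have "h = \<one>\<^bsub>\<P>\<^esub>" if h: "h \<in> H" and hg: "h \<in> conjugate \<P> (letter (Some i) ` carrier (\<G> i)) g" for h
      proof -
        obtain x where x: "x \<in> carrier (\<G> i)" "h = inv\<^bsub>\<P>\<^esub> g \<otimes>\<^bsub>\<P>\<^esub> letter (Some i) x \<otimes>\<^bsub>\<P>\<^esub> inv\<^bsub>\<P>\<^esub> (inv\<^bsub>\<P>\<^esub> g)"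
          using hg g by (auto simp: conjugate_def)
        then have "conj_letter h"
          unfolding conj_letter_def using g i J M
          by (intro bexI[of _ "inv\<^bsub>\<P>\<^esub> g"] bexI[of _ "Some i"] bexI[of _ x]) auto
        then show ?thesis using H(2) h by blast
      qed
      moreover have "\<one>\<^bsub>\<P>\<^esub> \<in> H" using H(1) by (auto simp: fin_gen_subgroup_def subgroup.one_closed)
      moreover have "\<one>\<^bsub>\<P>\<^esub> \<in> conjugate \<P> (letter (Some i) ` carrier (\<G> i)) g"
        unfolding conjugate_def
        using g letter_one[of "Some i"] J i M by (intro image_eqI[of _ _ "\<one>\<^bsub>\<P>\<^esub>"]) (auto simp: image_iff intro!: bexI[of _ "\<one>\<^bsub>\<G> i\<^esub>"])
      ultimately show ?thesis by blast
    qed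
    then show "H \<in> \<F>" by (intro iffD2[OF \<F>_iff] conjI ballI H(1))
  qed
  obtain H0 where H0: "H0 \<in> \<F>" "2 \<le> group_rank (\<P>\<lparr>carrier := H0\<rparr>)" using assms(5) G by blast
  note H0F = iffD1[OF \<F>_iff H0(1)]
  have sH0: "subgroup H0 \<P>" using H0F by (simp add: fin_gen_subgroup_def)
  have F_tf: "x = \<one>\<^bsub>F\<^esub>" if "x \<in> carrier F" "x [^]\<^bsub>F\<^esub> n = \<one>\<^bsub>F\<^esub>" "n > 0" for x and n :: nat
    using free_group_torsion_free[OF assms(2) that] .
  \<comment> \<open>Finite subgroups live in the factors \<open>\<G> i\<close>, because \<open>F\<close> is torsion-free.\<close>
  have factor_some: "\<exists>i\<in>I. j = Some i"
    if "j \<in> J" "subgroup A (M j)" and fA: "finite A" and "card A \<ge> 2" for j A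
  proof (cases j)
    case None
    then have A: "subgroup A F" using that(2) M by simp
    interpret F: group F using assms(2) by (simp add: free_group_def)
    have "\<exists>x\<in>A. x \<notin> {\<one>\<^bsub>F\<^esub>}" by (rule ex_outside) (use that in auto)
    then obtain x where x: "x \<in> A" "x \<noteq> \<one>\<^bsub>F\<^esub>" by blast
    obtain n :: nat where "n > 0" "x [^]\<^bsub>F\<^esub> n = \<one>\<^bsub>F\<^esub>"
      using F.finite_subgroup_torsion[OF A fA x(1)] .
    then show ?thesis using F_tf[of x n] x subgroup.mem_carrier[OF A x(1)] by blast
  qed (use that J in auto)
  have H0_conj: "h = \<one>\<^bsub>\<P>\<^esub>"
    if "h \<in> H0" "p \<in> carrier \<P>" "i \<in> I" "x \<in> carrier (\<G> i)"
      "h = p \<otimes>\<^bsub>\<P>\<^esub> letter (Some i) x \<otimes>\<^bsub>\<P>\<^esub> inv\<^bsub>\<P>\<^esub> p" for h p i x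
  proof -
    have "h \<in> conjugate \<P> (letter (Some i) ` carrier (\<G> i)) (inv\<^bsub>\<P>\<^esub> p)"
      unfolding conjugate_def using that by (intro image_eqI[of _ _ "letter (Some i) x"]) auto
    moreover have "H0 \<inter> conjugate \<P> (letter (Some i) ` carrier (\<G> i)) (inv\<^bsub>\<P>\<^esub> p) = {\<one>\<^bsub>\<P>\<^esub>}"
      using H0F that(3) P.inv_closed[OF that(2)] by simp
    ultimately show ?thesis using that(1) by blast
  qed
  \<comment> \<open>If only one \<open>\<G> i\<close> were nontrivial, then it would be all of \<open>G\<close>, and \<open>H0\<close> would be trivial.\<close>
  have out: "\<exists>j\<in>J. j \<noteq> Some i \<and> (\<exists>t\<in>carrier (M j). t \<noteq> \<one>\<^bsub>M j\<^esub>)" if i: "i \<in> I" for i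
  proof (rule ccontr)
    assume neg: "\<not> ?thesis"
    interpret Gi: group "\<G> i" using assms(1) i .
    have all: "\<exists>x\<in>carrier (\<G> i). g = letter (Some i) x" if "g \<in> carrier \<P>" for g
      using that
    proof (induction rule: carrier_induct)
      case one
      then show ?case using letter_one[of "Some i"] J M i by (auto intro!: bexI[of _ "\<one>\<^bsub>\<G> i\<^esub>"])
    next
      case (letter j x g)
      then obtain y where y: "y \<in> carrier (\<G> i)" "g = letter (Some i) y" by blast
      show ?case
      proof (cases "j = Some i")
        case True
        then have "letter j x \<otimes>\<^bsub>\<P>\<^esub> g = letter (Some i) (x \<otimes>\<^bsub>\<G> i\<^esub> y)"
          using letter_mult[of "Some i" x y] letter y J M i by simp
        then show ?thesis using letter y True M by auto
      next
        case False
        then have "x = \<one>\<^bsub>M j\<^esub>" using neg letter by blast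
        then show ?thesis using letter(1,3) y letter_one by auto
      qed
    qed
    have "H0 = {\<one>\<^bsub>\<P>\<^esub>}"
    proof -
      have "h = \<one>\<^bsub>\<P>\<^esub>" if h: "h \<in> H0" for h
      proof -
        have hc: "h \<in> carrier \<P>" by (rule subgroup.mem_carrier[OF sH0 h])
        obtain x where x: "x \<in> carrier (\<G> i)" "h = letter (Some i) x" using all[OF hc] by blast
        show ?thesis by (rule H0_conj[OF h P.one_closed i x(1)]) (use x(2) hc in simp)
      qed
      then show ?thesis using subgroup.one_closed[OF sH0] by blast
    qed
    then have "group_rank (\<P>\<lparr>carrier := H0\<rparr>) < 2"
      using P.cyclic_iff_group_rank[OF sH0] P.generate_one by auto
    then show False using H0(2) by simp
  qed
  have two: "\<exists>i\<in>I. \<exists>C. subgroup C (\<G> i) \<and> card C = 2" if sL: "subgroup L \<P>" and "ecard L = 2" for L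
  proof -
    have L: "finite L" "card L = 2" using that(2) ecard_eq_enat[of 2 L] by (auto simp: numeral_eq_enat)
    then have "L \<noteq> {\<one>\<^bsub>\<P>\<^esub>}" by auto
    then obtain j A where A: "j \<in> J" "subgroup A (M j)" "card A = card L" "finite A"
      using finite_subgroup_in_factor[OF sL L(1)] by blast
    then obtain i where "i \<in> I" "j = Some i" using factor_some[of j A] L(2) by auto
    then show ?thesis using A L(2) M by (intro bexI[of _ i] exI[of _ A]) auto
  qed
  show ?thesis
  proof (cases "alpha3 G")
    case (enat n)
    then obtain L where L: "subgroup L \<P>" "finite L" "card L = n" "n \<ge> 3"
      using alpha3_attained G by metis
    then have "L \<noteq> {\<one>\<^bsub>\<P>\<^esub>}" by auto
    then obtain j A where A: "j \<in> J" "subgroup A (M j)" "card A = n" "finite A"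
      using finite_subgroup_in_factor[OF L(1,2)] L(3) by blast
    then obtain i where i: "i \<in> I" "j = Some i" using factor_some[of j A] L(4) by auto
    obtain k t where t: "k \<in> J" "k \<noteq> j" "t \<in> carrier (M k)" "t \<noteq> \<one>\<^bsub>M k\<^esub>" using out[OF i(1)] i(2) by blast
    interpret Mk: group "M k" using factor_group t(1) .
    have t': "reduced [(k, t)]" "reduced [(k, inv\<^bsub>M k\<^esub> t)]" using t by (auto simp: reduced_Cons)
    have tt: "cl ([(k, t)] @ [(k, inv\<^bsub>M k\<^esub> t)]) = \<one>\<^bsub>\<P>\<^esub>"
      using t by (subst cl_append) (auto simp: letter_inv)
    \<comment> \<open>a second finite subgroup of the same factor is moved away from the first by conjugation\<close>
    have same: "ereal (real (n * card C) / real ((n - 1) * (card C - 1) - 1)) \<le> sigma_ratio \<P> \<F>"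
      if "subgroup C (M j)" "finite C" "card C \<ge> 2" for C
      using sigma_ratio_two_subgroups[OF A(1,2,4) _ A(1) that t'(1) _ t'(2) _ tt closed] A(3) L(4) t(2)
      by simp
    obtain m where m: "n = m + 3" using L(4) le_Suc_ex[of 3 n] by (auto simp: add.commute)
    have th: "theta (ereal_of_enat (alpha3 G)) = ereal (real n / (real n - 2))"
      using theta_enat[OF L(4)] enat by simp
    show ?thesis
    proof (cases "\<exists>L. subgroup L \<P> \<and> ecard L = 2")
      case True
      then obtain i' C where C: "i' \<in> I" "subgroup C (M (Some i'))" "card C = 2"
        using two M by metis
      then have fC: "finite C" by (metis card.infinite zero_neq_numeral)
      have "ereal (real (n * 2) / real ((n - 1) * (2 - 1) - 1)) \<le> sigma_ratio \<P> \<F>"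
      proof (cases "Some i' = j")
        case True
        then show ?thesis using same[of C] C fC by simp
      next
        case False
        then show ?thesis
          using sigma_ratio_two_subgroups[OF A(1,2,4) _ _ C(2) fC _ reduced_Nil _ reduced_Nil _ _ closed] A(3) L(4) C J(2)
          by (simp add: one_P)
      qed
      moreover have "real (n * 2) / real ((n - 1) * (2 - 1) - 1) = 2 * (real n / (real n - 2))"
        by (simp add: m)
      ultimately have "ereal (2 * (real n / (real n - 2))) \<le> sigma_ratio \<P> \<F>" by simp
      moreover have "beta2 G = ereal 2" using True by (simp add: beta2_def G)
      ultimately show ?thesis unfolding th by (simp add: G)
    next
      case False
      then have "beta2 G = 1" by (simp add: beta2_def G)
      moreover have "real (n * n) / real ((n - 1) * (n - 1) - 1) = real n / (real n - 2)"
      proof -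
        have "real ((n - 1) * (n - 1) - 1) = real n * (real n - 2)" by (simp add: m algebra_simps)
        then show ?thesis using L(4) by simp
      qed
      ultimately show ?thesis using same[of A] A L(4) th by (simp add: G)
    qed
  next
    case infinity
    then have th: "theta (ereal_of_enat (alpha3 G)) = 1" by (simp add: theta_def)
    show ?thesis
    proof (cases "\<exists>L. subgroup L \<P> \<and> ecard L = 2")
      case True
      then obtain i C where C: "i \<in> I" "subgroup C (M (Some i))" "card C = 2"
        using two M by metis
      let ?i = "Some i"
      have i: "?i \<in> J" using C(1) J by simp
      interpret Mi: group "M ?i" using factor_group i .
      obtain c where c: "c \<in> carrier (M ?i)" "c \<noteq> \<one>\<^bsub>M ?i\<^esub>" "c \<otimes>\<^bsub>M ?i\<^esub> c = \<one>\<^bsub>M ?i\<^esub>"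
        using Mi.order_two_involution[OF C(2,3)] by metis
      obtain j t where t: "j \<in> J" "j \<noteq> ?i" "t \<in> carrier (M j)" "t \<noteq> \<one>\<^bsub>M j\<^esub>" using out[OF C(1)] by blast
      interpret Mj: group "M j" using factor_group t(1) .
      have red: "reduced [(l, x)]" if "l \<in> J" "x \<in> carrier (M l)" "x \<noteq> \<one>\<^bsub>M l\<^esub>" for l x
        using that by (simp add: reduced_Cons)
      have "2 \<le> sigma_ratio \<P> \<F>"
      proof (rule ccontr)
        assume neg: "\<not> ?thesis"
        \<comment> \<open>With three involutions excluded, \<open>t\<close> is the only nontrivial letter outside of the factor of \<open>c\<close>; then
          \<open>t\<close> is an involution, \<open>c\<close> is the only nontrivial letter outside of its factor, and \<open>G\<close> is dihedral.\<close>
        have outside_i: "(l, x) = (j, t)" if "l \<in> J" "x \<in> carrier (M l)" "x \<noteq> \<one>\<^bsub>M l\<^esub>" "l \<noteq> ?i" for l x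
          using sigma_ratio_three_involutions[OF i c red[OF t(1,3,4)] _ red[OF that(1-3)] _ _ closed] neg t(2) that(4)
          by auto
        have tt: "t \<otimes>\<^bsub>M j\<^esub> t = \<one>\<^bsub>M j\<^esub>"
          using outside_i[of j "t \<otimes>\<^bsub>M j\<^esub> t"] t Mj.l_cancel_one[of t t] by auto
        have outside_j: "(l, x) = (?i, c)" if "l \<in> J" "x \<in> carrier (M l)" "x \<noteq> \<one>\<^bsub>M l\<^esub>" "l \<noteq> j" for l x
          using sigma_ratio_three_involutions[OF t(1,3,4) tt red[OF i c(1,2)] _ red[OF that(1-3)] _ _ closed] neg t(2) that(4)
          by auto
        have only: "(l, x) = (?i, c) \<or> (l, x) = (j, t)" if "l \<in> J" "x \<in> carrier (M l)" "x \<noteq> \<one>\<^bsub>M l\<^esub>" for l x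
          using outside_i[OF that] outside_j[OF that] t(2) by (cases "l = ?i") auto
        have "{\<one>\<^bsub>M j\<^esub>, t} \<subseteq> carrier (M j)" using t by simp
        then have "subgroup {\<one>\<^bsub>M j\<^esub>, t} (M j)"
          using tt t Mj.inv_equality[of t t] by (intro Mj.subgroupI) auto
        then obtain j' where j': "j' \<in> I" "j = Some j'"
          using factor_some[OF t(1), of "{\<one>\<^bsub>M j\<^esub>, t}"] t by (auto simp: card_insert_if)
        have "g = \<one>\<^bsub>\<P>\<^esub>" if g: "g \<in> H0" "g \<otimes>\<^bsub>\<P>\<^esub> g = \<one>\<^bsub>\<P>\<^esub>" for g
        proof (rule ccontr)
          assume ne: "g \<noteq> \<one>\<^bsub>\<P>\<^esub>"
          have gc: "g \<in> carrier \<P>" by (rule subgroup.mem_carrier[OF sH0 g(1)])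
          have "g [^]\<^bsub>\<P>\<^esub> (2 :: nat) = \<one>\<^bsub>\<P>\<^esub>" using g(2) gc by (simp add: numeral_2_eq_2)
          then have "conj_letter g" using torsion_conj_letter[OF gc, of 2] ne by simp
          then obtain p l x where p: "p \<in> carrier \<P>" "l \<in> J" "x \<in> carrier (M l)"
            "g = p \<otimes>\<^bsub>\<P>\<^esub> letter l x \<otimes>\<^bsub>\<P>\<^esub> inv\<^bsub>\<P>\<^esub> p"
            unfolding conj_letter_def by blast
          then have "x \<noteq> \<one>\<^bsub>M l\<^esub>" using ne letter_one by auto
          then have "\<exists>l'\<in>I. l = Some l'" using only[OF p(2,3)] C(1) j' by auto
          then show False using H0_conj[OF g(1) p(1)] p(3,4) M ne by auto
        qed
        then have "group_rank (\<P>\<lparr>carrier := H0\<rparr>) < 2"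
          using dihedral_free_product_cyclic[OF i c(1,3) t(1,3) tt only sH0] by blast
        then show False using H0(2) by simp
      qed
      moreover have "beta2 G = 2" using True by (simp add: beta2_def G)
      ultimately show ?thesis unfolding th by (simp add: G)
    next
      case False
      then have b: "beta2 G = 1" by (simp add: beta2_def G)
      obtain S where S: "finite S" "generate \<P> S = H0"
        using H0F unfolding fin_gen_subgroup_def by blast
      obtain x y where xy: "x \<in> H0" "y \<in> H0" "2 \<le> group_rank (\<P>\<lparr>carrier := generate \<P> {x, y}\<rparr>)"
        using P.noncyclic_two_generated[OF sH0 S H0(2)] by blast
      let ?K = "generate \<P> {x, y}"
      have xyc: "{x, y} \<subseteq> carrier \<P>" using xy subgroup.subset[OF sH0] by blast
      have K: "subgroup ?K \<P>" by (rule P.generate_is_subgroup[OF xyc])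
      have "?K \<subseteq> H0" using xy by (intro P.generate_subgroup_incl[OF _ sH0]) auto
      have "?K \<in> \<F>"
        unfolding \<F>_iff
      proof (intro conjI ballI)
        show "fin_gen_subgroup ?K \<P>"
          unfolding fin_gen_subgroup_def using K xyc by (intro conjI exI[of _ "{x, y}"]) auto
        fix g i assume gi: "g \<in> carrier \<P>" "i \<in> I"
        then have "H0 \<inter> conjugate \<P> (letter (Some i) ` carrier (\<G> i)) g = {\<one>\<^bsub>\<P>\<^esub>}"
          using H0F by simp
        then show "?K \<inter> conjugate \<P> (letter (Some i) ` carrier (\<G> i)) g = {\<one>\<^bsub>\<P>\<^esub>}"
          using \<open>?K \<subseteq> H0\<close> subgroup.one_closed[OF K] by blast
      qed
      have "group_rank (\<P>\<lparr>carrier := ?K\<rparr>) \<le> enat (card {x, y})"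
        by (rule P.group_rank_le[OF K]) auto
      also have "\<dots> \<le> enat 2" by (simp add: card_insert_if)
      finally have r: "group_rank (\<P>\<lparr>carrier := ?K\<rparr>) \<le> enat 2" .
      have "ereal (real 1 / (real (2 - 1) * real (2 - 1))) \<le> sigma_ratio \<P> \<F>"
        by (rule P.sigma_ratio_lower_bound[OF \<open>?K \<in> \<F>\<close> \<open>?K \<in> \<F>\<close> K K r r])
          (use xy(3) in \<open>simp_all add: numeral_eq_enat numeral_2_eq_2\<close>)
      then show ?thesis using b th by (simp add: G one_ereal_def)
    qed
  qed
qed

end
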